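(* Let $\mathfrak{f}$ be a free Lie algebra over $\mathbb{Z}$ of rank two and let $\hat{\mathfrak{f}}=\varprojlim \mathfrak{f}/\gamma_i(\mathfrak{f})$ be its pronilpotent completion. Then the homology group $H_2(\hat{\mathfrak{f}},\mathbb{Z})$ contains a nonzero $2$-divisible element, i.e. a nonzero element $z$ such that for every $k\ge 1$ there is $z_k\in H_2(\hat{\mathfrak{f}},\mathbb{Z})$ with $z=2^k z_k$. Hence, the cohomological dimension of $\hat{\mathfrak{f}}$ is greater than two.
   Context: For a Lie algebra $\mathfrak{g}$, $\gamma_i(\mathfrak{g})$ is the lower central series ($\gamma_1(\mathfrak{g})=\mathfrak{g}$, $\gamma_{i+1}(\mathfrak{g})=[\gamma_i(\mathfrak{g}),\mathfrak{g}]$). Homology of a Lie algebra $\mathfrak{g}$ over $\mathbb{Z}$ is $H_i(\mathfrak{g},\mathbb{Z})=\mathrm{Tor}_i^{U(\mathfrak{g})}(\mathbb{Z},\mathbb{Z})$, where $U(\mathfrak{g})$ is the universal enveloping algebra and $\mathbb{Z}$ the trivial module; cohomology is $H^i(\mathfrak{g},M)=\mathrm{Ext}^i_{U(\mathfrak{g})}(\mathbb{Z},M)$. The cohomological dimension of $\mathfrak{g}$ is the projective dimension of the trivial module $\mathbb{Z}$ over $U(\mathfrak{g})$, i.e. the supremum of the $n$ such that $H^n(\mathfrak{g},M)\ne0$ for some $U(\mathfrak{g})$-module $M$. *)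

theory Defs
  imports "HOL-Algebra.Algebra" "HOL-Library.Extended_Nat"
begin

section \<open>Lie rings\<close>

text \<open>
  A Lie algebra over the integers is a record of type \<^typ>\<open>'a ring\<close> whose multiplication
  \<open>\<otimes>\<close> is the Lie bracket; the field \<open>\<one>\<close> carries no information.
\<close>

locale nonassoc_ring = abelian_group L for L (structure) +
  assumes prod_closed: "\<lbrakk>x \<in> carrier L; y \<in> carrier L\<rbrakk> \<Longrightarrow> x \<otimes> y \<in> carrier L"
    and prod_add_left: "\<lbrakk>x \<in> carrier L; y \<in> carrier L; z \<in> carrier L\<rbrakk>
      \<Longrightarrow> (x \<oplus> y) \<otimes> z = (x \<otimes> z) \<oplus> (y \<otimes> z)"
    and prod_add_right: "\<lbrakk>x \<in> carrier L; y \<in> carrier L; z \<in> carrier L\<rbrakk>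
      \<Longrightarrow> z \<otimes> (x \<oplus> y) = (z \<otimes> x) \<oplus> (z \<otimes> y)"

locale lie_ring = nonassoc_ring +
  assumes bracket_self: "x \<in> carrier L \<Longrightarrow> x \<otimes> x = \<zero>"
    and jacobi: "\<lbrakk>x \<in> carrier L; y \<in> carrier L; z \<in> carrier L\<rbrakk>
      \<Longrightarrow> (x \<otimes> (y \<otimes> z)) \<oplus> (y \<otimes> (z \<otimes> x)) \<oplus> (z \<otimes> (x \<otimes> y)) = \<zero>"

subsection \<open>The free Lie ring\<close>

text \<open>
  The free Lie ring on \<open>S\<close> is the free nonassociative ring on \<open>S\<close> (the integral magma ring of the
  free magma on \<open>S\<close>) modulo the two-sided ideal generated by all squares and Jacobi sums.
\<close>

datatype 'x magma = Gen 'x | Mul "'x magma" "'x magma"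

definition free_nonassoc_ring :: "'x set \<Rightarrow> ('x magma \<Rightarrow>\<^sub>0 int) ring" where
  "free_nonassoc_ring S =
    \<lparr>carrier = {p. Poly_Mapping.keys p \<subseteq> {t. set_magma t \<subseteq> S}},
     monoid.mult = (\<lambda>p q. frag_extend (\<lambda>s. frag_extend (\<lambda>t. frag_of (Mul s t)) q) p),
     one = 0, ring.zero = 0, add = (+)\<rparr>"

text \<open>The library's \<^locale>\<open>ideal\<close> presupposes an associative ring with unit.\<close>

definition nonassoc_ideal :: "'a set \<Rightarrow> ('a, 'm) ring_scheme \<Rightarrow> bool" where
  "nonassoc_ideal I R \<longleftrightarrow> additive_subgroup I R \<and>
    (\<forall>a\<in>I. \<forall>r\<in>carrier R. a \<otimes>\<^bsub>R\<^esub> r \<in> I \<and> r \<otimes>\<^bsub>R\<^esub> a \<in> I)"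

definition lie_relators :: "('a, 'm) ring_scheme \<Rightarrow> 'a set" where
  "lie_relators R = {x \<otimes>\<^bsub>R\<^esub> x | x. x \<in> carrier R} \<union>
    {(x \<otimes>\<^bsub>R\<^esub> (y \<otimes>\<^bsub>R\<^esub> z)) \<oplus>\<^bsub>R\<^esub> (y \<otimes>\<^bsub>R\<^esub> (z \<otimes>\<^bsub>R\<^esub> x)) \<oplus>\<^bsub>R\<^esub> (z \<otimes>\<^bsub>R\<^esub> (x \<otimes>\<^bsub>R\<^esub> y)) | x y z.
      x \<in> carrier R \<and> y \<in> carrier R \<and> z \<in> carrier R}"

definition lie_ideal :: "('a, 'm) ring_scheme \<Rightarrow> 'a set" where
  "lie_ideal R = \<Inter>{I. nonassoc_ideal I R \<and> lie_relators R \<subseteq> I}"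

definition free_lie_ring :: "'x set \<Rightarrow> ('x magma \<Rightarrow>\<^sub>0 int) set ring" where
  "free_lie_ring S = free_nonassoc_ring S Quot lie_ideal (free_nonassoc_ring S)"

subsection \<open>Lower central series and pronilpotent completion\<close>

text \<open>Indexing starts at 0: \<open>lower_central L n\<close> is \<open>\<gamma>\<close> with index \<open>n + 1\<close>.\<close>

primrec lower_central :: "('a, 'm) ring_scheme \<Rightarrow> nat \<Rightarrow> 'a set" where
  "lower_central L 0 = carrier L"
| "lower_central L (Suc n) =
    generate (add_monoid L) {x \<otimes>\<^bsub>L\<^esub> y | x y. x \<in> lower_central L n \<and> y \<in> carrier L}"

text \<open>
  The inverse limit consists of the compatible sequences of cosets; the transition map sends a
  coset \<open>C\<close> of the smaller ideal to the coset \<open>\<gamma> + C\<close> of the larger one.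
\<close>

definition pronilpotent_completion :: "('a, 'm) ring_scheme \<Rightarrow> (nat \<Rightarrow> 'a set) ring" where
  "pronilpotent_completion L =
    \<lparr>carrier = {s. (\<forall>i. s i \<in> carrier (L Quot lower_central L i)) \<and>
                   (\<forall>i. lower_central L i <+>\<^bsub>L\<^esub> s (Suc i) = s i)},
     monoid.mult = (\<lambda>s t i. s i \<otimes>\<^bsub>L Quot lower_central L i\<^esub> t i),
     one = (\<lambda>i. \<one>\<^bsub>L Quot lower_central L i\<^esub>),
     ring.zero = (\<lambda>i. \<zero>\<^bsub>L Quot lower_central L i\<^esub>),
     add = (\<lambda>s t i. s i \<oplus>\<^bsub>L Quot lower_central L i\<^esub> t i)\<rparr>"

section \<open>The universal enveloping ring\<close>

definition free_ring :: "'a set \<Rightarrow> ('a list \<Rightarrow>\<^sub>0 int) ring" where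
  "free_ring S =
    \<lparr>carrier = {p. Poly_Mapping.keys p \<subseteq> lists S},
     monoid.mult = (\<lambda>p q. frag_extend (\<lambda>v. frag_extend (\<lambda>w. frag_of (v @ w)) q) p),
     one = frag_of [], ring.zero = 0, add = (+)\<rparr>"

text \<open>
  The additivity relators cut the free ring on the underlying set of \<open>L\<close> down to the tensor
  algebra of the abelian group \<open>L\<close>.
\<close>

definition uea_relators :: "('a, 'm) ring_scheme \<Rightarrow> ('a list \<Rightarrow>\<^sub>0 int) set" where
  "uea_relators L =
    {frag_of [x \<oplus>\<^bsub>L\<^esub> y] - frag_of [x] - frag_of [y] | x y. x \<in> carrier L \<and> y \<in> carrier L} \<union>
    {frag_of [x, y] - frag_of [y, x] - frag_of [x \<otimes>\<^bsub>L\<^esub> y] | x y. x \<in> carrier L \<and> y \<in> carrier L}"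

definition universal_enveloping :: "('a, 'm) ring_scheme \<Rightarrow> ('a list \<Rightarrow>\<^sub>0 int) set ring" where
  "universal_enveloping L =
    free_ring (carrier L) Quot genideal (free_ring (carrier L)) (uea_relators L)"

text \<open>
  All elements of the defining ideal have constant term 0, so the constant term is well defined on
  cosets. This is the ring homomorphism to the integers that kills \<open>L\<close>.
\<close>

definition uea_augmentation :: "('a list \<Rightarrow>\<^sub>0 int) set \<Rightarrow> int" where
  "uea_augmentation C = (THE n. \<forall>p\<in>C. Poly_Mapping.lookup p [] = n)"

section \<open>Modules over noncommutative rings\<close>

text \<open>
  The library's \<^locale>\<open>module\<close> requires a commutative ring. As there, the fields \<open>\<otimes>\<close> and \<open>\<one>\<close> of
  a module record are irrelevant.
\<close>

locale left_module = R?: ring R + M?: abelian_group M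
  for R :: "('r, 'k) ring_scheme" (structure) and M :: "('r, 'm, 'n) module_scheme" (structure) +
  assumes lsmult_closed: "\<lbrakk>a \<in> carrier R; x \<in> carrier M\<rbrakk> \<Longrightarrow> a \<odot>\<^bsub>M\<^esub> x \<in> carrier M"
    and lsmult_l_distr: "\<lbrakk>a \<in> carrier R; b \<in> carrier R; x \<in> carrier M\<rbrakk>
      \<Longrightarrow> (a \<oplus> b) \<odot>\<^bsub>M\<^esub> x = a \<odot>\<^bsub>M\<^esub> x \<oplus>\<^bsub>M\<^esub> b \<odot>\<^bsub>M\<^esub> x"
    and lsmult_r_distr: "\<lbrakk>a \<in> carrier R; x \<in> carrier M; y \<in> carrier M\<rbrakk>
      \<Longrightarrow> a \<odot>\<^bsub>M\<^esub> (x \<oplus>\<^bsub>M\<^esub> y) = a \<odot>\<^bsub>M\<^esub> x \<oplus>\<^bsub>M\<^esub> a \<odot>\<^bsub>M\<^esub> y"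
    and lsmult_assoc: "\<lbrakk>a \<in> carrier R; b \<in> carrier R; x \<in> carrier M\<rbrakk>
      \<Longrightarrow> (a \<otimes> b) \<odot>\<^bsub>M\<^esub> x = a \<odot>\<^bsub>M\<^esub> (b \<odot>\<^bsub>M\<^esub> x)"
    and lsmult_one: "x \<in> carrier M \<Longrightarrow> \<one> \<odot>\<^bsub>M\<^esub> x = x"

text \<open>The integers as a module over the enveloping ring; it serves as a left and as a right module.\<close>

definition trivial_module :: "(('a list \<Rightarrow>\<^sub>0 int) set, int) module" where
  "trivial_module =
    \<lparr>carrier = UNIV, monoid.mult = (*), one = 1, ring.zero = 0, add = (+),
     smult = (\<lambda>u n. uea_augmentation u * n)\<rparr>"

definition free_module :: "('r, 'k) ring_scheme \<Rightarrow> 'i set \<Rightarrow> ('r, 'i \<Rightarrow> 'r) module" where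
  "free_module R I =
    \<lparr>carrier = {f. range f \<subseteq> carrier R \<and> finite {i. f i \<noteq> \<zero>\<^bsub>R\<^esub>} \<and> {i. f i \<noteq> \<zero>\<^bsub>R\<^esub>} \<subseteq> I},
     monoid.mult = undefined, one = undefined,
     ring.zero = (\<lambda>_. \<zero>\<^bsub>R\<^esub>), add = (\<lambda>f g i. f i \<oplus>\<^bsub>R\<^esub> g i),
     smult = (\<lambda>r f i. r \<otimes>\<^bsub>R\<^esub> f i)\<rparr>"

definition hom_group :: "('r, 'k) ring_scheme \<Rightarrow> ('r, 'p, 'm) module_scheme \<Rightarrow>
    ('r, 'b, 'n) module_scheme \<Rightarrow> ('p \<Rightarrow> 'b) monoid" where
  "hom_group R P M =
    \<lparr>carrier = {h \<in> carrier P \<rightarrow>\<^sub>E carrier M.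
        (\<forall>x\<in>carrier P. \<forall>y\<in>carrier P. h (x \<oplus>\<^bsub>P\<^esub> y) = h x \<oplus>\<^bsub>M\<^esub> h y) \<and>
        (\<forall>r\<in>carrier R. \<forall>x\<in>carrier P. h (r \<odot>\<^bsub>P\<^esub> x) = r \<odot>\<^bsub>M\<^esub> h x)},
     monoid.mult = (\<lambda>h k. \<lambda>x\<in>carrier P. h x \<oplus>\<^bsub>M\<^esub> k x),
     one = (\<lambda>x\<in>carrier P. \<zero>\<^bsub>M\<^esub>)\<rparr>"

text \<open>
  Tensor product of a right module \<open>A\<close> and a left module \<open>B\<close>; the right action of \<open>r\<close> on \<open>a\<close> is
  written \<open>r \<odot> a\<close>.
\<close>

definition tensor_relators :: "('r, 'k) ring_scheme \<Rightarrow> ('r, 'a, 'm) module_scheme \<Rightarrow>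
    ('r, 'b, 'n) module_scheme \<Rightarrow> ('a \<times> 'b \<Rightarrow>\<^sub>0 int) set" where
  "tensor_relators R A B =
    {frag_of (a \<oplus>\<^bsub>A\<^esub> a', b) - frag_of (a, b) - frag_of (a', b) | a a' b.
      a \<in> carrier A \<and> a' \<in> carrier A \<and> b \<in> carrier B} \<union>
    {frag_of (a, b \<oplus>\<^bsub>B\<^esub> b') - frag_of (a, b) - frag_of (a, b') | a b b'.
      a \<in> carrier A \<and> b \<in> carrier B \<and> b' \<in> carrier B} \<union>
    {frag_of (r \<odot>\<^bsub>A\<^esub> a, b) - frag_of (a, r \<odot>\<^bsub>B\<^esub> b) | a r b.
      a \<in> carrier A \<and> r \<in> carrier R \<and> b \<in> carrier B}"

definition tensor_subgroup :: "('r, 'k) ring_scheme \<Rightarrow> ('r, 'a, 'm) module_scheme \<Rightarrow>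
    ('r, 'b, 'n) module_scheme \<Rightarrow> ('a \<times> 'b \<Rightarrow>\<^sub>0 int) set" where
  "tensor_subgroup R A B =
    generate (free_Abelian_group (carrier A \<times> carrier B)) (tensor_relators R A B)"

definition tensor_group :: "('r, 'k) ring_scheme \<Rightarrow> ('r, 'a, 'm) module_scheme \<Rightarrow>
    ('r, 'b, 'n) module_scheme \<Rightarrow> ('a \<times> 'b \<Rightarrow>\<^sub>0 int) set monoid" where
  "tensor_group R A B = free_Abelian_group (carrier A \<times> carrier B) Mod tensor_subgroup R A B"

text \<open>The map \<open>A \<otimes> B \<rightarrow> A \<otimes> B'\<close> induced by a homomorphism \<open>h\<close> from \<open>B\<close> to \<open>B'\<close>, on cosets.\<close>

definition tensor_map :: "('r, 'k) ring_scheme \<Rightarrow> ('r, 'a, 'm) module_scheme \<Rightarrow>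
    ('r, 'c, 'n) module_scheme \<Rightarrow> ('b \<Rightarrow> 'c) \<Rightarrow>
    ('a \<times> 'b \<Rightarrow>\<^sub>0 int) set \<Rightarrow> ('a \<times> 'c \<Rightarrow>\<^sub>0 int) set" where
  "tensor_map R A B' h C =
    tensor_subgroup R A B' <#>\<^bsub>free_Abelian_group (carrier A \<times> carrier B')\<^esub>
      frag_extend (\<lambda>(a, b). frag_of (a, h b)) ` C"

section \<open>Free resolutions, Tor and Ext\<close>

text \<open>
  Every left module \<open>M\<close> has a standard free resolution: degree 0 is free on the elements of \<open>M\<close>, and
  degree \<open>n + 1\<close> is free on names for the cycles of degree \<open>n\<close>, a cycle being named by any
  list of coefficients and basis elements that represents it. The datatype of names keeps all
  degrees in a single type.
\<close>

datatype ('r, 'm) cell = Point (point: 'm) | Cell (syzygy: "('r \<times> ('r, 'm) cell) list")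

primrec combination :: "('r, 'k) ring_scheme \<Rightarrow> ('r \<times> 'i) list \<Rightarrow> 'i \<Rightarrow> 'r" where
  "combination R [] = (\<lambda>_. \<zero>\<^bsub>R\<^esub>)"
| "combination R (x # xs) =
    (\<lambda>i. (if i = snd x then fst x else \<zero>\<^bsub>R\<^esub>) \<oplus>\<^bsub>R\<^esub> combination R xs i)"

definition resolution_aug :: "('r, 'k) ring_scheme \<Rightarrow> ('r, 'm, 'n) module_scheme \<Rightarrow>
    (('r, 'm) cell \<Rightarrow> 'r) \<Rightarrow> 'm" where
  "resolution_aug R M f = (\<Oplus>\<^bsub>M\<^esub>c\<in>{c. f c \<noteq> \<zero>\<^bsub>R\<^esub>}. f c \<odot>\<^bsub>M\<^esub> point c)"

definition resolution_bd :: "('r, 'k) ring_scheme \<Rightarrow>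
    (('r, 'm) cell \<Rightarrow> 'r) \<Rightarrow> (('r, 'm) cell \<Rightarrow> 'r)" where
  "resolution_bd R f =
    (\<lambda>e. \<Oplus>\<^bsub>R\<^esub>c\<in>{c. f c \<noteq> \<zero>\<^bsub>R\<^esub>}. f c \<otimes>\<^bsub>R\<^esub> combination R (syzygy c) e)"

primrec cells :: "('r, 'k) ring_scheme \<Rightarrow> ('r, 'm, 'n) module_scheme \<Rightarrow> nat \<Rightarrow> ('r, 'm) cell set" where
  "cells R M 0 = Point ` carrier M"
| "cells R M (Suc n) = {Cell xs | xs. set xs \<subseteq> carrier R \<times> cells R M n \<and>
    (if n = 0 then resolution_aug R M (combination R xs) = \<zero>\<^bsub>M\<^esub>
     else resolution_bd R (combination R xs) = (\<lambda>_. \<zero>\<^bsub>R\<^esub>))}"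

definition resolution :: "('r, 'k) ring_scheme \<Rightarrow> ('r, 'm, 'n) module_scheme \<Rightarrow> nat \<Rightarrow>
    ('r, ('r, 'm) cell \<Rightarrow> 'r) module" where
  "resolution R M n = free_module R (cells R M n)"

text \<open>
  The differential from degree \<open>n\<close> to degree \<open>n - 1\<close> of the deleted complex. In degree 0 it is the
  zero map (into degree \<open>0 - 1 = 0\<close>), so that the formulas below hold for \<open>n = 0\<close> as well.
\<close>

definition differential :: "('r, 'k) ring_scheme \<Rightarrow> nat \<Rightarrow>
    (('r, 'm) cell \<Rightarrow> 'r) \<Rightarrow> (('r, 'm) cell \<Rightarrow> 'r)" where
  "differential R n = (if n = 0 then (\<lambda>_ _. \<zero>\<^bsub>R\<^esub>) else resolution_bd R)"

text \<open>Homology at \<open>B\<close> of \<open>f : A \<rightarrow> B\<close> followed by \<open>g : B \<rightarrow> C\<close>, as a multiplicative group.\<close>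

definition homology_at :: "('a, 'k) monoid_scheme \<Rightarrow> ('a \<Rightarrow> 'b) \<Rightarrow> 'b monoid \<Rightarrow>
    ('b \<Rightarrow> 'c) \<Rightarrow> ('c, 'l) monoid_scheme \<Rightarrow> 'b set monoid" where
  "homology_at A f B g C = B\<lparr>carrier := kernel B C g\<rparr> Mod (f ` carrier A)"

definition Tor :: "nat \<Rightarrow> ('r, 'k) ring_scheme \<Rightarrow> ('r, 'a, 'm) module_scheme \<Rightarrow>
    ('r, 'b, 'n) module_scheme \<Rightarrow> ('a \<times> (('r, 'b) cell \<Rightarrow> 'r) \<Rightarrow>\<^sub>0 int) set set monoid" where
  "Tor n R A B = homology_at
    (tensor_group R A (resolution R B (n + 1)))
    (tensor_map R A (resolution R B n) (differential R (n + 1)))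
    (tensor_group R A (resolution R B n))
    (tensor_map R A (resolution R B (n - 1)) (differential R n))
    (tensor_group R A (resolution R B (n - 1)))"

definition Ext :: "nat \<Rightarrow> ('r, 'k) ring_scheme \<Rightarrow> ('r, 'b, 'n) module_scheme \<Rightarrow>
    ('r, 'a, 'm) module_scheme \<Rightarrow> ((('r, 'b) cell \<Rightarrow> 'r) \<Rightarrow> 'a) set monoid" where
  "Ext n R B A = homology_at
    (hom_group R (resolution R B (n - 1)) A)
    (\<lambda>h. \<lambda>x\<in>carrier (resolution R B n). h (differential R n x))
    (hom_group R (resolution R B n) A)
    (\<lambda>h. \<lambda>x\<in>carrier (resolution R B (n + 1)). h (differential R (n + 1) x))
    (hom_group R (resolution R B (n + 1)) A)"

section \<open>Homology and cohomological dimension of Lie rings\<close>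

definition lie_homology :: "nat \<Rightarrow> ('a, 'm) ring_scheme \<Rightarrow> _ monoid" where
  "lie_homology n L = Tor n (universal_enveloping L) trivial_module trivial_module"

definition lie_cohomology :: "nat \<Rightarrow> ('a, 'm) ring_scheme \<Rightarrow>
    (('a list \<Rightarrow>\<^sub>0 int) set, 'b, 'n) module_scheme \<Rightarrow> _ monoid" where
  "lie_cohomology n L M = Ext n (universal_enveloping L) trivial_module M"

definition cohomological_dimension :: "('a, 'm) ring_scheme \<Rightarrow> enat" where
  "cohomological_dimension L = Sup {enat n | n.
    \<exists>M :: (('a list \<Rightarrow>\<^sub>0 int) set,
           (('a list \<Rightarrow>\<^sub>0 int) set, int) cell \<Rightarrow> ('a list \<Rightarrow>\<^sub>0 int) set) module.
      left_module (universal_enveloping L) M \<and>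
      carrier (lie_cohomology n L M) \<noteq> {\<one>\<^bsub>lie_cohomology n L M\<^esub>}}"

end

theory Submission
  imports Defs "HOL-Library.Function_Algebras"
begin

text \<open>
  Write \<open>x\<close>, \<open>y\<close> for the generators and \<open>y j\<close> for the result of applying \<open>[x, -]\<close> to \<open>y\<close> exactly \<open>j\<close> times.
  Because \<open>[x, -]\<close> is a derivation and \<open>[y m, y m] = 0\<close>, the alternating sum \<open>w m\<close> of the brackets
  \<open>[y i, y (2 m - 1 - i)]\<close> with \<open>i < m\<close> telescopes to \<open>[x, w m] = [y, y (2 m)]\<close>. For any integers \<open>g m\<close>
  the completion contains the sums \<open>A\<close> of the \<open>g m * y (2 m)\<close> and \<open>B\<close> of the \<open>g m * w m\<close>, and
  \<open>y \<and> A - x \<and> B\<close> is a cycle because \<open>[y, A] = [x, B]\<close>. Its class is additive in \<open>g\<close>. It vanishes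
  when \<open>g\<close> is supported on one index, since the telescoping can be repeated with the boundaries of the
  chains \<open>x \<and> y i \<and> y j\<close> (\<open>wedge_leibniz\<close>, \<open>wedge_primitive\<close>). So finitely many coefficients can be
  dropped, and if \<open>2 ^ m\<close> divides \<open>g m\<close> for all \<open>m\<close>, then the class is divisible by every power of 2
  (\<open>hat_class_divisible\<close>).

  The class is nonzero for a suitable \<open>g\<close>. Modulo brackets with three factors \<open>y\<close>, the part of an element
  that has two factors \<open>y\<close> is a matrix, or power series in two variables \<open>s\<close>, \<open>t\<close>, on which \<open>[x, -]\<close>
  acts as multiplication by \<open>s + t\<close>. Brackets of elements linear in \<open>y\<close> contribute matrices of finite rank.
  If a linear functional \<open>lam\<close> kills all matrices of finite rank, \<open>p\<close> is the coefficient of \<open>x\<close>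
  and \<open>M\<close> is the matrix part, then \<open>p a * lam (M b) - p b * lam (M a)\<close> is a cocycle. On the cycle it
  takes the value \<open>- lam (M B)\<close>, and \<open>M B\<close> contains the Hankel matrix of \<open>g\<close>. For a
  lacunary \<open>g\<close> this matrix has infinite rank (\<open>hankel_infinite_rank\<close>), so \<open>lam\<close> can be chosen to be 1 on
  \<open>M B\<close> (\<open>separating_functional\<close>). The cocycle is evaluated on the standard resolution as the connecting
  map of an extension of modules over the enveloping ring (\<open>eval1_null\<close>, \<open>eval1_wedge\<close>).

  To compute in the standard resolution, tensoring a free module with the integers is identified with
  replacing coefficients by their augmentations (\<open>tensor_subgroup_iff\<close>). The second Tor group becomes the
  quotient of the degree 1 cycles with augmentation zero by the product of the augmentation
  ideal with the cycles (\<open>zeta_eq_one_iff\<close>), and the chains \<open>a \<and> b\<close> have explicit representatives there.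

  The statement on the cohomological dimension follows formally. If cohomology in degree 3 with
  coefficients in the degree 2 cycles vanished, these cycles would be a direct summand of the degree 2
  chains, and the second homology group would embed into a free abelian group, which has no nonzero
  2-divisible elements (\<open>divisible_Tor_imp_Ext\<close>).
\<close>

section \<open>Linear extension of functions on a basis\<close>

definition lin_ext :: "('k \<Rightarrow> 'b::comm_ring_1) \<Rightarrow> ('k \<Rightarrow>\<^sub>0 int) \<Rightarrow> 'b" where
  "lin_ext F p = (\<Sum>k\<in>Poly_Mapping.keys p. of_int (Poly_Mapping.lookup p k) * F k)"

lemma lin_ext_superset:
  assumes "finite A" "Poly_Mapping.keys p \<subseteq> A"
  shows "lin_ext F p = (\<Sum>k\<in>A. of_int (Poly_Mapping.lookup p k) * F k)"
  unfolding lin_ext_def by (rule sum.mono_neutral_left) (use assms in \<open>auto simp: in_keys_iff\<close>)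

lemma lin_ext_0 [simp]: "lin_ext F 0 = 0"
  by (simp add: lin_ext_def)

lemma lin_ext_frag_of [simp]: "lin_ext F (frag_of k) = F k"
  by (simp add: lin_ext_def)

lemma lin_ext_add: "lin_ext F (p + q) = lin_ext F p + lin_ext F q"
proof -
  let ?A = "Poly_Mapping.keys p \<union> Poly_Mapping.keys q"
  have "lin_ext F (p + q) = (\<Sum>k\<in>?A. of_int (Poly_Mapping.lookup (p + q) k) * F k)"
    by (rule lin_ext_superset) (use Poly_Mapping.keys_add [of p q] in auto)
  also have "\<dots> = (\<Sum>k\<in>?A. of_int (Poly_Mapping.lookup p k) * F k)
      + (\<Sum>k\<in>?A. of_int (Poly_Mapping.lookup q k) * F k)"
    by (simp add: lookup_add distrib_right sum.distrib)
  also have "\<dots> = lin_ext F p + lin_ext F q"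
    by (subst (1 2) lin_ext_superset [of ?A]) auto
  finally show ?thesis .
qed

lemma lin_ext_uminus: "lin_ext F (- p) = - lin_ext F p"
proof -
  have "lin_ext F (- p) + lin_ext F p = 0"
    by (metis lin_ext_add lin_ext_0 add.left_inverse)
  then show ?thesis by (simp add: eq_neg_iff_add_eq_0)
qed

lemma lin_ext_diff: "lin_ext F (p - q) = lin_ext F p - lin_ext F q"
  using lin_ext_add [of F p "- q"] by (simp add: lin_ext_uminus)

lemma lin_ext_frag_extend: "lin_ext F (frag_extend g p) = lin_ext (\<lambda>k. lin_ext F (g k)) p"
  using subset_UNIV [of "Poly_Mapping.keys p"]
  by (induction p rule: frag_induction) (auto simp: frag_extend_diff lin_ext_diff)

lemma lin_ext_cong: "(\<And>k. k \<in> Poly_Mapping.keys p \<Longrightarrow> F k = G k) \<Longrightarrow> lin_ext F p = lin_ext G p"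
  by (simp add: lin_ext_def)

lemma lin_ext_fun_add: "lin_ext (\<lambda>k. F k + G k) p = lin_ext F p + lin_ext G p"
  by (simp add: lin_ext_def distrib_left sum.distrib)

lemma lin_ext_fun_0 [simp]: "lin_ext (\<lambda>k. 0) p = 0"
  by (simp add: lin_ext_def)

lemma lin_ext_fun_cmult: "lin_ext (\<lambda>k. c * F k) p = c * lin_ext F p"
  by (simp add: lin_ext_def sum_distrib_left ac_simps)

lemma lin_ext_fun_multc: "lin_ext (\<lambda>k. F k * c) p = lin_ext F p * c"
  by (simp add: lin_ext_def sum_distrib_right mult.assoc)

text \<open>The functionals \<open>h\<close> that occur are built from coordinates of brackets and of iterated actions; this
  lets them pass under a formal integer combination.\<close>

lemma linear_lin_ext:
  fixes h :: "('i \<Rightarrow> real) \<Rightarrow> real"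
  assumes "\<And>r s c d. h (\<lambda>i. r * c i + s * d i) = r * h c + s * h d"
  shows "h (\<lambda>i. lin_ext (\<lambda>w. G w i) q) = lin_ext (\<lambda>w. h (G w)) q"
  using subset_UNIV [of "Poly_Mapping.keys q"]
proof (induction q rule: frag_induction)
  case zero
  then show ?case using assms [of 0 "\<lambda>_. 0" 0 "\<lambda>_. 0"] by simp
next
  case (diff a b)
  then show ?case
    using assms [of 1 "\<lambda>i. lin_ext (\<lambda>w. G w i) a" "-1" "\<lambda>i. lin_ext (\<lambda>w. G w i) b"]
    by (simp add: lin_ext_diff)
qed simp

section \<open>Free modules\<close>

lemma free_module_carrier:
  "f \<in> carrier (free_module R I) \<longleftrightarrow>
    (\<forall>i. f i \<in> carrier R) \<and> finite {i. f i \<noteq> \<zero>\<^bsub>R\<^esub>} \<and> {i. f i \<noteq> \<zero>\<^bsub>R\<^esub>} \<subseteq> I"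
  by (auto simp: free_module_def)

lemma free_module_simps [simp]:
  "add (free_module R I) = (\<lambda>f g i. f i \<oplus>\<^bsub>R\<^esub> g i)"
  "ring.zero (free_module R I) = (\<lambda>_. \<zero>\<^bsub>R\<^esub>)"
  "smult (free_module R I) = (\<lambda>r f i. r \<otimes>\<^bsub>R\<^esub> f i)"
  by (simp_all add: free_module_def)

definition (in ring) monomial :: "'a \<Rightarrow> 'i \<Rightarrow> 'i \<Rightarrow> 'a" where
  "monomial u c = (\<lambda>i. if i = c then u else \<zero>)"

context ring
begin

lemma free_module_values: "f \<in> carrier (free_module R I) \<Longrightarrow> f i \<in> carrier R"
  by (simp add: free_module_carrier)

lemma monomial_closed: "\<lbrakk>u \<in> carrier R; c \<in> I\<rbrakk> \<Longrightarrow> monomial u c \<in> carrier (free_module R I)"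
  by (auto simp: free_module_carrier monomial_def intro: finite_subset [of _ "{c}"])

lemma free_module_add_closed:
  assumes "f \<in> carrier (free_module R I)" "g \<in> carrier (free_module R I)"
  shows "(\<lambda>i. f i \<oplus> g i) \<in> carrier (free_module R I)"
proof -
  have "{i. f i \<oplus> g i \<noteq> \<zero>} \<subseteq> {i. f i \<noteq> \<zero>} \<union> {i. g i \<noteq> \<zero>}" by auto
  then show ?thesis using assms unfolding free_module_carrier
    by (meson a_closed finite_UnI finite_subset le_sup_iff subset_trans)
qed

lemma free_module_smult_closed:
  assumes "f \<in> carrier (free_module R I)" "u \<in> carrier R"
  shows "(\<lambda>i. u \<otimes> f i) \<in> carrier (free_module R I)"
proof -
  have "{i. u \<otimes> f i \<noteq> \<zero>} \<subseteq> {i. f i \<noteq> \<zero>}" using assms by auto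
  then show ?thesis using assms unfolding free_module_carrier
    by (meson m_closed finite_subset subset_trans)
qed

lemma free_module_zero_closed: "(\<lambda>i. \<zero>) \<in> carrier (free_module R I)"
  by (simp add: free_module_carrier)

lemma free_module_uminus_closed:
  assumes "f \<in> carrier (free_module R I)"
  shows "(\<lambda>i. \<ominus> f i) \<in> carrier (free_module R I)"
proof -
  have "{i. \<ominus> f i \<noteq> \<zero>} = {i. f i \<noteq> \<zero>}" using assms
    by (auto simp: free_module_carrier)
  then show ?thesis using assms unfolding free_module_carrier by auto
qed

text \<open>The set \<open>V\<close> keeps track of where the coefficients lie: it will be the kernel of an augmentation,
  so that chains with augmentation zero are built from monomials with augmentation zero.\<close>

lemma free_module_induct_values [consumes 2, case_names zero monomial add]:
  assumes f: "f \<in> carrier (free_module R I)" and V: "\<And>i. f i \<noteq> \<zero> \<Longrightarrow> f i \<in> V"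
    and 0: "P (\<lambda>_. \<zero>)"
    and m: "\<And>u c. \<lbrakk>u \<in> carrier R; u \<in> V; c \<in> I\<rbrakk> \<Longrightarrow> P (monomial u c)"
    and a: "\<And>f g. \<lbrakk>f \<in> carrier (free_module R I); g \<in> carrier (free_module R I); P f; P g\<rbrakk>
      \<Longrightarrow> P (\<lambda>i. f i \<oplus> g i)"
  shows "P f"
proof -
  have "P f" if "finite A" "{i. f i \<noteq> \<zero>} \<subseteq> A" "f \<in> carrier (free_module R I)"
    "\<And>i. f i \<noteq> \<zero> \<Longrightarrow> f i \<in> V" for A f
    using that
  proof (induction A arbitrary: f rule: finite_induct)
    case empty
    then have "f = (\<lambda>_. \<zero>)" by auto
    then show ?case using 0 by simp
  next
    case (insert c A)
    show ?case
    proof (cases "f c = \<zero>")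
      case True
      then have "{i. f i \<noteq> \<zero>} \<subseteq> A" using insert.prems by auto
      then show ?thesis using insert by blast
    next
      case False
      let ?g = "\<lambda>i. if i = c then \<zero> else f i"
      have c: "c \<in> I" using False insert.prems by (auto simp: free_module_carrier)
      have fv: "f i \<in> carrier R" for i using insert.prems(2) by (rule free_module_values)
      have g: "?g \<in> carrier (free_module R I)"
        using insert.prems(2) unfolding free_module_carrier
        by (auto intro: finite_subset [of _ "{i. f i \<noteq> \<zero>}"])
      have sub: "{i. ?g i \<noteq> \<zero>} \<subseteq> A" using insert.prems by auto
      have gV: "?g i \<in> V" if "?g i \<noteq> \<zero>" for i
        using that insert.prems(3) by (auto split: if_splits)
      have "P ?g" using insert.IH [OF sub g gV] .
      then have "P (\<lambda>i. monomial (f c) c i \<oplus> ?g i)"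
        by (rule a [OF monomial_closed [OF fv c] g m [OF fv insert.prems(3) [OF False] c]])
      moreover have "(\<lambda>i. monomial (f c) c i \<oplus> ?g i) = f" using fv by (auto simp: monomial_def)
      ultimately show ?thesis by simp
    qed
  qed
  then show ?thesis using f V unfolding free_module_carrier by blast
qed

lemma free_module_induct [consumes 1, case_names zero monomial add]:
  assumes f: "f \<in> carrier (free_module R I)"
    and "P (\<lambda>_. \<zero>)"
    and "\<And>u c. \<lbrakk>u \<in> carrier R; c \<in> I\<rbrakk> \<Longrightarrow> P (monomial u c)"
    and "\<And>f g. \<lbrakk>f \<in> carrier (free_module R I); g \<in> carrier (free_module R I); P f; P g\<rbrakk>
      \<Longrightarrow> P (\<lambda>i. f i \<oplus> g i)"
  shows "P f"
  by (rule free_module_induct_values [OF f, of "carrier R"])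
    (use assms free_module_values [OF f] in blast)+

lemma combination_closed:
  assumes "set xs \<subseteq> carrier R \<times> I"
  shows "combination R xs \<in> carrier (free_module R I)"
  using assms
proof (induction xs)
  case Nil
  then show ?case by (simp add: free_module_zero_closed)
next
  case (Cons x xs)
  then have "(\<lambda>i. monomial (fst x) (snd x) i \<oplus> combination R xs i) \<in> carrier (free_module R I)"
    by (intro free_module_add_closed monomial_closed) auto
  then show ?case by (simp add: monomial_def)
qed

lemma combination_append:
  assumes "set xs \<subseteq> carrier R \<times> I" "set ys \<subseteq> carrier R \<times> I"
  shows "combination R (xs @ ys) = (\<lambda>i. combination R xs i \<oplus> combination R ys i)"
  using assms
proof (induction xs)
  case Nil
  then have "combination R ys i \<in> carrier R" for i
    using free_module_values [OF combination_closed] by auto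
  then show ?case by (simp add: fun_eq_iff)
next
  case (Cons x xs)
  have "combination R xs i \<in> carrier R" "combination R ys i \<in> carrier R" for i
    using free_module_values [OF combination_closed] Cons.prems by auto
  with Cons show ?case by (auto simp: a_assoc)
qed

lemma combination_single: "u \<in> carrier R \<Longrightarrow> combination R [(u, c)] = monomial u c"
  by (auto simp: monomial_def)

text \<open>Every chain has a name, so every cycle is the syzygy of a cell; this is what makes the standard
  resolution exact.\<close>

lemma combination_surj:
  assumes "f \<in> carrier (free_module R I)"
  shows "\<exists>xs. set xs \<subseteq> carrier R \<times> I \<and> combination R xs = f"
  using assms
proof (induction rule: free_module_induct)
  case zero
  then show ?case by (intro exI [of _ "[]"]) auto
next
  case (monomial u c)
  then show ?case by (intro exI [of _ "[(u, c)]"]) (use combination_single in auto)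
next
  case (add f g)
  then obtain xs ys where *: "set xs \<subseteq> carrier R \<times> I" "combination R xs = f"
    "set ys \<subseteq> carrier R \<times> I" "combination R ys = g" by blast
  have "combination R (xs @ ys) = (\<lambda>i. f i \<oplus> g i)"
    using combination_append [OF *(1) *(3)] *(2,4) by simp
  then show ?case using *(1,3) by (intro exI [of _ "xs @ ys"]) simp
qed

text \<open>
  The additive map on a free module whose value at \<open>u\<close> times the basis vector \<open>c\<close> is \<open>F c u\<close>. The augmentation
  of the resolution and the maps that detect classes are of this form.
\<close>

definition free_ext :: "('i \<Rightarrow> 'a \<Rightarrow> 'm::comm_monoid_add) \<Rightarrow> ('i \<Rightarrow> 'a) \<Rightarrow> 'm" where
  "free_ext F f = (\<Sum>c\<in>{c. f c \<noteq> \<zero>}. F c (f c))"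

lemma free_ext_superset:
  assumes "finite A" "{c. f c \<noteq> \<zero>} \<subseteq> A" "\<And>c. F c \<zero> = 0"
  shows "free_ext F f = (\<Sum>c\<in>A. F c (f c))"
  unfolding free_ext_def by (rule sum.mono_neutral_left) (use assms in auto)

lemma free_ext_zero [simp]: "free_ext F (\<lambda>_. \<zero>) = 0"
  by (simp add: free_ext_def)

lemma free_ext_monomial:
  assumes "\<And>c. F c \<zero> = 0" "u \<in> carrier R"
  shows "free_ext F (monomial u c) = F c u"
proof -
  have "{i. monomial u c i \<noteq> \<zero>} \<subseteq> {c}" by (auto simp: monomial_def)
  then have "free_ext F (monomial u c) = (\<Sum>i\<in>{c}. F i (monomial u c i))"
    by (rule free_ext_superset [rotated]) (simp_all add: assms)
  then show ?thesis by (simp add: monomial_def)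
qed

lemma free_ext_add:
  assumes F: "\<And>c. F c \<zero> = 0"
    and add: "\<And>c u v. \<lbrakk>u \<in> carrier R; v \<in> carrier R\<rbrakk> \<Longrightarrow> F c (u \<oplus> v) = F c u + F c v"
    and f: "f \<in> carrier (free_module R I)" and g: "g \<in> carrier (free_module R I)"
  shows "free_ext F (\<lambda>i. f i \<oplus> g i) = free_ext F f + free_ext F g"
proof -
  let ?A = "{i. f i \<noteq> \<zero>} \<union> {i. g i \<noteq> \<zero>}"
  have fin: "finite ?A" using f g by (auto simp: free_module_carrier)
  have "free_ext F (\<lambda>i. f i \<oplus> g i) = (\<Sum>c\<in>?A. F c (f c \<oplus> g c))"
    by (rule free_ext_superset) (use fin F in auto)
  also have "\<dots> = (\<Sum>c\<in>?A. F c (f c)) + (\<Sum>c\<in>?A. F c (g c))"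
    by (simp add: add free_module_values [OF f] free_module_values [OF g] sum.distrib)
  also have "\<dots> = free_ext F f + free_ext F g"
    using free_ext_superset [of ?A f F] free_ext_superset [of ?A g F] fin F by auto
  finally show ?thesis .
qed

end

section \<open>The standard resolution over an augmented ring\<close>

definition int_module :: "('r \<Rightarrow> int) \<Rightarrow> ('r, int) module" where
  "int_module eps =
    \<lparr>carrier = UNIV, monoid.mult = (*), one = 1, ring.zero = 0, add = (+),
     smult = (\<lambda>u n. eps u * n)\<rparr>"

lemma int_module_simps [simp]:
  "carrier (int_module eps) = UNIV" "ring.zero (int_module eps) = 0"
  "add (int_module eps) = (+)" "smult (int_module eps) = (\<lambda>u n. eps u * n)"
  by (simp_all add: int_module_def)

lemma finsum_int_module: "finsum (int_module eps) f A = sum f A"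
proof -
  interpret T: abelian_monoid "int_module eps"
    by unfold_locales (auto simp: int_module_def)
  show ?thesis
    by (induction A rule: infinite_finite_induct) auto
qed

locale augmented_ring = ring R for R (structure) +
  fixes eps :: "'a \<Rightarrow> int"
  assumes eps_add: "\<lbrakk>u \<in> carrier R; v \<in> carrier R\<rbrakk> \<Longrightarrow> eps (u \<oplus> v) = eps u + eps v"
    and eps_mult: "\<lbrakk>u \<in> carrier R; v \<in> carrier R\<rbrakk> \<Longrightarrow> eps (u \<otimes> v) = eps u * eps v"
    and eps_one: "eps \<one> = 1"
begin

abbreviation T where "T \<equiv> int_module eps"
abbreviation P where "P n \<equiv> carrier (resolution R T n)"
abbreviation P1 where "P1 \<equiv> P (Suc 0)"
abbreviation P2 where "P2 \<equiv> P (Suc (Suc 0))"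
abbreviation P3 where "P3 \<equiv> P (Suc (Suc (Suc 0)))"
abbreviation bd where "bd \<equiv> resolution_bd R :: (('a, int) cell \<Rightarrow> 'a) \<Rightarrow> ('a, int) cell \<Rightarrow> 'a"
abbreviation syz where "syz c \<equiv> combination R (syzygy c)"

lemma eps_zero [simp]: "eps \<zero> = 0"
  using eps_add [of \<zero> \<zero>] by simp

lemma eps_uminus: "u \<in> carrier R \<Longrightarrow> eps (\<ominus> u) = - eps u"
  using eps_add [of u "\<ominus> u"] by (simp add: r_neg)

lemma eps_surj: "\<exists>u\<in>carrier R. eps u = n"
proof (induction n rule: int_induct [where k = 0])
  case base
  show ?case by (rule bexI [of _ \<zero>]) auto
next
  case (step1 i)
  then obtain u where "u \<in> carrier R" "eps u = i" by blast
  then show ?case using eps_add [of u \<one>] eps_one by (intro bexI [of _ "u \<oplus> \<one>"]) auto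
next
  case (step2 i)
  then obtain u where "u \<in> carrier R" "eps u = i" by blast
  then show ?case using eps_add [of u "\<ominus> \<one>"] eps_one eps_uminus [of \<one>]
    by (intro bexI [of _ "u \<oplus> \<ominus> \<one>"]) auto
qed

lemma P_def: "resolution R T n = free_module R (cells R T n)"
  by (simp add: resolution_def)

lemma P_values: "f \<in> P n \<Longrightarrow> f c \<in> carrier R"
  unfolding P_def by (rule free_module_values)

lemmas P_add = free_module_add_closed [of _ "cells R T n" for n, folded P_def]
lemmas P_smult = free_module_smult_closed [of _ "cells R T n" for n, folded P_def]
lemmas P_zero = free_module_zero_closed [of "cells R T n" for n, folded P_def]
lemmas P_uminus = free_module_uminus_closed [of _ "cells R T n" for n, folded P_def]
lemmas P_monomial = monomial_closed [of _ _ "cells R T n" for n, folded P_def]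
lemmas P_induct [consumes 1, case_names zero monomial add] =
  free_module_induct [of _ "cells R T n" for n, folded P_def]

lemma P_diff: "\<lbrakk>f \<in> P n; g \<in> P n\<rbrakk> \<Longrightarrow> (\<lambda>i. f i \<ominus> g i) \<in> P n"
  unfolding minus_eq by (intro P_add P_uminus)

lemma syz_closed: "c \<in> cells R T (Suc n) \<Longrightarrow> syz c \<in> P n"
  unfolding P_def by (rule combination_closed) auto

lemma syz_aug: "c \<in> cells R T (Suc 0) \<Longrightarrow> resolution_aug R T (syz c) = 0"
  by auto

lemma syz_bd: "c \<in> cells R T (Suc (Suc n)) \<Longrightarrow> bd (syz c) = (\<lambda>_. \<zero>)"
  by auto

lemma aug_free_ext: "resolution_aug R T f = free_ext (\<lambda>c u. eps u * point c) f"
  by (simp add: resolution_aug_def free_ext_def finsum_int_module)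

lemma aug_add:
  "\<lbrakk>f \<in> P 0; g \<in> P 0\<rbrakk>
    \<Longrightarrow> resolution_aug R T (\<lambda>i. f i \<oplus> g i) = resolution_aug R T f + resolution_aug R T g"
  unfolding aug_free_ext P_def
  by (rule free_ext_add) (auto simp: eps_add distrib_right)

lemma aug_monomial: "u \<in> carrier R \<Longrightarrow> resolution_aug R T (monomial u c) = eps u * point c"
  unfolding aug_free_ext by (subst free_ext_monomial) auto

lemma aug_smult:
  assumes "f \<in> P 0" "u \<in> carrier R"
  shows "resolution_aug R T (\<lambda>i. u \<otimes> f i) = eps u * resolution_aug R T f"
  using assms(1)
proof (induction rule: P_induct)
  case zero
  then show ?case using assms(2) by (simp add: aug_free_ext)
next
  case (monomial v c)
  have "(\<lambda>i. u \<otimes> monomial v c i) = monomial (u \<otimes> v) c"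
    using assms(2) by (auto simp: monomial_def)
  then show ?case using monomial assms(2) by (simp add: aug_monomial eps_mult)
next
  case (add f g)
  have "(\<lambda>i. u \<otimes> (f i \<oplus> g i)) = (\<lambda>i. u \<otimes> f i \<oplus> u \<otimes> g i)"
    using assms(2) P_values [OF add(1)] P_values [OF add(2)] by (auto simp: r_distr)
  then show ?case
    using add aug_add [OF P_smult [OF add(1) assms(2)] P_smult [OF add(2) assms(2)]]
    by (simp add: aug_add distrib_left)
qed

text \<open>The boundary sums over the support of its argument. Additivity needs one range for two chains and
  their sum.\<close>

lemma bd_superset:
  assumes f: "f \<in> P (Suc n)" and A: "finite A" "{c. f c \<noteq> \<zero>} \<subseteq> A" "A \<subseteq> cells R T (Suc n)"
  shows "bd f e = (\<Oplus>c\<in>A. f c \<otimes> syz c e)"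
proof -
  have s: "syz c e \<in> carrier R" if "c \<in> A" for c
    using that A(3) syz_closed P_values by blast
  show ?thesis unfolding resolution_bd_def
    by (rule add.finprod_mono_neutral_cong_left)
      (use A P_values [OF f] s in \<open>auto intro!: m_closed simp: Pi_def\<close>)
qed

lemma P_support: "f \<in> P n \<Longrightarrow> finite {c. f c \<noteq> \<zero>}" "f \<in> P n \<Longrightarrow> {c. f c \<noteq> \<zero>} \<subseteq> cells R T n"
  unfolding P_def by (auto simp: free_module_carrier)

lemma bd_zero: "bd (\<lambda>_. \<zero>) = (\<lambda>_. \<zero>)"
  by (simp add: resolution_bd_def)

lemma bd_monomial:
  assumes "u \<in> carrier R" "c \<in> cells R T (Suc n)"
  shows "bd (monomial u c) = (\<lambda>e. u \<otimes> syz c e)"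
proof
  fix e
  have "bd (monomial u c) e = (\<Oplus>c'\<in>{c}. monomial u c c' \<otimes> syz c' e)"
    by (rule bd_superset [OF P_monomial [OF assms]]) (use assms in \<open>auto simp: monomial_def\<close>)
  also have "\<dots> = u \<otimes> syz c e"
    using assms P_values [OF syz_closed [OF assms(2)]] by (simp add: monomial_def)
  finally show "bd (monomial u c) e = u \<otimes> syz c e" .
qed

lemma bd_add:
  assumes "f \<in> P (Suc n)" "g \<in> P (Suc n)"
  shows "bd (\<lambda>i. f i \<oplus> g i) = (\<lambda>e. bd f e \<oplus> bd g e)"
proof
  fix e
  let ?A = "{c. f c \<noteq> \<zero>} \<union> {c. g c \<noteq> \<zero>}"
  have fin: "finite ?A" using P_support(1) [OF assms(1)] P_support(1) [OF assms(2)] by simp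
  have sub: "?A \<subseteq> cells R T (Suc n)" by (intro Un_least P_support(2) assms)
  have s: "syz c e \<in> carrier R" if "c \<in> ?A" for c
    using that sub syz_closed P_values by blast
  have v: "f c \<in> carrier R" "g c \<in> carrier R" for c using P_values assms by auto
  have "bd (\<lambda>i. f i \<oplus> g i) e = (\<Oplus>c\<in>?A. (f c \<oplus> g c) \<otimes> syz c e)"
    by (rule bd_superset [OF P_add [OF assms] fin _ sub]) auto
  also have "\<dots> = (\<Oplus>c\<in>?A. f c \<otimes> syz c e \<oplus> g c \<otimes> syz c e)"
    by (rule finsum_cong') (use s v in \<open>auto simp: l_distr\<close>)
  also have "\<dots> = (\<Oplus>c\<in>?A. f c \<otimes> syz c e) \<oplus> (\<Oplus>c\<in>?A. g c \<otimes> syz c e)"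
    by (rule finsum_addf) (use s v in auto)
  also have "\<dots> = bd f e \<oplus> bd g e"
    using bd_superset [OF assms(1) fin _ sub] bd_superset [OF assms(2) fin _ sub] by auto
  finally show "bd (\<lambda>i. f i \<oplus> g i) e = bd f e \<oplus> bd g e" .
qed

lemma bd_closed: "f \<in> P (Suc n) \<Longrightarrow> bd f \<in> P n"
proof (induction rule: P_induct)
  case zero
  then show ?case by (simp add: bd_zero P_zero)
next
  case (monomial u c)
  then show ?case by (simp only: bd_monomial) (intro P_smult syz_closed)
next
  case (add f g)
  then show ?case by (simp add: bd_add P_add)
qed

lemma bd_smult:
  assumes "f \<in> P (Suc n)" "u \<in> carrier R"
  shows "bd (\<lambda>i. u \<otimes> f i) = (\<lambda>e. u \<otimes> bd f e)"
  using assms(1)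
proof (induction rule: P_induct)
  case zero
  then show ?case using assms(2) by (simp add: bd_zero)
next
  case (monomial v c)
  have "(\<lambda>i. u \<otimes> monomial v c i) = monomial (u \<otimes> v) c"
    using assms(2) by (auto simp: monomial_def)
  then show ?case
    using monomial assms(2) P_values [OF syz_closed [OF monomial(2)]]
    by (simp add: bd_monomial [OF _ monomial(2)] m_assoc)
next
  case (add f g)
  have "(\<lambda>i. u \<otimes> (f i \<oplus> g i)) = (\<lambda>i. u \<otimes> f i \<oplus> u \<otimes> g i)"
    using assms(2) P_values [OF add(1)] P_values [OF add(2)] by (auto simp: r_distr)
  then show ?case
    using add bd_add [OF P_smult [OF add(1) assms(2)] P_smult [OF add(2) assms(2)]]
      P_values [OF bd_closed [OF add(1)]] P_values [OF bd_closed [OF add(2)]] assms(2)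
    by (simp add: bd_add [OF add(1,2)] r_distr)
qed

lemma bd_uminus:
  assumes "f \<in> P (Suc n)"
  shows "bd (\<lambda>i. \<ominus> f i) = (\<lambda>e. \<ominus> bd f e)"
proof -
  have "(\<lambda>i. \<ominus> f i) = (\<lambda>i. (\<ominus> \<one>) \<otimes> f i)" using P_values [OF assms] by (simp add: l_minus)
  then show ?thesis
    using bd_smult [OF assms, of "\<ominus> \<one>"] P_values [OF bd_closed [OF assms]] by (simp add: l_minus)
qed

lemma bd_diff:
  assumes "f \<in> P (Suc n)" "g \<in> P (Suc n)"
  shows "bd (\<lambda>i. f i \<ominus> g i) = (\<lambda>e. bd f e \<ominus> bd g e)"
  unfolding minus_eq using bd_add [OF assms(1) P_uminus [OF assms(2)]] bd_uminus [OF assms(2)] by simp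

lemma bd_bd: "f \<in> P (Suc (Suc n)) \<Longrightarrow> bd (bd f) = (\<lambda>_. \<zero>)"
proof (induction rule: P_induct)
  case zero
  then show ?case by (simp add: bd_zero)
next
  case (monomial u c)
  then show ?case
    using bd_smult [OF syz_closed [OF monomial(2)] monomial(1)] syz_bd [OF monomial(2)]
    by (simp add: bd_monomial [OF monomial])
next
  case (add f g)
  then show ?case
    by (simp add: bd_add [OF add(1,2)] bd_add [OF bd_closed [OF add(1)] bd_closed [OF add(2)]])
qed

lemma exact:
  assumes "m \<in> P (Suc n)" "bd m = (\<lambda>_. \<zero>)"
  shows "\<exists>f\<in>P (Suc (Suc n)). bd f = m"
proof -
  obtain xs where xs: "set xs \<subseteq> carrier R \<times> cells R T (Suc n)" "combination R xs = m"
    using combination_surj [of m "cells R T (Suc n)"] assms(1) P_def by metis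
  then have c: "Cell xs \<in> cells R T (Suc (Suc n))" using assms(2) by auto
  have "bd (monomial \<one> (Cell xs)) = m"
    using bd_monomial [OF one_closed c] xs(2) P_values [OF assms(1)] by simp
  then show ?thesis using P_monomial [OF one_closed c] by blast
qed

text \<open>A chain that dies after tensoring with the integers is a sum of monomials \<open>u c\<close> with \<open>u\<close> in the
  augmentation ideal, so a functional that vanishes on these depends only on augmented coefficients.\<close>

lemma free_module_induct_eps [consumes 2, case_names zero monomial add]:
  assumes f: "f \<in> carrier (free_module R I)" and e: "\<And>c. eps (f c) = 0"
    and "Q (\<lambda>_. \<zero>)"
    and "\<And>u c. \<lbrakk>u \<in> carrier R; eps u = 0; c \<in> I\<rbrakk> \<Longrightarrow> Q (monomial u c)"
    and "\<And>f g. \<lbrakk>f \<in> carrier (free_module R I); g \<in> carrier (free_module R I); Q f; Q g\<rbrakk>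
      \<Longrightarrow> Q (\<lambda>i. f i \<oplus> g i)"
  shows "Q f"
  by (rule free_module_induct_values [OF f, of "{u. eps u = 0}"])
    (use assms free_module_values [OF f] in blast)+

end

section \<open>Tor in terms of augmented coefficients\<close>

context augmented_ring
begin

abbreviation FM where "FM I \<equiv> free_module R I"

abbreviation FA :: "'i set \<Rightarrow> (int \<times> ('i \<Rightarrow> 'a) \<Rightarrow>\<^sub>0 int) monoid" where
  "FA I \<equiv> free_Abelian_group (carrier T \<times> carrier (FM I))"

abbreviation TS where "TS I \<equiv> tensor_subgroup R T (FM I)"

text \<open>The coordinates of a tensor under the isomorphism of \<open>\<int> \<otimes> (free module)\<close> with a free abelian group:
  each coefficient is replaced by its augmentation.\<close>

definition shadow :: "(int \<times> ('i \<Rightarrow> 'a) \<Rightarrow>\<^sub>0 int) \<Rightarrow> 'i \<Rightarrow> int" where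
  "shadow x c = lin_ext (\<lambda>(n, f). n * eps (f c)) x"

lemma FA_simps [simp]:
  "x \<in> carrier (FA I) \<longleftrightarrow> Poly_Mapping.keys x \<subseteq> UNIV \<times> carrier (FM I)"
  "monoid.mult (FA I) = (+)" "monoid.one (FA I) = 0"
  by (auto simp: free_Abelian_group_def)

text \<open>The universal property of the tensor product, in the form of functionals: an augmented-linear map
  on the free module induces a map on tensors.\<close>

lemma tensor_functional:
  assumes add: "\<And>f g. \<lbrakk>f \<in> carrier (FM I); g \<in> carrier (FM I)\<rbrakk> \<Longrightarrow> G (\<lambda>i. f i \<oplus> g i) = G f + G g"
    and smult: "\<And>u f. \<lbrakk>u \<in> carrier R; f \<in> carrier (FM I)\<rbrakk> \<Longrightarrow> G (\<lambda>i. u \<otimes> f i) = eps u * G f"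
    and x: "x \<in> TS I"
  shows "lin_ext (\<lambda>(n, f). n * G f) x = (0::int)"
proof -
  have rel: "lin_ext (\<lambda>(n, f). n * G f) h = 0" if "h \<in> tensor_relators R T (FM I)" for h
    using that unfolding tensor_relators_def
    by (auto simp: lin_ext_diff add smult distrib_left distrib_right)
  show ?thesis
    using x unfolding tensor_subgroup_def
  proof (induction rule: generate.induct)
    case one
    then show ?case by simp
  next
    case (incl h)
    then show ?case by (rule rel)
  next
    case (inv h)
    then have "Poly_Mapping.keys h \<subseteq> carrier T \<times> carrier (FM I)"
      by (auto simp: tensor_relators_def intro!: free_module_add_closed free_module_smult_closed
          dest!: keys_diff [THEN subsetD])
    then show ?case using rel [OF inv] by (simp add: lin_ext_uminus)
  next
    case (eng h1 h2)
    then show ?case by (simp add: lin_ext_add)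
  qed
qed

lemma tensor_relators_closed: "tensor_relators R T (FM I) \<subseteq> carrier (FA I)"
  by (auto simp: tensor_relators_def intro!: free_module_add_closed free_module_smult_closed
        dest!: keys_diff [THEN subsetD])

lemma FA_group: "comm_group (FA I)"
  by (rule abelian_free_Abelian_group)

lemma tensor_subgroup_subgroup: "subgroup (TS I) (FA I)"
  unfolding tensor_subgroup_def
  by (intro group.generate_is_subgroup comm_group.axioms FA_group tensor_relators_closed)

lemma tensor_subgroup_closed:
  assumes "x \<in> TS I"
  shows tensor_subgroup_carrier: "Poly_Mapping.keys x \<subseteq> UNIV \<times> carrier (FM I)"
    and tensor_subgroup_add: "y \<in> TS I \<Longrightarrow> x + y \<in> TS I"
    and tensor_subgroup_uminus: "- x \<in> TS I"
proof -
  interpret N: subgroup "TS I" "FA I" by (rule tensor_subgroup_subgroup)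
  show c: "Poly_Mapping.keys x \<subseteq> UNIV \<times> carrier (FM I)"
    using N.subset assms by force
  show "x + y \<in> TS I" if "y \<in> TS I"
    using N.m_closed [OF assms that] by simp
  show "- x \<in> TS I"
    using N.m_inv_closed [OF assms] c by simp
qed

lemma tensor_subgroup_diff:
  "\<lbrakk>x \<in> TS I; y \<in> TS I\<rbrakk>
    \<Longrightarrow> x - y \<in> TS I"
  using tensor_subgroup_add [of x I "- y"] tensor_subgroup_uminus by fastforce

lemma tensor_relator_mem:
  "x \<in> tensor_relators R T (FM I) \<Longrightarrow> x \<in> TS I"
  unfolding tensor_subgroup_def by (rule generate.incl)

lemma tensor_rel_add:
  assumes "f \<in> carrier (FM I)" "g \<in> carrier (FM I)"
  shows "frag_of (n, \<lambda>i. f i \<oplus> g i) - frag_of (n, f) - frag_of (n, g) \<in> TS I"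
  by (rule tensor_relator_mem) (use assms in \<open>auto simp: tensor_relators_def\<close>)

lemma tensor_rel_zero: "frag_of (n, \<lambda>i. \<zero>) \<in> TS I"
proof -
  have "- (frag_of (n, \<lambda>i. \<zero>)) \<in> TS I"
    using tensor_rel_add [OF free_module_zero_closed free_module_zero_closed, of n I] by simp
  then show ?thesis using tensor_subgroup_uminus by fastforce
qed

lemma tensor_rel_left_zero:
  assumes "f \<in> carrier (FM I)"
  shows "frag_of (0, f) \<in> TS I"
proof -
  have "frag_of (0 + 0, f) - frag_of (0, f) - frag_of (0, f) \<in> TS I"
    unfolding tensor_subgroup_def
    by (rule generate.incl, unfold tensor_relators_def, intro UnI1 CollectI exI [of _ 0] exI [of _ f])
      (use assms in simp)
  then have "- (frag_of (0, f)) \<in> TS I" by simp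
  then show ?thesis using tensor_subgroup_uminus by fastforce
qed

lemma tensor_rel_smult:
  assumes "f \<in> carrier (FM I)" "u \<in> carrier R"
  shows "frag_of (eps u * n, f) - frag_of (n, \<lambda>i. u \<otimes> f i) \<in> TS I"
  by (rule tensor_relator_mem) (use assms in \<open>force simp: tensor_relators_def\<close>)

lemma tensor_rel_diff:
  assumes "f \<in> carrier (FM I)" "g \<in> carrier (FM I)"
  shows "frag_of (n, f) - frag_of (n, g) - frag_of (n, \<lambda>i. f i \<ominus> g i) \<in> TS I"
proof -
  have d: "(\<lambda>i. f i \<ominus> g i) \<in> carrier (FM I)"
    unfolding minus_eq by (intro free_module_add_closed free_module_uminus_closed assms)
  have "(\<lambda>i. f i \<ominus> g i \<oplus> g i) = f"
    using free_module_values [OF assms(1)] free_module_values [OF assms(2)]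
    by (auto simp: minus_eq a_assoc l_neg)
  with tensor_rel_add [OF d assms(2), of n] show ?thesis by (simp add: algebra_simps)
qed

text \<open>The augmentation is onto, so any integer on the left can be moved to the right.\<close>

lemma tensor_normal_form:
  assumes "Poly_Mapping.keys x \<subseteq> UNIV \<times> carrier (FM I)"
  shows "\<exists>f\<in>carrier (FM I). x - frag_of (1, f) \<in> TS I"
  using assms
proof (induction x rule: frag_induction)
  case zero
  show ?case
    using tensor_subgroup_uminus [OF tensor_rel_zero, of 1 I]
    by (intro bexI [of _ "\<lambda>i. \<zero>"] free_module_zero_closed) simp
next
  case (one y)
  obtain n f where y: "y = (n, f)" by (cases y)
  then have f: "f \<in> carrier (FM I)" using one by simp
  obtain u where u: "u \<in> carrier R" "eps u = n" using eps_surj by blast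
  show ?case
    using tensor_rel_smult [OF f u(1), of 1] u(2) y
    by (intro bexI [of _ "\<lambda>i. u \<otimes> f i"] free_module_smult_closed f u) simp
next
  case (diff a b)
  then obtain f g where *: "f \<in> carrier (FM I)" "a - frag_of (1, f) \<in> TS I"
    "g \<in> carrier (FM I)" "b - frag_of (1, g) \<in> TS I" by blast
  have d: "(\<lambda>i. f i \<ominus> g i) \<in> carrier (FM I)"
    unfolding minus_eq by (intro free_module_add_closed free_module_uminus_closed *)
  have "(a - frag_of (1, f)) - (b - frag_of (1, g))
      + (frag_of (1, f) - frag_of (1, g) - frag_of (1, \<lambda>i. f i \<ominus> g i)) \<in> TS I"
    by (intro tensor_subgroup_add tensor_subgroup_diff tensor_rel_diff *)
  then show ?case by (intro bexI [OF _ d]) (simp add: algebra_simps)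
qed

lemma shadow_add: "shadow (x + y) c = shadow x c + shadow y c"
  and shadow_diff: "shadow (x - y) c = shadow x c - shadow y c"
  and shadow_one [simp]: "shadow (frag_of (n, f)) c = n * eps (f c)"
  and shadow_0 [simp]: "shadow 0 c = 0"
  by (simp_all add: shadow_def lin_ext_add lin_ext_diff)

lemma shadow_subgroup: "x \<in> TS I \<Longrightarrow> shadow x c = 0"
  unfolding shadow_def
  by (rule tensor_functional [where I = I])
    (auto simp: eps_add eps_mult free_module_values)

lemma tensor_eps_zero:
  assumes "f \<in> carrier (FM I)" "\<And>c. eps (f c) = 0"
  shows "frag_of (1, f) \<in> TS I"
  using assms
proof (induction rule: free_module_induct_eps)
  case zero
  then show ?case by (rule tensor_rel_zero)
next
  case (monomial u c)
  have c: "monomial \<one> c \<in> carrier (FM I)" using monomial by (intro monomial_closed) auto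
  have "(\<lambda>i. u \<otimes> monomial \<one> c i) = monomial u c" using monomial(1) by (auto simp: monomial_def)
  with tensor_rel_smult [OF c monomial(1), of 1] monomial(2)
  have *: "frag_of (0, monomial \<one> c) - frag_of (1, monomial u c) \<in> TS I" by simp
  show ?case using tensor_subgroup_diff [OF tensor_rel_left_zero [OF c] *] by simp
next
  case (add f g)
  have "(frag_of (1, \<lambda>i. f i \<oplus> g i) - frag_of (1, f) - frag_of (1, g)) + frag_of (1, f) + frag_of (1, g)
      \<in> TS I"
    by (intro tensor_subgroup_add tensor_rel_add add)
  then show ?case by simp
qed

text \<open>By the normal form it is enough to look at \<open>1 \<otimes> f\<close>, and there \<open>f\<close> is a sum of monomials \<open>u c\<close> with
  \<open>eps u = 0\<close>, for which \<open>1 \<otimes> u c = eps u \<otimes> c = 0\<close>.\<close>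

lemma tensor_subgroup_iff:
  assumes x: "Poly_Mapping.keys x \<subseteq> UNIV \<times> carrier (FM I)"
  shows "x \<in> TS I \<longleftrightarrow> (\<forall>c. shadow x c = 0)"
proof
  assume "x \<in> TS I"
  then show "\<forall>c. shadow x c = 0" by (simp add: shadow_subgroup)
next
  assume 0: "\<forall>c. shadow x c = 0"
  obtain f where f: "f \<in> carrier (FM I)" "x - frag_of (1, f) \<in> TS I"
    using tensor_normal_form [OF x] by blast
  have "eps (f c) = 0" for c
    using shadow_subgroup [OF f(2), of c] 0 by (simp add: shadow_diff)
  then have "frag_of (1, f) \<in> TS I" by (intro tensor_eps_zero f) auto
  from tensor_subgroup_add [OF f(2) this] show "x \<in> TS I" by simp
qed

text \<open>The tensor \<open>1 \<otimes> f\<close>. Its representatives are singled out by their coordinates, which depend on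
  \<open>f\<close> through the augmented coefficients only.\<close>

definition tens :: "'i set \<Rightarrow> ('i \<Rightarrow> 'a) \<Rightarrow> (int \<times> ('i \<Rightarrow> 'a) \<Rightarrow>\<^sub>0 int) set" where
  "tens I f = {x. Poly_Mapping.keys x \<subseteq> UNIV \<times> carrier (FM I) \<and> (\<forall>c. shadow x c = eps (f c))}"

lemma keys_diff_subset:
  "\<lbrakk>Poly_Mapping.keys x \<subseteq> A; Poly_Mapping.keys y \<subseteq> A\<rbrakk> \<Longrightarrow> Poly_Mapping.keys (x - y) \<subseteq> A"
  for x y :: "'k \<Rightarrow>\<^sub>0 int"
  using keys_diff [of x y] by blast

lemma keys_add_subset:
  "\<lbrakk>Poly_Mapping.keys x \<subseteq> A; Poly_Mapping.keys y \<subseteq> A\<rbrakk> \<Longrightarrow> Poly_Mapping.keys (x + y) \<subseteq> A"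
  for x y :: "'k \<Rightarrow>\<^sub>0 int"
  using Poly_Mapping.keys_add [of x y] by blast

lemma tensor_coset:
  assumes "Poly_Mapping.keys x \<subseteq> UNIV \<times> carrier (FM I)"
  shows "TS I #>\<^bsub>FA I\<^esub> x
    = {y. Poly_Mapping.keys y \<subseteq> UNIV \<times> carrier (FM I) \<and> (\<forall>c. shadow y c = shadow x c)}"
    (is "?L = ?R")
proof
  show "?L \<subseteq> ?R"
  proof
    fix z assume "z \<in> ?L"
    then obtain y where y: "y \<in> TS I" "z = y + x" by (auto simp: r_coset_def)
    show "z \<in> ?R"
      using keys_add_subset [OF tensor_subgroup_carrier [OF y(1)] assms] shadow_subgroup [OF y(1)]
      by (simp add: y(2) shadow_add)
  qed
  show "?R \<subseteq> ?L"
  proof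
    fix y assume y: "y \<in> ?R"
    then have "y - x \<in> TS I"
      using keys_diff_subset [of y _ x] assms by (subst tensor_subgroup_iff) (auto simp: shadow_diff)
    then show "y \<in> ?L" by (auto simp: r_coset_def intro!: bexI [of _ "y - x"])
  qed
qed

lemma tens_coset:
  "f \<in> carrier (FM I) \<Longrightarrow> TS I #>\<^bsub>FA I\<^esub> frag_of (1, f) = tens I f"
  by (subst tensor_coset) (auto simp: tens_def)

lemma tens_self: "f \<in> carrier (FM I) \<Longrightarrow> frag_of (1, f) \<in> tens I f"
  by (simp add: tens_def)

lemma tens_eq_iff:
  "f \<in> carrier (FM I) \<Longrightarrow> tens I f = tens I g \<longleftrightarrow> (\<forall>c. eps (f c) = eps (g c))"
proof
  assume f: "f \<in> carrier (FM I)" and "tens I f = tens I g"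
  then have "frag_of (1, f) \<in> tens I g" using tens_self by blast
  then show "\<forall>c. eps (f c) = eps (g c)" by (simp add: tens_def)
qed (simp add: tens_def)

lemma tensor_subgroup_tens: "TS I = tens I (\<lambda>_. \<zero>)"
proof (intro Set.set_eqI iffI)
  fix x assume x: "x \<in> TS I"
  show "x \<in> tens I (\<lambda>_. \<zero>)"
    using tensor_subgroup_carrier [OF x] shadow_subgroup [OF x] by (simp add: tens_def)
next
  fix x assume "x \<in> tens I (\<lambda>_. \<zero>)"
  then show "x \<in> TS I"
    using tensor_subgroup_iff [of x I] by (simp add: tens_def)
qed

lemma tensor_group_carrier: "carrier (tensor_group R T (FM I)) = tens I ` carrier (FM I)"
proof (intro equalityI subsetI)
  fix C assume "C \<in> carrier (tensor_group R T (FM I))"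
  then obtain x where x: "Poly_Mapping.keys x \<subseteq> UNIV \<times> carrier (FM I)"
    and C: "C = TS I #>\<^bsub>FA I\<^esub> x"
    unfolding tensor_group_def FactGroup_def RCOSETS_def by auto
  obtain f where f: "f \<in> carrier (FM I)" "x - frag_of (1, f) \<in> TS I"
    using tensor_normal_form [OF x] by blast
  have "shadow x c = eps (f c)" for c
    using shadow_subgroup [OF f(2), of c] by (simp add: shadow_diff)
  then have "C = tens I f" unfolding C tensor_coset [OF x] by (simp add: tens_def)
  then show "C \<in> tens I ` carrier (FM I)" using f(1) by (rule image_eqI)
next
  fix C assume "C \<in> tens I ` carrier (FM I)"
  then obtain f where f: "f \<in> carrier (FM I)" "C = tens I f" by blast
  have "frag_of (1, f) \<in> carrier (FA I)" using f(1) by simp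
  then show "C \<in> carrier (tensor_group R T (FM I))"
    using tens_coset [OF f(1)] f(2)
    unfolding tensor_group_def FactGroup_def RCOSETS_def by force
qed

lemma tensor_group_one: "\<one>\<^bsub>tensor_group R T (FM I)\<^esub> = tens I (\<lambda>_. \<zero>)"
  by (simp add: tensor_group_def FactGroup_def tensor_subgroup_tens)

lemma tens_add:
  assumes f: "f \<in> carrier (FM I)" and g: "g \<in> carrier (FM I)"
  shows "tens I f <#>\<^bsub>FA I\<^esub> tens I g = tens I (\<lambda>i. f i \<oplus> g i)" (is "?L = ?R")
proof
  show "?L \<subseteq> ?R"
  proof
    fix z assume "z \<in> ?L"
    then obtain x y where "x \<in> tens I f" "y \<in> tens I g" "z = x + y"
      by (auto simp: set_mult_def)
    then show "z \<in> ?R"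
      using free_module_values [OF f] free_module_values [OF g] keys_add_subset [of x _ y]
      by (auto simp: tens_def shadow_add eps_add)
  qed
  show "?R \<subseteq> ?L"
  proof
    fix z assume z: "z \<in> ?R"
    then have "z - frag_of (1, f) \<in> tens I g"
      using free_module_values [OF f] free_module_values [OF g] keys_diff_subset [of z _ "frag_of (1, f)"] f
      by (auto simp: tens_def shadow_diff eps_add)
    then have "frag_of (1, f) + (z - frag_of (1, f)) \<in> ?L"
      unfolding set_mult_def using tens_self [OF f] by force
    then show "z \<in> ?L" by simp
  qed
qed

text \<open>The value on another representative \<open>y\<close> of \<open>1 \<otimes> f\<close> is compared with that on \<open>1 \<otimes> f\<close> itself through the
  functionals \<open>g \<mapsto> eps (h g c)\<close>, which kill \<open>y - 1 \<otimes> f\<close>.\<close>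

lemma tensor_map_tens:
  assumes h: "\<And>f. f \<in> carrier (FM I) \<Longrightarrow> h f \<in> carrier (FM J)"
    and add: "\<And>f g. \<lbrakk>f \<in> carrier (FM I); g \<in> carrier (FM I)\<rbrakk>
      \<Longrightarrow> h (\<lambda>i. f i \<oplus> g i) = (\<lambda>i. h f i \<oplus> h g i)"
    and smult: "\<And>u f. \<lbrakk>u \<in> carrier R; f \<in> carrier (FM I)\<rbrakk>
      \<Longrightarrow> h (\<lambda>i. u \<otimes> f i) = (\<lambda>i. u \<otimes> h f i)"
    and f: "f \<in> carrier (FM I)"
  shows "tensor_map R T (FM J) h (tens I f) = tens J (h f)"
proof -
  let ?e = "frag_extend (\<lambda>(a, b). frag_of (a, h b))"
  have img: "?e y \<in> tens J (h f)" if y: "y \<in> tens I f" for y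
  proof -
    have k: "Poly_Mapping.keys y \<subseteq> UNIV \<times> carrier (FM I)" using y by (simp add: tens_def)
    have "Poly_Mapping.keys (?e y) \<subseteq> UNIV \<times> carrier (FM J)"
      using keys_frag_extend [of "\<lambda>(a, b). frag_of (a, h b)" y] k h by fastforce
    moreover have "shadow (?e y) c = eps (h f c)" for c
    proof -
      let ?G = "\<lambda>g. eps (h g c)"
      have "y - frag_of (1, f) \<in> TS I"
        using y f keys_diff_subset [OF k, of "frag_of (1, f)"]
        by (subst tensor_subgroup_iff) (simp_all add: tens_def shadow_diff)
      then have "lin_ext (\<lambda>(n, f). n * ?G f) (y - frag_of (1, f)) = 0"
        by (rule tensor_functional [rotated 2])
          (simp_all add: add smult eps_add eps_mult free_module_values [OF h])
      moreover have "shadow (?e y) c = lin_ext (\<lambda>(n, f). n * ?G f) y"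
        unfolding shadow_def lin_ext_frag_extend by (rule lin_ext_cong) auto
      ultimately show ?thesis by (simp add: lin_ext_diff)
    qed
    ultimately show ?thesis by (simp add: tens_def)
  qed
  let ?N = "tens J (\<lambda>_. \<zero>)"
  have "?N <#>\<^bsub>FA J\<^esub> ?e ` tens I f = tens J (h f)"
  proof
    show "?N <#>\<^bsub>FA J\<^esub> ?e ` tens I f \<subseteq> tens J (h f)"
    proof
      fix z assume "z \<in> ?N <#>\<^bsub>FA J\<^esub> ?e ` tens I f"
      then obtain x y where xy: "x \<in> ?N" "y \<in> tens I f" "z = x + ?e y"
        unfolding set_mult_def by auto
      show "z \<in> tens J (h f)"
        using img [OF xy(2)] xy(1) keys_add_subset [of x _ "?e y"]
        unfolding xy(3) tens_def by (simp add: shadow_add)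
    qed
    show "tens J (h f) \<subseteq> ?N <#>\<^bsub>FA J\<^esub> ?e ` tens I f"
    proof
      fix z assume z: "z \<in> tens J (h f)"
      let ?y = "?e (frag_of (1, f))"
      have y: "?y \<in> ?e ` tens I f" using tens_self [OF f] by (rule imageI)
      have "z - ?y \<in> ?N"
        using z img [OF tens_self [OF f]] keys_diff_subset [of z _ ?y]
        by (simp add: tens_def shadow_diff)
      then have "(z - ?y) + ?y \<in> ?N <#>\<^bsub>FA J\<^esub> ?e ` tens I f"
        unfolding set_mult_def using y by force
      then show "z \<in> ?N <#>\<^bsub>FA J\<^esub> ?e ` tens I f" by simp
    qed
  qed
  then show ?thesis by (simp add: tensor_map_def tensor_subgroup_tens)
qed

end

context augmented_ring
begin

declare cells.simps [simp del]

abbreviation ts where "ts n \<equiv> tens (cells R T n)"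
abbreviation ts2 where "ts2 \<equiv> ts (Suc (Suc 0))"
abbreviation TP2 where "TP2 \<equiv> tensor_group R T (resolution R T (Suc (Suc 0)))"
abbreviation H2 where "H2 \<equiv> Tor 2 R T T"

lemma tensor_map_bd:
  assumes "f \<in> P (Suc n)"
  shows "tensor_map R T (resolution R T n) (differential R (Suc n)) (ts (Suc n) f) = ts n (bd f)"
  unfolding P_def differential_def
  using bd_closed [of _ n] bd_add [of _ n] bd_smult [of _ n] assms unfolding P_def
  by (simp add: tensor_map_tens)

text \<open>Chains of degree 2 that become cycles after tensoring with the integers, and the classes in the
  second Tor group that they represent. A class is spelled out as the coset that it is.\<close>

definition tor_cycles where
  "tor_cycles = {f \<in> P2. \<forall>c. eps (bd f c) = 0}"

definition tor where
  "tor f = (\<lambda>s. ts2 (\<lambda>i. bd s i \<oplus> f i)) ` P3"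

lemma Tor_2:
  "H2 = TP2
      \<lparr>carrier := ts2 ` tor_cycles\<rparr> Mod ts2 ` bd ` P3"
proof -
  have c: "carrier (tensor_group R T (resolution R T n)) = ts n ` P n" for n
    unfolding P_def by (rule tensor_group_carrier)
  have "kernel TP2 (tensor_group R T (resolution R T (Suc 0)))
      (tensor_map R T (resolution R T (Suc 0)) (differential R (Suc (Suc 0))))
    = {x \<in> ts2 ` P2. tensor_map R T (resolution R T (Suc 0)) (differential R (Suc (Suc 0))) x
        = ts (Suc 0) (\<lambda>_. \<zero>)}"
    unfolding kernel_def c unfolding P_def tensor_group_one ..
  also have "\<dots> = ts2 ` {f \<in> P2. ts (Suc 0) (bd f) = ts (Suc 0) (\<lambda>_. \<zero>)}"
    using tensor_map_bd by auto
  also have "{f \<in> P2. ts (Suc 0) (bd f) = ts (Suc 0) (\<lambda>_. \<zero>)} = tor_cycles"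
    unfolding tor_cycles_def
    by (intro Collect_cong conj_cong refl)
      (simp add: tens_eq_iff [of _ "cells R T (Suc 0)", folded P_def] bd_closed)
  finally have k: "kernel TP2 (tensor_group R T (resolution R T (Suc 0)))
      (tensor_map R T (resolution R T (Suc 0)) (differential R (Suc (Suc 0)))) = ts2 ` tor_cycles" .
  have "tensor_map R T (resolution R T (Suc (Suc 0))) (differential R (Suc (Suc (Suc 0)))) `
      carrier (tensor_group R T (resolution R T (Suc (Suc (Suc 0)))))
    = ts2 ` bd ` P3"
    unfolding c image_image using tensor_map_bd by (intro image_cong) auto
  then show ?thesis
    unfolding Tor_def homology_at_def by (simp add: numeral_2_eq_2 k)
qed

lemma ts_add:
  "\<lbrakk>f \<in> P n; g \<in> P n\<rbrakk> \<Longrightarrow> ts n f \<otimes>\<^bsub>tensor_group R T (resolution R T n)\<^esub> ts n g = ts n (\<lambda>i. f i \<oplus> g i)"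
  unfolding P_def using tens_add [of f "cells R T n" g]
  by (simp add: tensor_group_def FactGroup_def)

lemma tor_cycles_P: "f \<in> tor_cycles \<Longrightarrow> f \<in> P2"
  by (simp add: tor_cycles_def)

lemma tor_coset:
  assumes "f \<in> tor_cycles"
  shows "ts2 ` bd ` P3
    #>\<^bsub>TP2\<lparr>carrier := ts2 ` tor_cycles\<rparr>\<^esub>
    ts2 f = tor f"
  unfolding r_coset_def tor_def
  using ts_add [OF bd_closed tor_cycles_P [OF assms]] by auto

lemma Tor_carrier: "carrier H2 = tor ` tor_cycles"
proof -
  let ?H = "ts2 ` bd ` P3"
  let ?G = "TP2\<lparr>carrier := ts2 ` tor_cycles\<rparr>"
  have "carrier H2 = (\<lambda>f. ?H #>\<^bsub>?G\<^esub> ts2 f) ` tor_cycles"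
    unfolding Tor_2 FactGroup_def RCOSETS_def by auto
  also have "\<dots> = tor ` tor_cycles" by (rule image_cong [OF refl tor_coset])
  finally show ?thesis .
qed

lemma tor_zero: "tor (\<lambda>_. \<zero>) = ts2 ` bd ` P3"
  unfolding tor_def image_image
  by (rule image_cong) (use P_values [OF bd_closed] in auto)

lemma Tor_one: "\<one>\<^bsub>H2\<^esub> = tor (\<lambda>_. \<zero>)"
  unfolding Tor_2 FactGroup_def tor_zero by simp

lemma tor_cycles_add:
  assumes "f \<in> tor_cycles" "g \<in> tor_cycles"
  shows "(\<lambda>i. f i \<oplus> g i) \<in> tor_cycles"
  using assms P_values [OF bd_closed] bd_add P_add unfolding tor_cycles_def
  by (auto simp: eps_add)

lemma tor_add:
  assumes f: "f \<in> tor_cycles" and g: "g \<in> tor_cycles"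
  shows "tor f \<otimes>\<^bsub>H2\<^esub> tor g = tor (\<lambda>i. f i \<oplus> g i)"
proof -
  note fv = P_values [OF tor_cycles_P [OF f]] P_values [OF tor_cycles_P [OF g]]
  have eq: "ts2 (\<lambda>i. bd s i \<oplus> f i) \<otimes>\<^bsub>TP2\<^esub>
      ts2 (\<lambda>i. bd t i \<oplus> g i)
      = ts2 (\<lambda>i. bd (\<lambda>i. s i \<oplus> t i) i \<oplus> (f i \<oplus> g i))"
    if st: "s \<in> P3" "t \<in> P3" for s t
  proof -
    have v: "bd s i \<in> carrier R" "bd t i \<in> carrier R" for i
      using P_values bd_closed st by blast+
    have "(\<lambda>i. bd s i \<oplus> f i \<oplus> (bd t i \<oplus> g i)) = (\<lambda>i. bd (\<lambda>i. s i \<oplus> t i) i \<oplus> (f i \<oplus> g i))"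
      using v fv by (simp add: bd_add [OF st] a_ac)
    then show ?thesis
      using ts_add [OF P_add [OF bd_closed [OF st(1)] tor_cycles_P [OF f]]
          P_add [OF bd_closed [OF st(2)] tor_cycles_P [OF g]]] by simp
  qed
  have "tor f \<otimes>\<^bsub>H2\<^esub> tor g
    = {x \<otimes>\<^bsub>TP2\<^esub> y | x y. x \<in> tor f \<and> y \<in> tor g}"
    unfolding Tor_2 FactGroup_def set_mult_def by auto
  also have "\<dots> = {ts2 (\<lambda>i. bd (\<lambda>i. s i \<oplus> t i) i \<oplus> (f i \<oplus> g i)) | s t.
      s \<in> P3 \<and> t \<in> P3}" (is "_ = ?M")
  proof (intro equalityI subsetI)
    fix z assume "z \<in> {x \<otimes>\<^bsub>TP2\<^esub> y | x y. x \<in> tor f \<and> y \<in> tor g}"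
    then obtain s t where st: "s \<in> P3" "t \<in> P3"
      "z = ts2 (\<lambda>i. bd s i \<oplus> f i) \<otimes>\<^bsub>TP2\<^esub>
        ts2 (\<lambda>i. bd t i \<oplus> g i)"
      unfolding tor_def by auto
    then show "z \<in> ?M" using eq [OF st(1,2)] by (intro CollectI exI [of _ s] exI [of _ t] conjI) simp_all
  next
    fix z assume "z \<in> ?M"
    then obtain s t where st: "s \<in> P3" "t \<in> P3"
      "z = ts2 (\<lambda>i. bd (\<lambda>i. s i \<oplus> t i) i \<oplus> (f i \<oplus> g i))"
      by auto
    have "ts2 (\<lambda>i. bd s i \<oplus> f i) \<in> tor f" "ts2 (\<lambda>i. bd t i \<oplus> g i) \<in> tor g"
      unfolding tor_def using st(1,2) by simp_all
    then show "z \<in> {x \<otimes>\<^bsub>TP2\<^esub> y | x y. x \<in> tor f \<and> y \<in> tor g}"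
      unfolding st(3) eq [OF st(1,2), symmetric] by blast
  qed
  also have "\<dots> = tor (\<lambda>i. f i \<oplus> g i)"
  proof (intro equalityI subsetI)
    fix x assume "x \<in> ?M"
    then show "x \<in> tor (\<lambda>i. f i \<oplus> g i)" unfolding tor_def using P_add by auto
  next
    fix x assume "x \<in> tor (\<lambda>i. f i \<oplus> g i)"
    then obtain s where s: "s \<in> P3"
      "x = ts2 (\<lambda>i. bd s i \<oplus> (f i \<oplus> g i))" unfolding tor_def by auto
    have "(\<lambda>i. s i \<oplus> \<zero>) = s" using P_values [OF s(1)] by simp
    then show "x \<in> ?M" using s P_zero by (intro CollectI exI [of _ s] exI [of _ "\<lambda>_. \<zero>"]) simp
  qed
  finally show ?thesis .
qed

lemma tor_self: "f \<in> tor_cycles \<Longrightarrow> ts2 f \<in> tor f"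
  unfolding tor_def
  by (rule image_eqI [OF _ P_zero]) (use P_values [OF tor_cycles_P] in \<open>simp add: bd_zero\<close>)

lemma tor_eqD:
  assumes "f \<in> tor_cycles" "tor f = tor g" "g \<in> tor_cycles"
  shows "\<exists>s\<in>P3. \<forall>c. eps (f c) = eps (bd s c) + eps (g c)"
proof -
  have "ts2 f \<in> tor g" using tor_self [OF assms(1)] assms(2) by simp
  then obtain s where s: "s \<in> P3"
    "ts2 f = ts2 (\<lambda>i. bd s i \<oplus> g i)" unfolding tor_def by auto
  have "eps (f c) = eps (bd s c \<oplus> g c)" for c
    using s(2) tens_eq_iff [of f "cells R T (Suc (Suc 0))" "\<lambda>i. bd s i \<oplus> g i"] tor_cycles_P [OF assms(1)]
    unfolding P_def by simp
  then show ?thesis using s(1) P_values [OF bd_closed [OF s(1)]] P_values [OF tor_cycles_P [OF assms(3)]]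
    by (auto simp: eps_add)
qed

lemma tor_cong:
  assumes f: "f \<in> tor_cycles" and g: "g \<in> tor_cycles" and s: "s \<in> P3"
    and e: "\<And>c. eps (f c) = eps (bd s c) + eps (g c)"
  shows "tor f = tor g"
proof -
  have sub: "tor f \<subseteq> tor g"
    if f: "f \<in> tor_cycles" and g: "g \<in> tor_cycles" and s: "s \<in> P3"
      and e: "\<And>c. eps (f c) = eps (bd s c) + eps (g c)" for f g s
  proof
    fix x assume "x \<in> tor f"
    then obtain t where t: "t \<in> P3" "x = ts2 (\<lambda>i. bd t i \<oplus> f i)"
      unfolding tor_def by auto
    note v = P_values [OF bd_closed [OF s]] P_values [OF bd_closed [OF t(1)]]
      P_values [OF tor_cycles_P [OF f]] P_values [OF tor_cycles_P [OF g]]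
    have "(\<lambda>i. bd t i \<oplus> f i) \<in> P2"
      by (intro P_add bd_closed t tor_cycles_P f)
    then have "x = ts2 (\<lambda>i. bd (\<lambda>i. t i \<oplus> s i) i \<oplus> g i)"
      unfolding t(2) P_def using v
      by (subst tens_eq_iff) (auto simp: bd_add [OF t(1) s] eps_add e)
    then show "x \<in> tor g" unfolding tor_def using P_add [OF t(1) s] by auto
  qed
  show ?thesis
  proof (rule equalityI [OF sub [OF f g s e] sub [OF g f P_uminus [OF s]]])
    show "eps (g c) = eps (bd (\<lambda>i. \<ominus> s i) c) + eps (f c)" for c
      using e [of c] P_values [OF bd_closed [OF s]] by (simp add: bd_uminus [OF s] eps_uminus)
  qed
qed

lemma tor_cycles_zero: "(\<lambda>_. \<zero>) \<in> tor_cycles"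
  by (simp add: tor_cycles_def P_zero bd_zero)

text \<open>Powers of classes lift to chains, and an additive functional \<open>F\<close> on chains records the exponent.\<close>

lemma tor_pow:
  fixes F :: "_ \<Rightarrow> int"
  assumes f: "f \<in> tor_cycles" and z: "F (\<lambda>_. \<zero>) = 0"
    and add: "\<And>f g. \<lbrakk>f \<in> P2; g \<in> P2\<rbrakk> \<Longrightarrow> F (\<lambda>i. f i \<oplus> g i) = F f + F g"
  shows "\<exists>q\<in>tor_cycles. tor f [^]\<^bsub>H2\<^esub> (n::nat) = tor q \<and> F q = int n * F f"
proof (induction n)
  case 0
  show ?case using tor_cycles_zero z by (intro bexI [of _ "\<lambda>_. \<zero>"]) (auto simp: Tor_one nat_pow_def)
next
  case (Suc n)
  then obtain q where q: "q \<in> tor_cycles" "tor f [^]\<^bsub>H2\<^esub> n = tor q" "F q = int n * F f" by blast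
  have "tor f [^]\<^bsub>H2\<^esub> Suc n = tor (\<lambda>i. q i \<oplus> f i)"
    using q(2) tor_add [OF q(1) f] by (simp add: nat_pow_def)
  then show ?case
    using tor_cycles_add [OF q(1) f] add [OF tor_cycles_P [OF q(1)] tor_cycles_P [OF f]] q(3)
    by (intro bexI [of _ "\<lambda>i. q i \<oplus> f i"]) (auto simp: algebra_simps)
qed

subsection \<open>A divisible class forces cohomology in degree 3\<close>

text \<open>The cycles in degree 2, which form the image of the boundary from degree 3. They are the
  coefficients for which the boundary itself is a cocycle of degree 3.\<close>

definition cycle_module :: "('a, ('a, int) cell \<Rightarrow> 'a) module" where
  "cycle_module = (resolution R T (Suc (Suc 0)))
    \<lparr>carrier := {f \<in> P2. bd f = (\<lambda>_. \<zero>)}\<rparr>"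

lemma cycle_module_simps [simp]:
  "carrier cycle_module = {f \<in> P2. bd f = (\<lambda>_. \<zero>)}"
  "add cycle_module = (\<lambda>f g i. f i \<oplus> g i)"
  "ring.zero cycle_module = (\<lambda>_. \<zero>)"
  "smult cycle_module = (\<lambda>r f i. r \<otimes> f i)"
  by (simp_all add: cycle_module_def P_def)

lemma cycle_module_left_module: "left_module R cycle_module"
proof (intro left_module.intro left_module_axioms.intro ring_axioms abelian_groupI, goal_cases)
  case (6 x)
  then have "(\<lambda>i. \<ominus> x i) \<in> carrier cycle_module"
    by (auto simp: P_uminus bd_uminus)
  then show ?case using 6 P_values [of x] by (intro bexI [of _ "\<lambda>i. \<ominus> x i"]) (auto simp: l_neg)
qed (auto simp: P_add P_zero P_smult bd_add bd_zero bd_smult P_values a_ac m_assoc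
    l_distr r_distr fun_eq_iff)

text \<open>If the boundary, seen as a cocycle with values in the degree 2 cycles, were a coboundary, then it
  would extend to a retraction \<open>h\<close> of the degree 2 chains onto the cycles. The complement \<open>f - h f\<close>
  kills boundaries, so it would embed the second Tor group into the free abelian group of augmented
  chains, in which no nonzero element is divisible by every power of 2.\<close>

theorem divisible_Tor_imp_Ext:
  assumes z: "z \<in> carrier H2" "z \<noteq> \<one>\<^bsub>H2\<^esub>"
    and div: "\<And>k. k \<ge> 1 \<Longrightarrow> \<exists>y\<in>carrier H2. z = y [^]\<^bsub>H2\<^esub> ((2::nat) ^ k)"
  shows "carrier (Ext 3 R T cycle_module) \<noteq> {\<one>\<^bsub>Ext 3 R T cycle_module\<^esub>}"
proof
  assume triv: "carrier (Ext 3 R T cycle_module) = {\<one>\<^bsub>Ext 3 R T cycle_module\<^esub>}"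
  let ?P4 = "P (Suc (Suc (Suc (Suc 0))))"
  let ?H2 = "hom_group R (resolution R T (Suc (Suc 0))) cycle_module"
  let ?H3 = "hom_group R (resolution R T (Suc (Suc (Suc 0)))) cycle_module"
  let ?H4 = "hom_group R (resolution R T (Suc (Suc (Suc (Suc 0))))) cycle_module"
  let ?f = "\<lambda>h. \<lambda>x\<in>P3. h (bd x)" and ?g = "\<lambda>h. \<lambda>x\<in>?P4. h (bd x)"
  have E: "Ext 3 R T cycle_module = ?H3\<lparr>carrier := kernel ?H3 ?H4 ?g\<rparr> Mod (?f ` carrier ?H2)"
    unfolding Ext_def homology_at_def by (simp add: numeral_3_eq_3 differential_def)
  have add: "add (resolution R T n) = (\<lambda>f g i. f i \<oplus> g i)"
    and smult: "smult (resolution R T n) = (\<lambda>r f i. r \<otimes> f i)" for n by (simp_all add: P_def)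
  let ?D = "\<lambda>x\<in>P3. bd x"
  have D: "?D \<in> kernel ?H3 ?H4 ?g"
    unfolding kernel_def hom_group_def
    by (auto simp: add smult P_add P_smult bd_closed bd_bd bd_add bd_smult)
  let ?Z = "\<lambda>x\<in>P2. (\<lambda>_. \<zero>)"
  have Z: "?Z \<in> carrier ?H2"
    unfolding hom_group_def by (auto simp: add smult P_add P_smult P_zero bd_zero)
  have "?D \<in> ?f ` carrier ?H2"
  proof -
    let ?N = "?f ` carrier ?H2"
    have "?N #>\<^bsub>?H3\<lparr>carrier := kernel ?H3 ?H4 ?g\<rparr>\<^esub> ?D \<in> carrier (Ext 3 R T cycle_module)"
      unfolding E FactGroup_def RCOSETS_def using D by auto
    then have "?N #>\<^bsub>?H3\<lparr>carrier := kernel ?H3 ?H4 ?g\<rparr>\<^esub> ?D = ?N"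
      unfolding triv unfolding E FactGroup_def by simp
    moreover have "?f ?Z \<otimes>\<^bsub>?H3\<^esub> ?D \<in> ?N #>\<^bsub>?H3\<lparr>carrier := kernel ?H3 ?H4 ?g\<rparr>\<^esub> ?D"
      unfolding r_coset_def by (rule UN_I [OF imageI [OF Z]]) simp
    moreover have "?f ?Z \<otimes>\<^bsub>?H3\<^esub> ?D = ?D"
      using P_values [OF bd_closed [of _ "Suc (Suc 0)"]] bd_closed [of _ "Suc (Suc 0)"]
      by (auto simp: hom_group_def fun_eq_iff)
    ultimately show ?thesis by simp
  qed
  then obtain h where h: "h \<in> carrier ?H2" and hD: "?D = ?f h" by blast
  \<comment> \<open>\<open>h\<close> retracts the chains of degree 2 onto the cycles.\<close>
  have h_closed: "h f \<in> P2" "bd (h f) = (\<lambda>_. \<zero>)" if "f \<in> P2" for f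
    using h that unfolding hom_group_def by (auto simp: PiE_iff)
  have h_add: "h (\<lambda>i. f i \<oplus> g i) = (\<lambda>i. h f i \<oplus> h g i)" if "f \<in> P2" "g \<in> P2" for f g
    using h that unfolding hom_group_def by (auto simp: add)
  have h_smult: "h (\<lambda>i. u \<otimes> f i) = (\<lambda>i. u \<otimes> h f i)" if "f \<in> P2" "u \<in> carrier R" for f u
    using h that unfolding hom_group_def by (auto simp: smult)
  have h_bd: "h (bd s) = bd s" if "s \<in> P3" for s
    using fun_cong [OF hD, of s] that by simp
  have hv: "h f c \<in> carrier R" if "f \<in> P2" for f c
    using P_values [OF h_closed(1) [OF that]] .
  \<comment> \<open>the augmented coordinates of the complement \<open>f - h f\<close>\<close>
  define L where "L f c = eps (f c) - eps (h f c)" for f c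
  have L_add: "L (\<lambda>i. f i \<oplus> g i) c = L f c + L g c" if "f \<in> P2" "g \<in> P2" for f g c
    using that hv P_values by (simp add: L_def h_add eps_add)
  have h0: "h (\<lambda>_. \<zero>) = (\<lambda>_. \<zero>)"
    using h_bd [OF P_zero] by (simp add: bd_zero)
  have L_0: "L (\<lambda>_. \<zero>) c = 0" for c by (simp add: L_def h0)
  have L_eps: "L f c = 0" if "f \<in> P2" "\<And>c. eps (f c) = 0" for f c
    using that unfolding P_def
  proof (induction rule: free_module_induct_eps)
    case zero
    then show ?case by (rule L_0)
  next
    case (monomial u d)
    have m: "monomial \<one> d \<in> P2" using monomial by (intro P_monomial) auto
    have "monomial u d = (\<lambda>i. u \<otimes> monomial \<one> d i)" using monomial(1) by (auto simp: monomial_def)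
    then show ?case
      using monomial(1,2) h_smult [OF m monomial(1)] hv [OF m] P_values [OF m]
      by (simp add: L_def eps_mult)
  next
    case (add f g)
    then show ?case using L_add [unfolded P_def, of f g] by simp
  qed
  have L_bd: "L (bd s) c = 0" if "s \<in> P3" for s c by (simp add: L_def h_bd [OF that])
  have L_cong: "L f c = L g c" if "f \<in> P2" "g \<in> P2" "\<And>c. eps (f c) = eps (g c)" for f g c
  proof -
    have u: "(\<lambda>i. \<ominus> g i) \<in> P2" using that by (intro P_uminus)
    have "L (\<lambda>i. f i \<oplus> \<ominus> g i) c = 0"
      by (rule L_eps [OF P_add [OF that(1) u]])
        (use that P_values [OF that(1)] P_values [OF that(2)] in \<open>simp add: eps_add eps_uminus\<close>)
    moreover have "L (\<lambda>i. g i \<oplus> \<ominus> g i) c = 0"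
      using P_values [OF that(2)] by (simp add: r_neg L_0)
    ultimately show ?thesis using L_add [OF that(1) u] L_add [OF that(2) u] by simp
  qed
  obtain r where r: "r \<in> tor_cycles" "z = tor r" using z(1) by (auto simp: Tor_carrier)
  \<comment> \<open>\<open>L\<close> is additive and kills boundaries, so it inherits the divisibility of the class.\<close>
  have dvd: "(2::int) ^ k dvd L r c" if k: "k \<ge> 1" for k c
  proof -
    obtain y where y: "y \<in> tor_cycles" "tor r = tor y [^]\<^bsub>H2\<^esub> ((2::nat) ^ k)"
      using div [OF k] by (auto simp: Tor_carrier r(2))
    obtain q where q: "q \<in> tor_cycles" "tor r = tor q" "L q c = int (2 ^ k) * L y c"
      using tor_pow [OF y(1), of "\<lambda>f. L f c" "2 ^ k"] L_0 L_add y(2) by auto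
    obtain s where s: "s \<in> P3" "\<And>c. eps (r c) = eps (bd s c) + eps (q c)"
      using tor_eqD [OF r(1) q(2,1)] by blast
    have "L r c = L (\<lambda>i. bd s i \<oplus> q i) c"
      by (rule L_cong [OF tor_cycles_P [OF r(1)] P_add [OF bd_closed [OF s(1)] tor_cycles_P [OF q(1)]]])
        (use s(2) P_values [OF bd_closed [OF s(1)]] P_values [OF tor_cycles_P [OF q(1)]] in
          \<open>simp add: eps_add\<close>)
    also have "\<dots> = L q c"
      using L_add [OF bd_closed [OF s(1)] tor_cycles_P [OF q(1)]] L_bd [OF s(1)] by simp
    finally show ?thesis by (simp add: q(3))
  qed
  have L_r: "L r c = 0" for c
  proof (rule ccontr)
    assume n: "L r c \<noteq> 0"
    let ?k = "Suc (nat \<bar>L r c\<bar>)"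
    have "(2::int) ^ ?k \<le> \<bar>L r c\<bar>" using dvd_imp_le_int [OF n dvd [of ?k c]] by simp
    moreover have "int (nat \<bar>L r c\<bar>) < 2 ^ nat \<bar>L r c\<bar>" by (rule of_nat_less_two_power)
    ultimately show False by simp
  qed
  note rP = tor_cycles_P [OF r(1)]
  obtain s where s: "s \<in> P3" "bd s = h r"
    using exact [OF h_closed [OF rP]] by blast
  have "tor r = tor (\<lambda>_. \<zero>)"
    by (rule tor_cong [OF r(1) tor_cycles_zero s(1)]) (use L_r in \<open>simp add: L_def s(2)\<close>)
  then show False using z(2) r(2) by (simp add: Tor_one)
qed

subsection \<open>Classes of cycles in degree 1\<close>

text \<open>By exactness the second Tor group is the quotient of the degree 1 cycles with augmentation zero by
  the sums of products of an element of the augmentation ideal with a cycle. Its classes are easier to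
  handle in degree 1: here \<open>null_cycles\<close> consists of these sums, written as boundaries, and \<open>zeta m\<close> is
  the class of a cycle \<open>m\<close>.\<close>

definition null_cycles where
  "null_cycles = bd ` {f \<in> P2. \<forall>c. eps (f c) = 0}"

definition zeta where
  "zeta m = tor (SOME f. f \<in> P2 \<and> bd f = m)"

definition zeta_cycles where
  "zeta_cycles = {m \<in> P1. bd m = (\<lambda>_. \<zero>) \<and> (\<forall>c. eps (m c) = 0)}"

lemma zeta_cycles_P: "m \<in> zeta_cycles \<Longrightarrow> m \<in> P1"
  by (simp add: zeta_cycles_def)

lemma zeta_lift:
  assumes "m \<in> zeta_cycles"
  shows "\<exists>f\<in>tor_cycles. bd f = m \<and> zeta m = tor f"
proof -
  let ?f = "SOME f. f \<in> P2 \<and> bd f = m"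
  have "\<exists>f. f \<in> P2 \<and> bd f = m"
    using exact [of m 0] assms by (auto simp: zeta_cycles_def)
  then have f: "?f \<in> P2 \<and> bd ?f = m" by (rule someI_ex)
  then have "?f \<in> tor_cycles" using assms unfolding tor_cycles_def zeta_cycles_def by auto
  then show ?thesis using f unfolding zeta_def by blast
qed

lemma zeta_closed: "m \<in> zeta_cycles \<Longrightarrow> zeta m \<in> carrier H2"
  using zeta_lift by (auto simp: Tor_carrier)

lemma tor_eq_if_bd_eq:
  assumes "f \<in> tor_cycles" "g \<in> tor_cycles" "bd f = bd g"
  shows "tor f = tor g"
proof -
  note P = tor_cycles_P [OF assms(1)] tor_cycles_P [OF assms(2)]
  have "bd (\<lambda>i. f i \<ominus> g i) = (\<lambda>_. \<zero>)"
    unfolding bd_diff [OF P] assms(3) using P_values [OF bd_closed [OF P(2)]] by (simp add: minus_eq r_neg)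
  then obtain s where s: "s \<in> P3" "bd s = (\<lambda>i. f i \<ominus> g i)"
    using exact [OF P_diff [OF P]] by blast
  show ?thesis
    by (rule tor_cong [OF assms(1,2) s(1)])
      (use P_values [OF P(1)] P_values [OF P(2)] in \<open>simp add: s(2) minus_eq eps_add eps_uminus\<close>)
qed

lemma zeta_cycles_add:
  assumes "m \<in> zeta_cycles" "m' \<in> zeta_cycles"
  shows "(\<lambda>i. m i \<oplus> m' i) \<in> zeta_cycles"
  using assms P_add P_values unfolding zeta_cycles_def by (auto simp: bd_add eps_add)

lemma zeta_add:
  assumes m: "m \<in> zeta_cycles" and m': "m' \<in> zeta_cycles"
  shows "zeta (\<lambda>i. m i \<oplus> m' i) = zeta m \<otimes>\<^bsub>H2\<^esub> zeta m'"
proof -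
  obtain f where f: "f \<in> tor_cycles" "bd f = m" "zeta m = tor f" using zeta_lift [OF m] by blast
  obtain g where g: "g \<in> tor_cycles" "bd g = m'" "zeta m' = tor g" using zeta_lift [OF m'] by blast
  obtain h where h: "h \<in> tor_cycles" "bd h = (\<lambda>i. m i \<oplus> m' i)" "zeta (\<lambda>i. m i \<oplus> m' i) = tor h"
    using zeta_lift [OF zeta_cycles_add [OF m m']] by blast
  have "tor h = tor (\<lambda>i. f i \<oplus> g i)"
    by (rule tor_eq_if_bd_eq [OF h(1) tor_cycles_add [OF f(1) g(1)]])
      (simp add: h(2) f(2) g(2) bd_add [OF tor_cycles_P [OF f(1)] tor_cycles_P [OF g(1)]])
  then show ?thesis using tor_add [OF f(1) g(1)] f g h by simp
qed

lemma zeta_eq_one_iff: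
  assumes m: "m \<in> zeta_cycles"
  shows "zeta m = \<one>\<^bsub>H2\<^esub> \<longleftrightarrow> m \<in> null_cycles"
proof
  obtain f where f: "f \<in> tor_cycles" "bd f = m" "zeta m = tor f" using zeta_lift [OF m] by blast
  {
    assume "zeta m = \<one>\<^bsub>H2\<^esub>"
    then have "tor f = tor (\<lambda>_. \<zero>)" using f by (simp add: Tor_one)
    then obtain s where s: "s \<in> P3" "\<And>c. eps (f c) = eps (bd s c) + eps \<zero>"
      using tor_eqD [OF f(1) _ tor_cycles_zero] by blast
    note P = tor_cycles_P [OF f(1)] bd_closed [OF s(1)]
    have "bd (\<lambda>i. f i \<ominus> bd s i) = m"
      unfolding bd_diff [OF P] bd_bd [OF s(1)] using f(2) P_values [OF zeta_cycles_P [OF m]]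
      by (simp add: minus_eq)
    moreover have "eps (f c \<ominus> bd s c) = 0" for c
      using s(2) P_values [OF P(1)] P_values [OF P(2)] by (simp add: minus_eq eps_add eps_uminus)
    ultimately show "m \<in> null_cycles"
      unfolding null_cycles_def using P_diff [OF P] by blast
  }
  assume "m \<in> null_cycles"
  then obtain g where g: "g \<in> P2" "\<And>c. eps (g c) = 0" "m = bd g"
    by (auto simp: null_cycles_def)
  then have gc: "g \<in> tor_cycles" using m unfolding tor_cycles_def zeta_cycles_def by auto
  have "tor f = tor g" by (rule tor_eq_if_bd_eq [OF f(1) gc]) (simp add: f(2) g(3))
  also have "\<dots> = tor (\<lambda>_. \<zero>)"
    by (rule tor_cong [OF gc tor_cycles_zero P_zero]) (simp add: g(2) bd_zero)
  finally show "zeta m = \<one>\<^bsub>H2\<^esub>" using f by (simp add: Tor_one)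
qed

lemma null_cycles_zero: "(\<lambda>_. \<zero>) \<in> null_cycles"
  unfolding null_cycles_def by (rule image_eqI [of _ _ "\<lambda>_. \<zero>"]) (auto simp: bd_zero P_zero)

lemma null_cycles_add:
  assumes "m \<in> null_cycles" "m' \<in> null_cycles"
  shows "(\<lambda>i. m i \<oplus> m' i) \<in> null_cycles"
proof -
  obtain f g where fg: "f \<in> P2" "\<And>c. eps (f c) = 0" "m = bd f"
    "g \<in> P2" "\<And>c. eps (g c) = 0" "m' = bd g"
    using assms unfolding null_cycles_def by auto
  show ?thesis unfolding null_cycles_def
    by (rule image_eqI [of _ _ "\<lambda>i. f i \<oplus> g i"])
      (use fg P_values [OF fg(1)] P_values [OF fg(4)] in \<open>simp_all add: bd_add P_add eps_add\<close>)
qed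

lemma null_cycles_uminus:
  assumes "m \<in> null_cycles"
  shows "(\<lambda>i. \<ominus> m i) \<in> null_cycles"
proof -
  obtain f where f: "f \<in> P2" "\<And>c. eps (f c) = 0" "m = bd f"
    using assms unfolding null_cycles_def by auto
  show ?thesis unfolding null_cycles_def
    by (rule image_eqI [of _ _ "\<lambda>i. \<ominus> f i"])
      (use f P_values [OF f(1)] in \<open>simp_all add: bd_uminus P_uminus eps_uminus\<close>)
qed

text \<open>If \<open>m\<close> is the boundary of \<open>f\<close>, then \<open>u m\<close> is the boundary of \<open>u f\<close>, which is zero after tensoring. All
  relations between degree 2 classes below come from this.\<close>

lemma null_cycles_smult:
  assumes "m \<in> P1" "bd m = (\<lambda>_. \<zero>)" "u \<in> carrier R" "eps u = 0"
  shows "(\<lambda>i. u \<otimes> m i) \<in> null_cycles"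
proof -
  obtain f where f: "f \<in> P2" "bd f = m" using exact assms(1,2) by blast
  show ?thesis unfolding null_cycles_def
    by (rule image_eqI [of _ _ "\<lambda>i. u \<otimes> f i"])
      (use f assms(3,4) P_values [OF f(1)] in \<open>simp_all add: bd_smult P_smult eps_mult\<close>)
qed

text \<open>The criterion by which a class will be shown to be nonzero.\<close>

lemma null_cycles_functional:
  fixes F :: "_ \<Rightarrow> real"
  assumes add: "\<And>f g. \<lbrakk>f \<in> P1; g \<in> P1\<rbrakk> \<Longrightarrow> F (\<lambda>i. f i \<oplus> g i) = F f + F g"
    and smult: "\<And>u m. \<lbrakk>u \<in> carrier R; m \<in> P1; bd m = (\<lambda>_. \<zero>); eps u = 0\<rbrakk>
      \<Longrightarrow> F (\<lambda>i. u \<otimes> m i) = 0"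
    and m: "m \<in> null_cycles"
  shows "F m = 0"
proof -
  obtain f where f: "f \<in> P2" "\<And>c. eps (f c) = 0" "m = bd f"
    using m unfolding null_cycles_def by auto
  have "F (bd f) = 0"
    using f(1,2) unfolding P_def
  proof (induction rule: free_module_induct_eps)
    case zero
    have "F (\<lambda>_. \<zero>) = F (\<lambda>_. \<zero>) + F (\<lambda>_. \<zero>)" using add [OF P_zero P_zero] by simp
    then show ?case by (simp add: bd_zero)
  next
    case (monomial u c)
    then show ?case
      using smult [OF monomial(1) syz_closed [OF monomial(3)] syz_bd [OF monomial(3)] monomial(2)]
      by (simp add: bd_monomial)
  next
    case (add f g)
    then show ?case
      using assms(1) [OF bd_closed [of f] bd_closed [of g]] bd_add [of f _ g] unfolding P_def
      by simp
  qed
  then show ?thesis by (simp add: f(3))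
qed

end

context augmented_ring
begin

lemma Tor_monoid: "Group.monoid H2"
proof (rule monoidI)
  fix x y z
  assume "x \<in> carrier H2" "y \<in> carrier H2" "z \<in> carrier H2"
  then obtain f g h where fgh: "f \<in> tor_cycles" "x = tor f" "g \<in> tor_cycles" "y = tor g"
    "h \<in> tor_cycles" "z = tor h" unfolding Tor_carrier by blast
  note v = P_values [OF tor_cycles_P [OF fgh(1)]] P_values [OF tor_cycles_P [OF fgh(3)]]
    P_values [OF tor_cycles_P [OF fgh(5)]]
  show "x \<otimes>\<^bsub>H2\<^esub> y \<in> carrier H2"
    using fgh tor_cycles_add by (simp add: tor_add Tor_carrier)
  show "x \<otimes>\<^bsub>H2\<^esub> y \<otimes>\<^bsub>H2\<^esub> z = x \<otimes>\<^bsub>H2\<^esub> (y \<otimes>\<^bsub>H2\<^esub> z)"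
    using fgh tor_cycles_add v by (simp add: tor_add a_assoc)
  show "\<one>\<^bsub>H2\<^esub> \<otimes>\<^bsub>H2\<^esub> x = x" "x \<otimes>\<^bsub>H2\<^esub> \<one>\<^bsub>H2\<^esub> = x"
    using fgh(1,2) v tor_cycles_zero by (simp_all add: Tor_one tor_add)
qed (auto simp: Tor_one Tor_carrier tor_cycles_zero)

text \<open>Congruence is needed on all chains of degree 1: the chains attached to single brackets are not
  cycles, only suitable combinations of them are.\<close>

definition ceq (infix "\<doteq>" 50) where
  "m \<doteq> m' \<longleftrightarrow> m \<in> P1 \<and> m' \<in> P1 \<and> (\<lambda>c. m c \<ominus> m' c) \<in> null_cycles"

lemma ceq_refl: "m \<in> P1 \<Longrightarrow> m \<doteq> m"
  using P_values [of m "Suc 0"] null_cycles_zero by (simp add: ceq_def minus_eq r_neg)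

lemma ceq_sym: "m \<doteq> m' \<Longrightarrow> m' \<doteq> m"
proof -
  assume a: "m \<doteq> m'"
  then have P: "m \<in> P1" "m' \<in> P1" by (auto simp: ceq_def)
  have "(\<lambda>c. m' c \<ominus> m c) = (\<lambda>c. \<ominus> (m c \<ominus> m' c))"
    using P_values [OF P(1)] P_values [OF P(2)] by (simp add: minus_eq minus_add a_comm)
  then show ?thesis using a P null_cycles_uminus by (simp add: ceq_def)
qed

lemma ceq_trans: "\<lbrakk>m \<doteq> m'; m' \<doteq> m''\<rbrakk> \<Longrightarrow> m \<doteq> m''"
proof -
  assume a: "m \<doteq> m'" "m' \<doteq> m''"
  then have P: "m \<in> P1" "m' \<in> P1" "m'' \<in> P1" by (auto simp: ceq_def)
  have "m c \<ominus> m'' c = (m c \<ominus> m' c) \<oplus> (m' c \<ominus> m'' c)" for c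
    using P_values [OF P(1), of c] P_values [OF P(2), of c] P_values [OF P(3), of c] by algebra
  then show ?thesis using a P null_cycles_add [of "\<lambda>c. m c \<ominus> m' c" "\<lambda>c. m' c \<ominus> m'' c"]
    by (simp add: ceq_def)
qed

lemma ceq_add: "\<lbrakk>m \<doteq> m'; n \<doteq> n'\<rbrakk> \<Longrightarrow> (\<lambda>c. m c \<oplus> n c) \<doteq> (\<lambda>c. m' c \<oplus> n' c)"
proof -
  assume a: "m \<doteq> m'" "n \<doteq> n'"
  then have P: "m \<in> P1" "m' \<in> P1" "n \<in> P1" "n' \<in> P1" by (auto simp: ceq_def)
  have "m c \<oplus> n c \<ominus> (m' c \<oplus> n' c) = (m c \<ominus> m' c) \<oplus> (n c \<ominus> n' c)" for c
    using P_values [OF P(1), of c] P_values [OF P(2), of c] P_values [OF P(3), of c] P_values [OF P(4), of c]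
    by algebra
  then show ?thesis using a P P_add null_cycles_add [of "\<lambda>c. m c \<ominus> m' c" "\<lambda>c. n c \<ominus> n' c"]
    by (simp add: ceq_def)
qed

lemma ceq_uminus: "m \<doteq> m' \<Longrightarrow> (\<lambda>c. \<ominus> m c) \<doteq> (\<lambda>c. \<ominus> m' c)"
proof -
  assume a: "m \<doteq> m'"
  then have P: "m \<in> P1" "m' \<in> P1" by (auto simp: ceq_def)
  have "(\<lambda>c. \<ominus> m c \<ominus> (\<ominus> m' c)) = (\<lambda>c. \<ominus> (m c \<ominus> m' c))"
    using P_values [OF P(1)] P_values [OF P(2)] by (simp add: minus_eq minus_add)
  then show ?thesis using a P P_uminus null_cycles_uminus by (simp add: ceq_def)
qed

lemma ceq_diff: "\<lbrakk>m \<doteq> m'; n \<doteq> n'\<rbrakk> \<Longrightarrow> (\<lambda>c. m c \<ominus> n c) \<doteq> (\<lambda>c. m' c \<ominus> n' c)"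
  unfolding minus_eq by (intro ceq_add ceq_uminus)

lemma ceq_zeta_cycles: "\<lbrakk>m \<doteq> m'; m \<in> zeta_cycles; m' \<in> zeta_cycles\<rbrakk> \<Longrightarrow> zeta m = zeta m'"
proof -
  assume a: "m \<doteq> m'" and m: "m \<in> zeta_cycles" and m': "m' \<in> zeta_cycles"
  note v = P_values [OF zeta_cycles_P [OF m]] P_values [OF zeta_cycles_P [OF m']]
  have n: "(\<lambda>c. m c \<ominus> m' c) \<in> null_cycles" using a by (simp add: ceq_def)
  have z: "(\<lambda>c. m c \<ominus> m' c) \<in> zeta_cycles"
    using m m' P_diff [of m "Suc 0" m'] bd_diff [of m 0 m'] v
    unfolding zeta_cycles_def by (auto simp: minus_eq eps_add eps_uminus)
  have "zeta m = zeta (\<lambda>c. (m c \<ominus> m' c) \<oplus> m' c)"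
    using v by (simp add: minus_eq a_assoc l_neg)
  also have "\<dots> = \<one>\<^bsub>H2\<^esub> \<otimes>\<^bsub>H2\<^esub> zeta m'"
    using zeta_add [OF z m'] zeta_eq_one_iff [OF z] n by simp
  also have "\<dots> = zeta m'" by (rule monoid.l_one [OF Tor_monoid zeta_closed [OF m']])
  finally show ?thesis .
qed

lemma doubling_divisible:
  assumes "\<And>k. m k \<in> zeta_cycles" "\<And>k. zeta (m k) = zeta (m (Suc k)) \<otimes>\<^bsub>H2\<^esub> zeta (m (Suc k))"
  shows "zeta (m j) = zeta (m (j + k)) [^]\<^bsub>H2\<^esub> ((2::nat) ^ k)"
proof -
  interpret Group.monoid "H2" by (rule Tor_monoid)
  show ?thesis
  proof (induction k arbitrary: j)
    case 0
    show ?case using zeta_closed [OF assms(1)] by simp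
  next
    case (Suc k)
    show ?case
      using assms(2) [of j] Suc [of "Suc j"]
        nat_pow_mult [OF zeta_closed [OF assms(1)], of "Suc (j + k)" "2 ^ k" "2 ^ k"]
      by (simp add: mult_2)
  qed
qed

end

section \<open>The universal enveloping ring\<close>

definition bilin_ext :: "('k \<Rightarrow> 'l \<Rightarrow> 'm) \<Rightarrow> ('k \<Rightarrow>\<^sub>0 int) \<Rightarrow> ('l \<Rightarrow>\<^sub>0 int) \<Rightarrow> ('m \<Rightarrow>\<^sub>0 int)" where
  "bilin_ext op p q = frag_extend (\<lambda>s. frag_extend (\<lambda>t. frag_of (op s t)) q) p"

lemma lin_ext_bilin_ext:
  "lin_ext F (bilin_ext op p q) = lin_ext (\<lambda>s. lin_ext (\<lambda>t. F (op s t)) q) p"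
  by (simp add: bilin_ext_def lin_ext_frag_extend)

lemma lin_ext_lookup: "lin_ext (\<lambda>k. if k = x then 1 else 0) p = Poly_Mapping.lookup p x"
proof -
  have "lin_ext (\<lambda>k. if k = x then 1 else 0) p
      = (\<Sum>k\<in>Poly_Mapping.keys p. if k = x then Poly_Mapping.lookup p k else 0)"
    unfolding lin_ext_def by (rule sum.cong) auto
  then show ?thesis by (simp add: in_keys_iff)
qed

text \<open>Integer-valued linear functionals separate formal combinations; identities such as associativity
  of a bilinearly extended product reduce in this way to the basis.\<close>

lemma frag_eqI: "(\<And>F. lin_ext F p = (lin_ext F q :: int)) \<Longrightarrow> p = q"
  by (rule poly_mapping_eqI) (metis lin_ext_lookup)

lemma bilin_ext_add_left: "bilin_ext op (p + q) r = bilin_ext op p r + bilin_ext op q r"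
  and bilin_ext_add_right: "bilin_ext op r (p + q) = bilin_ext op r p + bilin_ext op r q"
  by (rule frag_eqI, simp add: lin_ext_bilin_ext lin_ext_add lin_ext_fun_add)+

lemma bilin_ext_frag_of [simp]: "bilin_ext op (frag_of s) (frag_of t) = frag_of (op s t)"
  by (simp add: bilin_ext_def)

lemma keys_bilin_ext:
  "Poly_Mapping.keys (bilin_ext op p q)
    \<subseteq> (\<Union>s\<in>Poly_Mapping.keys p. \<Union>t\<in>Poly_Mapping.keys q. {op s t})"
proof -
  have "Poly_Mapping.keys (frag_extend (\<lambda>t. frag_of (op s t)) q) \<subseteq> (\<Union>t\<in>Poly_Mapping.keys q. {op s t})" for s
    using keys_frag_extend [of "\<lambda>t. frag_of (op s t)" q] by (simp only: keys_frag_of)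
  then show ?thesis
    unfolding bilin_ext_def by (intro order.trans [OF keys_frag_extend] UN_mono order.refl) simp
qed

lemma free_ring_simps [simp]:
  "p \<in> carrier (free_ring S) \<longleftrightarrow> Poly_Mapping.keys p \<subseteq> lists S"
  "monoid.mult (free_ring S) = bilin_ext (@)"
  "monoid.one (free_ring S) = frag_of []"
  "ring.zero (free_ring S) = 0" "add (free_ring S) = (+)"
  by (auto simp: free_ring_def bilin_ext_def fun_eq_iff)

lemma free_ring_ring: "ring (free_ring S)"
proof (rule ringI)
  show "abelian_group (free_ring S)"
  proof (rule abelian_groupI, goal_cases)
    case (6 x)
    then show ?case by (intro bexI [of _ "- x"]) auto
  next
    case (1 x y)
    then show ?case using Poly_Mapping.keys_add [of x y] by auto
  qed (simp_all add: add_ac)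
  show "Group.monoid (free_ring S)"
  proof (rule monoidI, goal_cases)
    case (1 x y)
    show ?case
      unfolding free_ring_simps
    proof
      fix z assume "z \<in> Poly_Mapping.keys (bilin_ext (@) x y)"
      then obtain s t where "s \<in> Poly_Mapping.keys x" "t \<in> Poly_Mapping.keys y" "z = s @ t"
        using keys_bilin_ext [of "(@)" x y] by blast
      then show "z \<in> lists S" using 1 by auto
    qed
  next
    case (3 x y z)
    show ?case by simp (rule frag_eqI, simp add: lin_ext_bilin_ext)
  qed (simp, simp_all, (rule frag_eqI, simp add: lin_ext_bilin_ext)+)
qed (simp_all add: bilin_ext_add_left bilin_ext_add_right)

lemma uea_relators_closed:
  assumes "nonassoc_ring L"
  shows "uea_relators L \<subseteq> carrier (free_ring (carrier L))"
proof -
  interpret nonassoc_ring L by fact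
  have *: "Poly_Mapping.keys (a - b - c) \<subseteq> A"
    if "Poly_Mapping.keys a \<subseteq> A" "Poly_Mapping.keys b \<subseteq> A" "Poly_Mapping.keys c \<subseteq> A"
    for a b c :: "'x list \<Rightarrow>\<^sub>0 int" and A
    using keys_diff [of "a - b" c] keys_diff [of a b] that by blast
  show ?thesis
    unfolding uea_relators_def
  proof (intro Un_least subsetI)
    fix p assume "p \<in> {frag_of [x \<oplus>\<^bsub>L\<^esub> y] - frag_of [x] - frag_of [y] | x y. x \<in> carrier L \<and> y \<in> carrier L}"
    then obtain x y where p: "p = frag_of [x \<oplus>\<^bsub>L\<^esub> y] - frag_of [x] - frag_of [y]"
      and xy: "x \<in> carrier L" "y \<in> carrier L" by blast
    show "p \<in> carrier (free_ring (carrier L))"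
      unfolding p free_ring_simps by (rule *) (use xy in simp_all)
  next
    fix p assume "p \<in> {frag_of [x, y] - frag_of [y, x] - frag_of [x \<otimes>\<^bsub>L\<^esub> y] | x y. x \<in> carrier L \<and> y \<in> carrier L}"
    then obtain x y where p: "p = frag_of [x, y] - frag_of [y, x] - frag_of [x \<otimes>\<^bsub>L\<^esub> y]"
      and xy: "x \<in> carrier L" "y \<in> carrier L" by blast
    show "p \<in> carrier (free_ring (carrier L))"
      unfolding p free_ring_simps by (rule *) (use xy prod_closed in simp_all)
  qed
qed

subsection \<open>Representations and the enveloping ring\<close>

text \<open>Representations on spaces of real-valued functions. Their elements are treated coordinatewise, so
  that formal integer combinations act through \<^const>\<open>lin_ext\<close>.\<close>

locale lie_representation = nonassoc_ring +
  fixes act :: "'a \<Rightarrow> ('i \<Rightarrow> real) \<Rightarrow> 'i \<Rightarrow> real"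
  assumes act_linear: "act x (\<lambda>i. r * c i + s * d i) = (\<lambda>i. r * act x c i + s * act x d i)"
    and act_add: "\<lbrakk>x \<in> carrier L; y \<in> carrier L\<rbrakk> \<Longrightarrow> act (x \<oplus> y) c = (\<lambda>i. act x c i + act y c i)"
    and act_bracket: "\<lbrakk>x \<in> carrier L; y \<in> carrier L\<rbrakk>
      \<Longrightarrow> act (x \<otimes> y) c = (\<lambda>i. act x (act y c) i - act y (act x c) i)"

context nonassoc_ring
begin

abbreviation F where "F \<equiv> free_ring (carrier L)"
abbreviation U where "U \<equiv> universal_enveloping L"

definition uea_ideal where "uea_ideal = genideal F (uea_relators L)"

definition env :: "'a \<Rightarrow> ('a list \<Rightarrow>\<^sub>0 int) set" where
  "env x = uea_ideal +>\<^bsub>F\<^esub> frag_of [x]"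

lemma F_ring: "ring F"
  by (rule free_ring_ring)

lemma uea_ideal_ideal: "ideal uea_ideal F"
  unfolding uea_ideal_def
  by (rule ring.genideal_ideal [OF F_ring uea_relators_closed [OF nonassoc_ring_axioms]])

lemma uea_relators_ideal: "uea_relators L \<subseteq> uea_ideal"
  unfolding uea_ideal_def
  by (rule ring.genideal_self [OF F_ring uea_relators_closed [OF nonassoc_ring_axioms]])

lemma uea_ideal_minimal: "\<lbrakk>ideal J F; uea_relators L \<subseteq> J\<rbrakk> \<Longrightarrow> uea_ideal \<subseteq> J"
  unfolding uea_ideal_def by (rule ring.genideal_minimal [OF F_ring])

lemma U_def: "U = F Quot uea_ideal"
  by (simp add: universal_enveloping_def uea_ideal_def)

lemma U_ring: "ring U"
  unfolding U_def by (rule ideal.quotient_is_ring [OF uea_ideal_ideal])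

lemma proj_hom: "(+>\<^bsub>F\<^esub>) uea_ideal \<in> ring_hom F U"
  unfolding U_def by (rule ideal.rcos_ring_hom [OF uea_ideal_ideal])

lemma U_cases:
  assumes "u \<in> carrier U"
  obtains p where "p \<in> carrier F" "u = uea_ideal +>\<^bsub>F\<^esub> p"
  using assms unfolding U_def FactRing_def A_RCOSETS_def' by auto

lemma proj_closed: "p \<in> carrier F \<Longrightarrow> uea_ideal +>\<^bsub>F\<^esub> p \<in> carrier U"
  using ring_hom_closed [OF proj_hom] .

lemma proj_mem: "p \<in> carrier F \<Longrightarrow> p \<in> uea_ideal +>\<^bsub>F\<^esub> p"
proof -
  interpret I: ideal uea_ideal F by (rule uea_ideal_ideal)
  show ?thesis
    unfolding a_r_coset_def'
    using additive_subgroup.zero_closed [OF ideal.axioms(1) [OF uea_ideal_ideal]] by force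
qed

lemma proj_diff:
  assumes "q \<in> uea_ideal +>\<^bsub>F\<^esub> p"
  shows "q - p \<in> uea_ideal"
  using assms by (auto simp: a_r_coset_def')

lemma env_closed: "x \<in> carrier L \<Longrightarrow> env x \<in> carrier U"
  unfolding env_def by (rule proj_closed) simp

lemma proj_eqI:
  assumes "p \<in> carrier F" "q \<in> carrier F" "p - q \<in> uea_ideal"
  shows "uea_ideal +>\<^bsub>F\<^esub> p = uea_ideal +>\<^bsub>F\<^esub> q"
proof -
  interpret I: ideal uea_ideal F by (rule uea_ideal_ideal)
  have "p = (p - q) \<oplus>\<^bsub>F\<^esub> q" by simp
  then have "p \<in> uea_ideal +>\<^bsub>F\<^esub> q"
    using assms(3) unfolding a_r_coset_def' by blast
  then show ?thesis using I.a_repr_independence [OF _ assms(2) I.a_subgroup] by simp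
qed

lemma env_add:
  assumes "x \<in> carrier L" "y \<in> carrier L"
  shows "env (x \<oplus> y) = env x \<oplus>\<^bsub>U\<^esub> env y"
proof -
  have "env (x \<oplus> y) = uea_ideal +>\<^bsub>F\<^esub> (frag_of [x] + frag_of [y])"
    unfolding env_def
  proof (rule proj_eqI)
    show "frag_of [x] + frag_of [y] \<in> carrier F"
      using assms Poly_Mapping.keys_add [of "frag_of [x]" "frag_of [y]"] by auto
    show "frag_of [x \<oplus> y] - (frag_of [x] + frag_of [y]) \<in> uea_ideal"
      using assms uea_relators_ideal unfolding uea_relators_def by (force simp: diff_diff_eq)
  qed (use assms in auto)
  also have "\<dots> = env x \<oplus>\<^bsub>U\<^esub> env y"
    using ring_hom_add [OF proj_hom, of "frag_of [x]" "frag_of [y]"] assms by (simp add: env_def)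
  finally show ?thesis .
qed

lemma env_bracket:
  assumes "x \<in> carrier L" "y \<in> carrier L"
  shows "env x \<otimes>\<^bsub>U\<^esub> env y = env y \<otimes>\<^bsub>U\<^esub> env x \<oplus>\<^bsub>U\<^esub> env (x \<otimes> y)"
proof -
  have m: "env a \<otimes>\<^bsub>U\<^esub> env b = uea_ideal +>\<^bsub>F\<^esub> frag_of [a, b]" if "a \<in> carrier L" "b \<in> carrier L" for a b
    using ring_hom_mult [OF proj_hom, of "frag_of [a]" "frag_of [b]"] that by (simp add: env_def)
  have "env x \<otimes>\<^bsub>U\<^esub> env y = uea_ideal +>\<^bsub>F\<^esub> (frag_of [y, x] + frag_of [x \<otimes> y])"
    unfolding m [OF assms]
  proof (rule proj_eqI)
    show "frag_of [y, x] + frag_of [x \<otimes> y] \<in> carrier F"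
      using assms prod_closed Poly_Mapping.keys_add [of "frag_of [y, x]" "frag_of [x \<otimes> y]"] by auto
    show "frag_of [x, y] - (frag_of [y, x] + frag_of [x \<otimes> y]) \<in> uea_ideal"
      using assms uea_relators_ideal unfolding uea_relators_def by (force simp: diff_diff_eq)
  qed (use assms in auto)
  also have "\<dots> = env y \<otimes>\<^bsub>U\<^esub> env x \<oplus>\<^bsub>U\<^esub> env (x \<otimes> y)"
    using ring_hom_add [OF proj_hom, of "frag_of [y, x]" "frag_of [x \<otimes> y]"] assms prod_closed m
    by (simp add: env_def)
  finally show ?thesis .
qed

subsection \<open>The augmentation\<close>

lemma lookup_bilin_ext_Nil:
  "Poly_Mapping.lookup (bilin_ext (@) p q) [] = Poly_Mapping.lookup p [] * Poly_Mapping.lookup q []"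
proof -
  have "lin_ext (\<lambda>t. if v @ t = [] then 1 else 0) q
      = (if v = [] then 1 else 0) * lin_ext (\<lambda>t. if t = [] then 1 else (0::int)) q" for v
    by (cases v) auto
  then show ?thesis
    unfolding lin_ext_lookup [symmetric] lin_ext_bilin_ext by (simp only: lin_ext_fun_multc)
qed

lemma ideal_freeI:
  assumes "J \<subseteq> carrier F" "0 \<in> J" "\<And>p q. \<lbrakk>p \<in> J; q \<in> J\<rbrakk> \<Longrightarrow> p - q \<in> J"
    and "\<And>p q. \<lbrakk>p \<in> J; q \<in> carrier F\<rbrakk> \<Longrightarrow> bilin_ext (@) p q \<in> J \<and> bilin_ext (@) q p \<in> J"
  shows "ideal J F"
proof (rule idealI [OF F_ring])
  have u: "- p \<in> J" if "p \<in> J" for p using assms(3) [OF assms(2) that] by simp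
  interpret F: ring F by (rule F_ring)
  show "subgroup J (add_monoid F)"
  proof (rule F.add.subgroupI)
    show "\<ominus>\<^bsub>F\<^esub> p \<in> J" if "p \<in> J" for p
    proof -
      have "\<ominus>\<^bsub>F\<^esub> p = - p"
        by (rule F.minus_equality)
          (use subsetD [OF assms(1) that] subsetD [OF assms(1) u [OF that]] in simp_all)
      then show ?thesis using u [OF that] by simp
    qed
    show "p \<oplus>\<^bsub>F\<^esub> q \<in> J" if "p \<in> J" "q \<in> J" for p q
      using assms(3) [OF that(1) u [OF that(2)]] by simp
  qed (use assms(1,2) in auto)
qed (use assms(4) in auto)

lemma uea_ideal_constant: "p \<in> uea_ideal \<Longrightarrow> Poly_Mapping.lookup p [] = 0"
proof -
  let ?J = "{p \<in> carrier F. Poly_Mapping.lookup p [] = 0}"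
  have "ideal ?J F"
  proof (rule ideal_freeI)
    fix p q assume "p \<in> ?J" "q \<in> carrier F"
    then show "bilin_ext (@) p q \<in> ?J \<and> bilin_ext (@) q p \<in> ?J"
      using monoid.m_closed [OF ring.is_monoid [OF F_ring], of p q]
        monoid.m_closed [OF ring.is_monoid [OF F_ring], of q p]
      by (simp add: lookup_bilin_ext_Nil)
  next
    fix p q assume "p \<in> ?J" "q \<in> ?J"
    then show "p - q \<in> ?J" using keys_diff [of p q] by (auto simp: lookup_minus)
  qed auto
  moreover have "Poly_Mapping.lookup p [] = 0" if "p \<in> uea_relators L" for p
    using that unfolding uea_relators_def by (auto simp: lookup_minus)
  then have "uea_relators L \<subseteq> ?J"
    using uea_relators_closed [OF nonassoc_ring_axioms] by blast
  ultimately show "p \<in> uea_ideal \<Longrightarrow> Poly_Mapping.lookup p [] = 0"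
    using uea_ideal_minimal by blast
qed

lemma uea_augmentation_proj:
  assumes "p \<in> carrier F"
  shows "uea_augmentation (uea_ideal +>\<^bsub>F\<^esub> p) = Poly_Mapping.lookup p []"
  unfolding uea_augmentation_def
proof (rule the_equality)
  show "\<forall>q\<in>uea_ideal +>\<^bsub>F\<^esub> p. Poly_Mapping.lookup q [] = Poly_Mapping.lookup p []"
    using uea_ideal_constant [OF proj_diff] by (auto simp: lookup_minus)
  then show "n = Poly_Mapping.lookup p []"
    if "\<forall>q\<in>uea_ideal +>\<^bsub>F\<^esub> p. Poly_Mapping.lookup q [] = n" for n
    using that proj_mem [OF assms] by auto
qed

lemma uea_augmentation_env: "x \<in> carrier L \<Longrightarrow> uea_augmentation (env x) = 0"
  unfolding env_def by (subst uea_augmentation_proj) auto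

lemma U_augmented: "augmented_ring U uea_augmentation"
proof (rule augmented_ring.intro [OF U_ring augmented_ring_axioms.intro])
  interpret F: ring F by (rule F_ring)
  fix u v assume uv: "u \<in> carrier U" "v \<in> carrier U"
  obtain p where p: "p \<in> carrier F" "u = uea_ideal +>\<^bsub>F\<^esub> p" using uv(1) by (rule U_cases)
  obtain q where q: "q \<in> carrier F" "v = uea_ideal +>\<^bsub>F\<^esub> q" using uv(2) by (rule U_cases)
  show "uea_augmentation (u \<oplus>\<^bsub>U\<^esub> v) = uea_augmentation u + uea_augmentation v"
    using ring_hom_add [OF proj_hom p(1) q(1)] uea_augmentation_proj [OF F.a_closed [OF p(1) q(1)]]
    by (simp only: p(2) q(2) uea_augmentation_proj [OF p(1)] uea_augmentation_proj [OF q(1)]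
        free_ring_simps lookup_add)
  show "uea_augmentation (u \<otimes>\<^bsub>U\<^esub> v) = uea_augmentation u * uea_augmentation v"
    using ring_hom_mult [OF proj_hom p(1) q(1)] uea_augmentation_proj [OF F.m_closed [OF p(1) q(1)]]
    by (simp only: p(2) q(2) uea_augmentation_proj [OF p(1)] uea_augmentation_proj [OF q(1)]
        free_ring_simps lookup_bilin_ext_Nil)
next
  interpret F: ring F by (rule F_ring)
  show "uea_augmentation \<one>\<^bsub>U\<^esub> = 1"
    using ring_hom_one [OF proj_hom] uea_augmentation_proj [OF F.one_closed] by simp
qed

end

context lie_representation
begin

definition word :: "'a list \<Rightarrow> ('i \<Rightarrow> real) \<Rightarrow> 'i \<Rightarrow> real" where
  "word v = foldr act v"

definition frag_act :: "('a list \<Rightarrow>\<^sub>0 int) \<Rightarrow> ('i \<Rightarrow> real) \<Rightarrow> 'i \<Rightarrow> real" where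
  "frag_act p c i = lin_ext (\<lambda>v. word v c i) p"

definition env_act :: "('a list \<Rightarrow>\<^sub>0 int) set \<Rightarrow> ('i \<Rightarrow> real) \<Rightarrow> 'i \<Rightarrow> real" where
  "env_act u = frag_act (SOME p. p \<in> u)"

lemma word_linear: "word v (\<lambda>i. r * c i + s * d i) = (\<lambda>i. r * word v c i + s * word v d i)"
  by (induction v) (simp_all add: word_def act_linear)

lemma frag_act_linear:
  "frag_act p (\<lambda>i. r * c i + s * d i) = (\<lambda>i. r * frag_act p c i + s * frag_act p d i)"
  by (simp add: frag_act_def [abs_def] word_linear lin_ext_fun_add lin_ext_fun_cmult)

lemma word_lin_ext: "word v (\<lambda>i. lin_ext (\<lambda>w. G w i) q) i = lin_ext (\<lambda>w. word v (G w) i) q"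
  by (rule linear_lin_ext [of "\<lambda>c. word v c i"]) (simp add: word_linear)

lemma frag_act_mult: "frag_act (bilin_ext (@) p q) c = frag_act p (frag_act q c)"
proof
  fix i
  have "frag_act p (frag_act q c) i = lin_ext (\<lambda>v. lin_ext (\<lambda>w. word v (word w c) i) q) p"
    by (simp add: frag_act_def [abs_def] word_lin_ext)
  then show "frag_act (bilin_ext (@) p q) c i = frag_act p (frag_act q c) i"
    by (simp add: frag_act_def lin_ext_bilin_ext word_def)
qed

lemma frag_act_diff: "frag_act (p - q) c = (\<lambda>i. frag_act p c i - frag_act q c i)"
  and frag_act_add: "frag_act (p + q) c = (\<lambda>i. frag_act p c i + frag_act q c i)"
  by (auto simp: frag_act_def lin_ext_diff lin_ext_add)

lemma frag_act_zero: "frag_act p (\<lambda>_. 0) = (\<lambda>_. 0)"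
  using frag_act_linear [of p 0 "\<lambda>_. 0" 0 "\<lambda>_. 0"] by simp

text \<open>The elements of the free ring that act as zero form an ideal, and additivity and the bracket
  relation put the relators into it.\<close>

lemma uea_ideal_act: "p \<in> uea_ideal \<Longrightarrow> frag_act p c = (\<lambda>_. 0)"
proof -
  let ?J = "{p \<in> carrier F. \<forall>c. frag_act p c = (\<lambda>_. 0)}"
  have "ideal ?J F"
  proof (rule ideal_freeI)
    fix p q assume "p \<in> ?J" "q \<in> carrier F"
    then show "bilin_ext (@) p q \<in> ?J \<and> bilin_ext (@) q p \<in> ?J"
      using monoid.m_closed [OF ring.is_monoid [OF F_ring], of p q]
        monoid.m_closed [OF ring.is_monoid [OF F_ring], of q p]
      by (simp add: frag_act_mult frag_act_zero)
  next
    fix p q assume "p \<in> ?J" "q \<in> ?J"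
    then show "p - q \<in> ?J"
      using order.trans [OF keys_diff [of p q], of "lists (carrier L)"] by (simp add: frag_act_diff)
  qed (auto simp: frag_act_def)
  moreover have "frag_act p c = (\<lambda>_. 0)" if "p \<in> uea_relators L" for p c
    using that unfolding uea_relators_def
    by (auto simp: frag_act_diff) (auto simp: frag_act_def word_def act_add act_bracket)
  then have "uea_relators L \<subseteq> ?J"
    using uea_relators_closed [OF nonassoc_ring_axioms] by blast
  ultimately show "p \<in> uea_ideal \<Longrightarrow> frag_act p c = (\<lambda>_. 0)"
    using uea_ideal_minimal by blast
qed

lemma env_act_proj:
  assumes "p \<in> carrier F"
  shows "env_act (uea_ideal +>\<^bsub>F\<^esub> p) = frag_act p"
proof
  fix c
  let ?q = "SOME q. q \<in> uea_ideal +>\<^bsub>F\<^esub> p"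
  have "?q \<in> uea_ideal +>\<^bsub>F\<^esub> p" using proj_mem [OF assms] by (rule someI)
  then have "frag_act (?q - p) c = (\<lambda>_. 0)" by (intro uea_ideal_act proj_diff)
  then show "env_act (uea_ideal +>\<^bsub>F\<^esub> p) c = frag_act p c"
    by (simp add: env_act_def frag_act_diff fun_eq_iff)
qed

lemma env_act_linear:
  "env_act u (\<lambda>i. r * c i + s * d i) = (\<lambda>i. r * env_act u c i + s * env_act u d i)"
  unfolding env_act_def by (rule frag_act_linear)

lemma env_act_add:
  assumes "u \<in> carrier U" "v \<in> carrier U"
  shows "env_act (u \<oplus>\<^bsub>U\<^esub> v) c = (\<lambda>i. env_act u c i + env_act v c i)"
proof -
  interpret F: ring F by (rule F_ring)
  obtain p where p: "p \<in> carrier F" "u = uea_ideal +>\<^bsub>F\<^esub> p" using assms(1) by (rule U_cases)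
  obtain q where q: "q \<in> carrier F" "v = uea_ideal +>\<^bsub>F\<^esub> q" using assms(2) by (rule U_cases)
  show ?thesis
    using ring_hom_add [OF proj_hom p(1) q(1)] env_act_proj [OF F.a_closed [OF p(1) q(1)]]
    by (simp only: p(2) q(2) env_act_proj [OF p(1)] env_act_proj [OF q(1)] free_ring_simps frag_act_add)
qed

lemma env_act_mult:
  assumes "u \<in> carrier U" "v \<in> carrier U"
  shows "env_act (u \<otimes>\<^bsub>U\<^esub> v) c = env_act u (env_act v c)"
proof -
  interpret F: ring F by (rule F_ring)
  obtain p where p: "p \<in> carrier F" "u = uea_ideal +>\<^bsub>F\<^esub> p" using assms(1) by (rule U_cases)
  obtain q where q: "q \<in> carrier F" "v = uea_ideal +>\<^bsub>F\<^esub> q" using assms(2) by (rule U_cases)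
  show ?thesis
    using ring_hom_mult [OF proj_hom p(1) q(1)] env_act_proj [OF F.m_closed [OF p(1) q(1)]]
    by (simp only: p(2) q(2) env_act_proj [OF p(1)] env_act_proj [OF q(1)] free_ring_simps frag_act_mult)
qed

lemma env_act_env: "x \<in> carrier L \<Longrightarrow> env_act (env x) = act x"
  unfolding env_def by (subst env_act_proj) (auto simp: frag_act_def word_def fun_eq_iff)

text \<open>In a coordinate that is killed by the Lie ring only the constant term survives.\<close>

lemma env_act_augmentation:
  fixes c :: "'i \<Rightarrow> real"
  assumes u: "u \<in> carrier U" and i: "\<And>x c. act x c i = 0"
  shows "env_act u c i = uea_augmentation u * c i"
proof -
  obtain p where p: "p \<in> carrier F" "u = uea_ideal +>\<^bsub>F\<^esub> p" using u by (rule U_cases)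
  have "word v c i = (if v = [] then 1 else 0) * c i" for v
    by (cases v) (auto simp: word_def i)
  then have "frag_act p c i = of_int (Poly_Mapping.lookup p []) * c i"
    unfolding frag_act_def lin_ext_lookup [symmetric]
    by (simp add: lin_ext_def sum_distrib_right) (rule sum.cong, auto)
  then show ?thesis using p by (simp add: env_act_proj uea_augmentation_proj)
qed

end

section \<open>Degree 2 classes of a Lie ring\<close>

text \<open>The identity behind the vanishing of the boundary of a Chevalley-Eilenberg 3-chain: \<open>a\<close>, \<open>b\<close>, \<open>c\<close>
  stand for the basis elements at \<open>x\<close>, \<open>y\<close>, \<open>z\<close> and \<open>p\<close>, \<open>q\<close>, \<open>r\<close> for those at the three brackets.\<close>

lemma (in ring) jacobi_identity:
  assumes "x \<in> carrier R" "y \<in> carrier R" "z \<in> carrier R"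
    "p \<in> carrier R" "q \<in> carrier R" "r \<in> carrier R"
    "a \<in> carrier R" "b \<in> carrier R" "c \<in> carrier R"
  shows "(x \<otimes> p \<ominus> (y \<otimes> z \<ominus> z \<otimes> y) \<otimes> a) \<oplus> (y \<otimes> q \<ominus> (z \<otimes> x \<ominus> x \<otimes> z) \<otimes> b)
      \<oplus> (z \<otimes> r \<ominus> (x \<otimes> y \<ominus> y \<otimes> x) \<otimes> c)
    = x \<otimes> (p \<ominus> (y \<otimes> c \<ominus> z \<otimes> b)) \<oplus> y \<otimes> (q \<ominus> (z \<otimes> a \<ominus> x \<otimes> c))
      \<oplus> z \<otimes> (r \<ominus> (x \<otimes> b \<ominus> y \<otimes> a))"
  using assms by algebra

locale anticomm_ring = nonassoc_ring +
  assumes anticomm: "\<lbrakk>x \<in> carrier L; y \<in> carrier L\<rbrakk> \<Longrightarrow> x \<otimes> y = \<ominus> (y \<otimes> x)"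

context nonassoc_ring
begin

sublocale U: augmented_ring U uea_augmentation
  by (rule U_augmented)

text \<open>The cell whose boundary is the element \<open>x\<close> of the enveloping ring, placed on the cell \<open>1\<close> of degree 0;
  \<open>bas x\<close> is the corresponding basis vector.\<close>

definition bar :: "'a \<Rightarrow> (('a list \<Rightarrow>\<^sub>0 int) set, int) cell" where
  "bar x = Cell [(env x, Point 1)]"

definition bas :: "'a \<Rightarrow> (('a list \<Rightarrow>\<^sub>0 int) set, int) cell \<Rightarrow> ('a list \<Rightarrow>\<^sub>0 int) set" where
  "bas x = U.monomial \<one>\<^bsub>U\<^esub> (bar x)"

text \<open>The Chevalley-Eilenberg chain \<open>a \<and> b\<close>, represented by its boundary without the term of \<open>[a, b]\<close>. A
  combination of such chains is a cycle as soon as the brackets cancel.\<close>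

definition wedge :: "'a \<Rightarrow> 'a \<Rightarrow> (('a list \<Rightarrow>\<^sub>0 int) set, int) cell \<Rightarrow> ('a list \<Rightarrow>\<^sub>0 int) set" where
  "wedge a b = (\<lambda>c. env a \<otimes>\<^bsub>U\<^esub> bas b c \<ominus>\<^bsub>U\<^esub> env b \<otimes>\<^bsub>U\<^esub> bas a c)"

lemma point_cell: "Point 1 \<in> cells U U.T 0"
  by (simp add: cells.simps)

lemma syz_bar: "x \<in> carrier L \<Longrightarrow> U.syz (bar x) = U.monomial (env x) (Point 1)"
  by (simp add: bar_def U.combination_single env_closed del: combination.simps)

lemma bar_cell: "x \<in> carrier L \<Longrightarrow> bar x \<in> cells U U.T (Suc 0)"
  using syz_bar [of x] U.aug_monomial [OF env_closed, of x "Point 1"]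
  by (auto simp: bar_def cells.simps env_closed uea_augmentation_env)

lemma bas_P: "x \<in> carrier L \<Longrightarrow> bas x \<in> U.P1"
  unfolding bas_def by (intro U.P_monomial bar_cell) simp

lemma bas_values: "x \<in> carrier L \<Longrightarrow> bas x c \<in> carrier U"
  using U.P_values [OF bas_P] .

lemma bd_bas: "x \<in> carrier L \<Longrightarrow> U.bd (bas x) = U.monomial (env x) (Point 1)"
  unfolding bas_def
  by (subst U.bd_monomial [OF _ bar_cell]) (auto simp: syz_bar U.monomial_def env_closed)

lemma bd_smult_bas:
  assumes "x \<in> carrier L" "u \<in> carrier U"
  shows "U.bd (\<lambda>c. u \<otimes>\<^bsub>U\<^esub> bas x c) = U.monomial (u \<otimes>\<^bsub>U\<^esub> env x) (Point 1)"
  unfolding U.bd_smult [OF bas_P [OF assms(1)] assms(2)] bd_bas [OF assms(1)]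
  using assms by (auto simp: U.monomial_def fun_eq_iff env_closed)

lemma wedge_P: "\<lbrakk>a \<in> carrier L; b \<in> carrier L\<rbrakk> \<Longrightarrow> wedge a b \<in> U.P1"
  unfolding wedge_def by (intro U.P_diff U.P_smult bas_P env_closed)

lemma wedge_eps:
  assumes "a \<in> carrier L" "b \<in> carrier L"
  shows "uea_augmentation (wedge a b c) = 0"
  using assms bas_values env_closed
  by (simp add: wedge_def a_minus_def U.eps_add U.eps_uminus U.eps_mult uea_augmentation_env)

lemma wedge_bd:
  assumes "a \<in> carrier L" "b \<in> carrier L"
  shows "U.bd (wedge a b) = U.monomial (env (a \<otimes> b)) (Point 1)"
proof -
  have e: "env a \<in> carrier U" "env b \<in> carrier U" "env (a \<otimes> b) \<in> carrier U"
    using assms prod_closed env_closed by auto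
  have "env a \<otimes>\<^bsub>U\<^esub> env b \<ominus>\<^bsub>U\<^esub> env b \<otimes>\<^bsub>U\<^esub> env a = env (a \<otimes> b)"
    unfolding env_bracket [OF assms] using e by algebra
  then show ?thesis
    unfolding wedge_def U.bd_diff [OF U.P_smult [OF bas_P [OF assms(2)] e(1)] U.P_smult [OF bas_P [OF assms(1)] e(2)]]
      bd_smult_bas [OF assms(2) e(1)] bd_smult_bas [OF assms(1) e(2)]
    by (auto simp: U.monomial_def a_minus_def fun_eq_iff)
qed

lemma wedge_swap:
  assumes "a \<in> carrier L" "b \<in> carrier L"
  shows "wedge a b = (\<lambda>c. \<ominus>\<^bsub>U\<^esub> wedge b a c)"
proof
  fix c
  note v = env_closed [OF assms(1)] env_closed [OF assms(2)] bas_values [OF assms(1), of c] bas_values [OF assms(2), of c]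
  show "wedge a b c = \<ominus>\<^bsub>U\<^esub> wedge b a c" unfolding wedge_def using v by algebra
qed

lemma wedge_self: "a \<in> carrier L \<Longrightarrow> wedge a a = (\<lambda>c. \<zero>\<^bsub>U\<^esub>)"
  using bas_values env_closed by (simp add: wedge_def a_minus_def U.r_neg)

text \<open>The failure of additivity is \<open>a\<close> times the cycle that compares \<open>bas (b \<oplus> b')\<close> with \<open>bas b\<close> and \<open>bas b'\<close>.\<close>

lemma wedge_add_right:
  assumes "a \<in> carrier L" "b \<in> carrier L" "b' \<in> carrier L"
  shows "U.ceq (wedge a (b \<oplus> b')) (\<lambda>c. wedge a b c \<oplus>\<^bsub>U\<^esub> wedge a b' c)"
proof -
  let ?m = "\<lambda>c. bas (b \<oplus> b') c \<ominus>\<^bsub>U\<^esub> (bas b c \<oplus>\<^bsub>U\<^esub> bas b' c)"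
  have bb: "b \<oplus> b' \<in> carrier L" using assms by simp
  have P: "?m \<in> U.P1"
    by (intro U.P_diff U.P_add bas_P bb assms)
  have "U.bd ?m = (\<lambda>e. U.monomial (env (b \<oplus> b')) (Point 1) e \<ominus>\<^bsub>U\<^esub>
      (U.monomial (env b) (Point 1) e \<oplus>\<^bsub>U\<^esub> U.monomial (env b') (Point 1) e))"
    unfolding U.bd_diff [OF bas_P [OF bb] U.P_add [OF bas_P [OF assms(2)] bas_P [OF assms(3)]]]
      U.bd_add [OF bas_P [OF assms(2)] bas_P [OF assms(3)]] by (simp add: bd_bas assms)
  then have bd: "U.bd ?m = (\<lambda>_. \<zero>\<^bsub>U\<^esub>)"
    using env_closed assms by (auto simp: U.monomial_def env_add a_minus_def U.r_neg fun_eq_iff)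
  have "(\<lambda>c. wedge a (b \<oplus> b') c \<ominus>\<^bsub>U\<^esub> (wedge a b c \<oplus>\<^bsub>U\<^esub> wedge a b' c)) = (\<lambda>c. env a \<otimes>\<^bsub>U\<^esub> ?m c)"
  proof
    fix c
    note v = env_closed [OF assms(1)] env_closed [OF assms(2)] env_closed [OF assms(3)]
      bas_values [OF assms(1), of c] bas_values [OF assms(2), of c] bas_values [OF assms(3), of c]
      bas_values [OF bb, of c]
    show "wedge a (b \<oplus> b') c \<ominus>\<^bsub>U\<^esub> (wedge a b c \<oplus>\<^bsub>U\<^esub> wedge a b' c) = env a \<otimes>\<^bsub>U\<^esub> ?m c"
      unfolding wedge_def env_add [OF assms(2,3)] using v by algebra
  qed
  then show ?thesis
    unfolding U.ceq_def
    using U.null_cycles_smult [OF P bd env_closed [OF assms(1)] uea_augmentation_env [OF assms(1)]]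
      wedge_P assms bb U.P_add by simp
qed

text \<open>The boundary of \<open>x \<and> y \<and> z\<close>. It is the sum of the products of \<open>x\<close>, \<open>y\<close>, \<open>z\<close> with the cycles that express
  the three brackets as commutators.\<close>

lemma wedge_jacobi:
  assumes "x \<in> carrier L" "y \<in> carrier L" "z \<in> carrier L"
  shows "(\<lambda>c. wedge x (y \<otimes> z) c \<oplus>\<^bsub>U\<^esub> wedge y (z \<otimes> x) c \<oplus>\<^bsub>U\<^esub> wedge z (x \<otimes> y) c) \<in> U.null_cycles"
proof -
  define m where "m a b = (\<lambda>c. bas (a \<otimes> b) c \<ominus>\<^bsub>U\<^esub> wedge a b c)" for a b
  have n: "(\<lambda>c. env a \<otimes>\<^bsub>U\<^esub> m b d c) \<in> U.null_cycles"
    if "a \<in> carrier L" "b \<in> carrier L" "d \<in> carrier L" for a b d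
  proof (rule U.null_cycles_smult)
    show "m b d \<in> U.P1" unfolding m_def by (intro U.P_diff bas_P wedge_P prod_closed that)
    show "U.bd (m b d) = (\<lambda>_. \<zero>\<^bsub>U\<^esub>)"
      unfolding m_def U.bd_diff [OF bas_P [OF prod_closed [OF that(2,3)]] wedge_P [OF that(2,3)]]
        bd_bas [OF prod_closed [OF that(2,3)]] wedge_bd [OF that(2,3)]
      using env_closed prod_closed that by (auto simp: U.monomial_def a_minus_def U.r_neg)
  qed (use that in \<open>simp_all add: env_closed uea_augmentation_env\<close>)
  have "(\<lambda>c. wedge x (y \<otimes> z) c \<oplus>\<^bsub>U\<^esub> wedge y (z \<otimes> x) c \<oplus>\<^bsub>U\<^esub> wedge z (x \<otimes> y) c)
    = (\<lambda>c. env x \<otimes>\<^bsub>U\<^esub> m y z c \<oplus>\<^bsub>U\<^esub> env y \<otimes>\<^bsub>U\<^esub> m z x c \<oplus>\<^bsub>U\<^esub> env z \<otimes>\<^bsub>U\<^esub> m x y c)"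
  proof
    fix c
    have comm: "env (a \<otimes> b) = env a \<otimes>\<^bsub>U\<^esub> env b \<ominus>\<^bsub>U\<^esub> env b \<otimes>\<^bsub>U\<^esub> env a"
      if "a \<in> carrier L" "b \<in> carrier L" for a b
    proof -
      have e: "env a \<in> carrier U" "env b \<in> carrier U" "env (a \<otimes> b) \<in> carrier U"
        using that prod_closed env_closed by auto
      show ?thesis unfolding env_bracket [OF that] using e by algebra
    qed
    note v = env_closed [OF assms(1)] env_closed [OF assms(2)] env_closed [OF assms(3)]
      bas_values [OF assms(1), of c] bas_values [OF assms(2), of c] bas_values [OF assms(3), of c]
      bas_values [OF prod_closed [OF assms(2,3)], of c] bas_values [OF prod_closed [OF assms(3,1)], of c]
      bas_values [OF prod_closed [OF assms(1,2)], of c]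
    show "wedge x (y \<otimes> z) c \<oplus>\<^bsub>U\<^esub> wedge y (z \<otimes> x) c \<oplus>\<^bsub>U\<^esub> wedge z (x \<otimes> y) c
      = env x \<otimes>\<^bsub>U\<^esub> m y z c \<oplus>\<^bsub>U\<^esub> env y \<otimes>\<^bsub>U\<^esub> m z x c \<oplus>\<^bsub>U\<^esub> env z \<otimes>\<^bsub>U\<^esub> m x y c"
      unfolding wedge_def m_def comm [OF assms(2,3)] comm [OF assms(3,1)] comm [OF assms(1,2)]
      by (rule U.jacobi_identity [OF v(1-3) v(7-9) v(4-6)])
  qed
  then show ?thesis
    using U.null_cycles_add [OF U.null_cycles_add [OF n [OF assms] n [OF assms(2,3,1)]] n [OF assms(3,1,2)]]
    by simp
qed

end

context nonassoc_ring
begin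

lemma wedge_zero_right:
  assumes "a \<in> carrier L"
  shows "U.ceq (wedge a \<zero>) (\<lambda>c. \<zero>\<^bsub>U\<^esub>)"
proof -
  note v = U.P_values [OF wedge_P [OF assms zero_closed]]
  have "U.ceq (wedge a \<zero>) (\<lambda>c. wedge a \<zero> c \<oplus>\<^bsub>U\<^esub> wedge a \<zero> c)"
    using wedge_add_right [OF assms zero_closed zero_closed] by simp
  then have "U.ceq (\<lambda>c. wedge a \<zero> c \<ominus>\<^bsub>U\<^esub> wedge a \<zero> c)
      (\<lambda>c. (wedge a \<zero> c \<oplus>\<^bsub>U\<^esub> wedge a \<zero> c) \<ominus>\<^bsub>U\<^esub> wedge a \<zero> c)"
    by (intro U.ceq_diff U.ceq_refl wedge_P assms zero_closed)
  then have "U.ceq (\<lambda>c. \<zero>\<^bsub>U\<^esub>) (wedge a \<zero>)"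
    using v by (simp add: a_minus_def U.r_neg U.a_assoc)
  then show ?thesis by (rule U.ceq_sym)
qed

lemma wedge_uminus_right:
  assumes "a \<in> carrier L" "b \<in> carrier L"
  shows "U.ceq (wedge a (\<ominus> b)) (\<lambda>c. \<ominus>\<^bsub>U\<^esub> wedge a b c)"
proof -
  have nb: "\<ominus> b \<in> carrier L" using assms by simp
  note v = U.P_values [OF wedge_P [OF assms]] U.P_values [OF wedge_P [OF assms(1) nb]]
  have "U.ceq (wedge a \<zero>) (\<lambda>c. wedge a b c \<oplus>\<^bsub>U\<^esub> wedge a (\<ominus> b) c)"
    using wedge_add_right [OF assms nb] by (simp add: assms r_neg)
  then have "U.ceq (\<lambda>c. \<zero>\<^bsub>U\<^esub>) (\<lambda>c. wedge a b c \<oplus>\<^bsub>U\<^esub> wedge a (\<ominus> b) c)"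
    by (rule U.ceq_trans [OF U.ceq_sym [OF wedge_zero_right [OF assms(1)]]])
  then have *: "U.ceq (\<lambda>c. \<zero>\<^bsub>U\<^esub> \<ominus>\<^bsub>U\<^esub> wedge a b c)
      (\<lambda>c. (wedge a b c \<oplus>\<^bsub>U\<^esub> wedge a (\<ominus> b) c) \<ominus>\<^bsub>U\<^esub> wedge a b c)"
    by (intro U.ceq_diff U.ceq_refl wedge_P assms)
  have 2: "(\<lambda>c. (wedge a b c \<oplus>\<^bsub>U\<^esub> wedge a (\<ominus> b) c) \<ominus>\<^bsub>U\<^esub> wedge a b c) = wedge a (\<ominus> b)"
  proof
    show "(wedge a b c \<oplus>\<^bsub>U\<^esub> wedge a (\<ominus> b) c) \<ominus>\<^bsub>U\<^esub> wedge a b c = wedge a (\<ominus> b) c" for c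
      using v(1) [of c] v(2) [of c] by algebra
  qed
  have 1: "(\<lambda>c. \<zero>\<^bsub>U\<^esub> \<ominus>\<^bsub>U\<^esub> wedge a b c) = (\<lambda>c. \<ominus>\<^bsub>U\<^esub> wedge a b c)"
    using v(1) by (simp add: a_minus_def)
  show ?thesis by (rule U.ceq_sym [OF * [unfolded 1 2]])
qed

lemma wedge_diff_right:
  assumes "a \<in> carrier L" "b \<in> carrier L" "b' \<in> carrier L"
  shows "U.ceq (wedge a (b \<ominus> b')) (\<lambda>c. wedge a b c \<ominus>\<^bsub>U\<^esub> wedge a b' c)"
proof -
  have 1: "U.ceq (wedge a (b \<ominus> b')) (\<lambda>c. wedge a b c \<oplus>\<^bsub>U\<^esub> wedge a (\<ominus> b') c)"
    unfolding a_minus_def [of L] using assms by (intro wedge_add_right) auto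
  have 2: "U.ceq (\<lambda>c. wedge a b c \<oplus>\<^bsub>U\<^esub> wedge a (\<ominus> b') c) (\<lambda>c. wedge a b c \<ominus>\<^bsub>U\<^esub> wedge a b' c)"
    unfolding a_minus_def [of U] by (intro U.ceq_add U.ceq_refl wedge_P wedge_uminus_right assms)
  show ?thesis by (rule U.ceq_trans [OF 1 2])
qed

end

context anticomm_ring
begin

text \<open>The boundary of \<open>x \<and> a \<and> b\<close>, read as the statement that up to boundaries \<open>x \<and> [a, b]\<close> is the result of
  applying the derivation \<open>[x, -]\<close> to \<open>a \<and> b\<close>.\<close>

lemma wedge_leibniz:
  assumes x: "x \<in> carrier L" and a: "a \<in> carrier L" and b: "b \<in> carrier L"
  shows "U.ceq (wedge x (a \<otimes> b)) (\<lambda>c. wedge (x \<otimes> a) b c \<oplus>\<^bsub>U\<^esub> wedge a (x \<otimes> b) c)"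
proof -
  have cl: "a \<otimes> b \<in> carrier L" "b \<otimes> x \<in> carrier L" "x \<otimes> a \<in> carrier L" "x \<otimes> b \<in> carrier L"
    using prod_closed x a b by auto
  have 1: "U.ceq (wedge x (a \<otimes> b)) (\<lambda>c. \<ominus>\<^bsub>U\<^esub> wedge a (b \<otimes> x) c \<ominus>\<^bsub>U\<^esub> wedge b (x \<otimes> a) c)"
  proof -
    have "(\<lambda>c. wedge x (a \<otimes> b) c \<ominus>\<^bsub>U\<^esub> (\<ominus>\<^bsub>U\<^esub> wedge a (b \<otimes> x) c \<ominus>\<^bsub>U\<^esub> wedge b (x \<otimes> a) c))
      = (\<lambda>c. wedge x (a \<otimes> b) c \<oplus>\<^bsub>U\<^esub> wedge a (b \<otimes> x) c \<oplus>\<^bsub>U\<^esub> wedge b (x \<otimes> a) c)"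
    proof
      fix c
      note v = U.P_values [OF wedge_P [OF x cl(1)], of c] U.P_values [OF wedge_P [OF a cl(2)], of c]
        U.P_values [OF wedge_P [OF b cl(3)], of c]
      show "wedge x (a \<otimes> b) c \<ominus>\<^bsub>U\<^esub> (\<ominus>\<^bsub>U\<^esub> wedge a (b \<otimes> x) c \<ominus>\<^bsub>U\<^esub> wedge b (x \<otimes> a) c)
        = wedge x (a \<otimes> b) c \<oplus>\<^bsub>U\<^esub> wedge a (b \<otimes> x) c \<oplus>\<^bsub>U\<^esub> wedge b (x \<otimes> a) c"
        using v by algebra
    qed
    then show ?thesis
      unfolding U.ceq_def using wedge_jacobi [OF x a b]
      by (auto intro!: wedge_P U.P_diff U.P_uminus x a b cl)
  qed
  have 2: "U.ceq (wedge a (b \<otimes> x)) (\<lambda>c. \<ominus>\<^bsub>U\<^esub> wedge a (x \<otimes> b) c)"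
    unfolding anticomm [OF b x] by (rule wedge_uminus_right [OF a cl(4)])
  have 3: "wedge b (x \<otimes> a) = (\<lambda>c. \<ominus>\<^bsub>U\<^esub> wedge (x \<otimes> a) b c)"
    by (rule wedge_swap [OF b cl(3)])
  have 4: "U.ceq (\<lambda>c. \<ominus>\<^bsub>U\<^esub> wedge a (b \<otimes> x) c \<ominus>\<^bsub>U\<^esub> wedge b (x \<otimes> a) c)
      (\<lambda>c. \<ominus>\<^bsub>U\<^esub> (\<ominus>\<^bsub>U\<^esub> wedge a (x \<otimes> b) c) \<ominus>\<^bsub>U\<^esub> (\<ominus>\<^bsub>U\<^esub> wedge (x \<otimes> a) b c))"
    unfolding 3 by (intro U.ceq_diff U.ceq_uminus 2 U.ceq_refl wedge_P cl b)
  have "(\<lambda>c. \<ominus>\<^bsub>U\<^esub> (\<ominus>\<^bsub>U\<^esub> wedge a (x \<otimes> b) c) \<ominus>\<^bsub>U\<^esub> (\<ominus>\<^bsub>U\<^esub> wedge (x \<otimes> a) b c))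
      = (\<lambda>c. wedge (x \<otimes> a) b c \<oplus>\<^bsub>U\<^esub> wedge a (x \<otimes> b) c)"
  proof
    fix c
    note v = U.P_values [OF wedge_P [OF a cl(4)], of c] U.P_values [OF wedge_P [OF cl(3) b], of c]
    show "\<ominus>\<^bsub>U\<^esub> (\<ominus>\<^bsub>U\<^esub> wedge a (x \<otimes> b) c) \<ominus>\<^bsub>U\<^esub> (\<ominus>\<^bsub>U\<^esub> wedge (x \<otimes> a) b c)
      = wedge (x \<otimes> a) b c \<oplus>\<^bsub>U\<^esub> wedge a (x \<otimes> b) c" using v by algebra
  qed
  with U.ceq_trans [OF 1 4] show ?thesis by simp
qed

text \<open>Write \<open>y j\<close> for the iterated bracket. Since \<open>[x, [y j, y k]] = [y (j + 1), y k] + [y j, y (k + 1)]\<close>, the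
  alternating sum of the \<open>[y (j + i), y (j + 2 m - 1 - i)]\<close> for \<open>i < m\<close> telescopes to
  \<open>[y j, y (j + 2 m)]\<close> under \<open>[x, -]\<close>, because the last term is \<open>[y (j + m), y (j + m)] = 0\<close>. The recursion
  peels off the first summand.\<close>

primrec iter_bracket :: "'a \<Rightarrow> 'a \<Rightarrow> nat \<Rightarrow> 'a" where
  "iter_bracket x y 0 = y"
| "iter_bracket x y (Suc n) = x \<otimes> iter_bracket x y n"

primrec primitive :: "'a \<Rightarrow> 'a \<Rightarrow> nat \<Rightarrow> nat \<Rightarrow> 'a" where
  "primitive x y 0 j = \<zero>"
| "primitive x y (Suc m) j
    = iter_bracket x y j \<otimes> iter_bracket x y (j + 2 * m + 1) \<ominus> primitive x y m (Suc j)"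

lemma iter_bracket_closed: "\<lbrakk>x \<in> carrier L; y \<in> carrier L\<rbrakk> \<Longrightarrow> iter_bracket x y n \<in> carrier L"
  by (induction n) (auto simp: prod_closed)

lemma primitive_closed: "\<lbrakk>x \<in> carrier L; y \<in> carrier L\<rbrakk> \<Longrightarrow> primitive x y m j \<in> carrier L"
  by (induction m arbitrary: j) (auto intro!: minus_closed prod_closed iter_bracket_closed)

text \<open>The same telescoping, one level up: with \<open>wedge_leibniz\<close> in place of the Leibniz rule for brackets.\<close>

lemma wedge_primitive:
  assumes x: "x \<in> carrier L" and y: "y \<in> carrier L"
  shows "U.ceq (wedge x (primitive x y m j))
    (wedge (iter_bracket x y j) (iter_bracket x y (j + 2 * m)))"
proof (induction m arbitrary: j)
  case 0
  show ?case
    using wedge_zero_right [OF x] wedge_self [OF iter_bracket_closed [OF x y]] by simp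
next
  case (Suc m)
  let ?y = "iter_bracket x y"
  have yc: "?y n \<in> carrier L" for n by (rule iter_bracket_closed [OF x y])
  have pc: "primitive x y n i \<in> carrier L" for n i by (rule primitive_closed [OF x y])
  have 1: "U.ceq (wedge x (primitive x y (Suc m) j))
      (\<lambda>c. wedge x (?y j \<otimes> ?y (j + 2 * m + 1)) c \<ominus>\<^bsub>U\<^esub> wedge x (primitive x y m (Suc j)) c)"
    unfolding primitive.simps by (intro wedge_diff_right x prod_closed yc pc)
  have 2: "U.ceq (\<lambda>c. wedge x (?y j \<otimes> ?y (j + 2 * m + 1)) c \<ominus>\<^bsub>U\<^esub> wedge x (primitive x y m (Suc j)) c)
      (\<lambda>c. (wedge (?y (Suc j)) (?y (j + 2 * m + 1)) c \<oplus>\<^bsub>U\<^esub> wedge (?y j) (?y (j + 2 * m + 2)) c)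
        \<ominus>\<^bsub>U\<^esub> wedge (?y (Suc j)) (?y (Suc j + 2 * m)) c)"
  proof (rule U.ceq_diff [OF _ Suc])
    show "U.ceq (wedge x (?y j \<otimes> ?y (j + 2 * m + 1)))
      (\<lambda>c. wedge (?y (Suc j)) (?y (j + 2 * m + 1)) c \<oplus>\<^bsub>U\<^esub> wedge (?y j) (?y (j + 2 * m + 2)) c)"
      using wedge_leibniz [OF x yc [of j] yc [of "j + 2 * m + 1"]] by simp
  qed
  have "(\<lambda>c. (wedge (?y (Suc j)) (?y (j + 2 * m + 1)) c \<oplus>\<^bsub>U\<^esub> wedge (?y j) (?y (j + 2 * m + 2)) c)
        \<ominus>\<^bsub>U\<^esub> wedge (?y (Suc j)) (?y (Suc j + 2 * m)) c) = wedge (?y j) (?y (j + 2 * Suc m))"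
  proof
    fix c
    have e: "Suc j + 2 * m = j + 2 * m + 1" "j + 2 * Suc m = j + 2 * m + 2" by auto
    note v = U.P_values [OF wedge_P [OF yc [of "Suc j"] yc [of "j + 2 * m + 1"]], of c]
      U.P_values [OF wedge_P [OF yc [of j] yc [of "j + 2 * m + 2"]], of c]
    show "(wedge (?y (Suc j)) (?y (j + 2 * m + 1)) c \<oplus>\<^bsub>U\<^esub> wedge (?y j) (?y (j + 2 * m + 2)) c)
        \<ominus>\<^bsub>U\<^esub> wedge (?y (Suc j)) (?y (Suc j + 2 * m)) c = wedge (?y j) (?y (j + 2 * Suc m)) c"
      unfolding e using v by algebra
  qed
  with U.ceq_trans [OF 1 2] show ?case by simp
qed

end

section \<open>Detecting degree 2 classes\<close>

text \<open>The values \<open>delta x i\<close> stand for \<open>lam (T^i (w x))\<close>, where \<open>w\<close> is a derivation into a module on which the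
  Lie ring acts through \<open>p\<close> and an endomorphism \<open>T\<close>, and \<open>lam\<close> is a functional. Recording all powers of
  \<open>T\<close> turns \<open>lam\<close> into a module map to the sequences with the shift. The two-cochain
  \<open>(a, b) \<mapsto> p a * delta b 0 - p b * delta a 0\<close> is then a cocycle with trivial coefficients: it is the image
  of the derivation \<open>delta\<close> under the connecting map of the extension
  \<open>\<real> \<rightarrow> sequences \<rightarrow> sequences\<close>, whose second map drops the first entry.\<close>

locale detection = nonassoc_ring +
  fixes p :: "'a \<Rightarrow> real" and delta :: "'a \<Rightarrow> nat \<Rightarrow> real"
  assumes p_add: "\<lbrakk>x \<in> carrier L; y \<in> carrier L\<rbrakk> \<Longrightarrow> p (x \<oplus> y) = p x + p y"
    and p_bracket: "\<lbrakk>x \<in> carrier L; y \<in> carrier L\<rbrakk> \<Longrightarrow> p (x \<otimes> y) = 0"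
    and delta_add: "\<lbrakk>x \<in> carrier L; y \<in> carrier L\<rbrakk> \<Longrightarrow> delta (x \<oplus> y) i = delta x i + delta y i"
    and delta_bracket: "\<lbrakk>x \<in> carrier L; y \<in> carrier L\<rbrakk>
      \<Longrightarrow> delta (x \<otimes> y) i = p x * delta y (Suc i) - p y * delta x (Suc i)"
begin

text \<open>The derivation \<open>delta\<close> as a representation. Entry 0 spans a trivial quotient, the entries from 1 on
  carry the shift scaled by \<open>p x\<close>, and \<open>x\<close> sends the unit vector at 0 to \<open>delta x\<close>.\<close>

definition act :: "'a \<Rightarrow> (nat \<Rightarrow> real) \<Rightarrow> nat \<Rightarrow> real" where
  "act x c i = (case i of 0 \<Rightarrow> 0 | Suc j \<Rightarrow> p x * c (Suc (Suc j)) + c 0 * delta x j)"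

lemma act_0 [simp]: "act x c 0 = 0"
  and act_Suc [simp]: "act x c (Suc j) = p x * c (Suc (Suc j)) + c 0 * delta x j"
  by (simp_all add: act_def)

sublocale lie_representation L act
proof
  show "act x (\<lambda>i. r * c i + s * d i) = (\<lambda>i. r * act x c i + s * act x d i)" for x r c s d
    by (auto simp: act_def fun_eq_iff algebra_simps split: nat.split)
  show "act (x \<oplus> y) c = (\<lambda>i. act x c i + act y c i)" if "x \<in> carrier L" "y \<in> carrier L" for x y c
    using that by (auto simp: act_def fun_eq_iff algebra_simps p_add delta_add split: nat.split)
  show "act (x \<otimes> y) c = (\<lambda>i. act x (act y c) i - act y (act x c) i)"
    if "x \<in> carrier L" "y \<in> carrier L" for x y c
    using that by (auto simp: act_def fun_eq_iff algebra_simps p_bracket delta_bracket split: nat.split)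
qed

definition unit :: "nat \<Rightarrow> real" where "unit i = (if i = 0 then 1 else 0)"

text \<open>On sequences with entry 0 equal to zero, \<open>drop0\<close> is the surjection of the extension and \<open>lift\<close> is an
  additive section of it; entry 1 of the middle module is the kernel.\<close>

definition lift :: "(nat \<Rightarrow> real) \<Rightarrow> nat \<Rightarrow> real" where
  "lift c i = (case i of 0 \<Rightarrow> 0 | Suc j \<Rightarrow> c j)"

definition drop0 :: "(nat \<Rightarrow> real) \<Rightarrow> nat \<Rightarrow> real" where
  "drop0 c i = (if i = 0 then 0 else c (Suc i))"

lemma env_act_eps0:
  fixes c :: "nat \<Rightarrow> real"
  shows "u \<in> carrier U \<Longrightarrow> env_act u c 0 = uea_augmentation u * c 0"
  by (rule env_act_augmentation) auto

lemma env_act_trivial: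
  fixes c :: "nat \<Rightarrow> real"
  assumes u: "u \<in> carrier U" and c: "\<And>x. act x c = (\<lambda>_. 0)"
  shows "env_act u c i = uea_augmentation u * c i"
proof -
  obtain q where q: "q \<in> carrier F" "u = uea_ideal +>\<^bsub>F\<^esub> q" using u by (rule U_cases)
  have a0: "act x (\<lambda>_. 0) = (\<lambda>_. 0)" for x by (auto simp: act_def fun_eq_iff split: nat.split)
  have "word v c = (\<lambda>i. (if v = [] then 1 else 0) * c i)" for v
  proof (induction v)
    case (Cons x v)
    then show ?case using a0 [of x] c [of x] by (cases "v = []") (simp_all add: word_def)
  qed (simp add: word_def)
  then have "frag_act q c i = lin_ext (\<lambda>v. (if v = [] then 1 else 0) * c i) q"
    by (simp add: frag_act_def)
  then have "frag_act q c i = of_int (Poly_Mapping.lookup q []) * c i"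
    unfolding lin_ext_lookup [symmetric]
    by (simp add: lin_ext_def sum_distrib_right) (rule sum.cong, auto)
  then show ?thesis using q by (simp add: env_act_proj uea_augmentation_proj)
qed

lemma env_act_drop0:
  assumes u: "u \<in> carrier U" and c: "c 0 = 0"
  shows "env_act u (drop0 c) = drop0 (env_act u c)"
proof -
  obtain q where q: "q \<in> carrier F" "u = uea_ideal +>\<^bsub>F\<^esub> q" using u by (rule U_cases)
  have step: "act x (drop0 d) = drop0 (act x d)" if "d 0 = 0" for x and d :: "nat \<Rightarrow> real"
    using that by (auto simp: fun_eq_iff drop0_def act_def split: nat.split)
  have "word v (drop0 c) = drop0 (word v c) \<and> word v c 0 = 0" for v
  proof (induction v)
    case (Cons x v)
    then show ?case using step [of "word v c" x] by (simp add: word_def)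
  qed (simp add: word_def c)
  then have "frag_act q (drop0 c) = drop0 (frag_act q c)"
    by (auto simp: frag_act_def fun_eq_iff drop0_def)
  then show ?thesis using q by (simp add: env_act_proj)
qed

text \<open>The module map from degree 0 that sends the basis vector at \<open>n\<close> to \<open>n\<close> times the unit vector, and the
  module map from degree 1 that lifts its composite with the boundary along \<open>drop0\<close>. The connecting
  map is entry 1 of the second.\<close>

definition eval0 :: "((('a list \<Rightarrow>\<^sub>0 int) set, int) cell \<Rightarrow> ('a list \<Rightarrow>\<^sub>0 int) set) \<Rightarrow> nat \<Rightarrow> real" where
  "eval0 f i = U.free_ext (\<lambda>c u. of_int (point c) * env_act u unit i) f"

definition eval1 :: "((('a list \<Rightarrow>\<^sub>0 int) set, int) cell \<Rightarrow> ('a list \<Rightarrow>\<^sub>0 int) set) \<Rightarrow> nat \<Rightarrow> real" where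
  "eval1 f i = U.free_ext (\<lambda>c u. env_act u (lift (eval0 (U.syz c))) i) f"

lemma env_act_0 [simp]: "env_act \<zero>\<^bsub>U\<^esub> c i = 0"
  using fun_cong [OF env_act_add [of "\<zero>\<^bsub>U\<^esub>" "\<zero>\<^bsub>U\<^esub>" c], of i] by simp

lemma env_act_c0 [simp]: "env_act u (\<lambda>_. 0) = (\<lambda>_. 0)"
  using env_act_linear [of u 0 "\<lambda>_. 0" 0 "\<lambda>_. 0"] by simp

lemma env_act_plus: "env_act u (\<lambda>i. c i + d i) = (\<lambda>i. env_act u c i + env_act u d i)"
  using env_act_linear [of u 1 c 1 d] by simp

lemma env_act_scale: "env_act u (\<lambda>i. r * c i) = (\<lambda>i. r * env_act u c i)"
  using env_act_linear [of u r c 0 c] by simp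

lemma eval0_add:
  "\<lbrakk>f \<in> U.P 0; g \<in> U.P 0\<rbrakk> \<Longrightarrow> eval0 (\<lambda>i. f i \<oplus>\<^bsub>U\<^esub> g i) = (\<lambda>i. eval0 f i + eval0 g i)"
  unfolding eval0_def [abs_def] U.P_def
  by (intro ext U.free_ext_add) (auto simp: env_act_add distrib_left)

lemma eval0_monomial:
  "u \<in> carrier U \<Longrightarrow> eval0 (U.monomial u c) = (\<lambda>i. of_int (point c) * env_act u unit i)"
  unfolding eval0_def [abs_def] by (subst U.free_ext_monomial) auto

lemma eval0_smult:
  assumes "f \<in> U.P 0" "u \<in> carrier U"
  shows "eval0 (\<lambda>i. u \<otimes>\<^bsub>U\<^esub> f i) = env_act u (eval0 f)"
  using assms(1)
proof (induction rule: U.P_induct)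
  case zero
  then show ?case using assms(2) by (simp add: eval0_def [abs_def])
next
  case (monomial v c)
  have "(\<lambda>i. u \<otimes>\<^bsub>U\<^esub> U.monomial v c i) = U.monomial (u \<otimes>\<^bsub>U\<^esub> v) c"
    using assms(2) by (auto simp: U.monomial_def fun_eq_iff)
  then show ?case using monomial assms(2) by (simp add: eval0_monomial env_act_mult env_act_scale)
next
  case (add f g)
  have "(\<lambda>i. u \<otimes>\<^bsub>U\<^esub> (f i \<oplus>\<^bsub>U\<^esub> g i)) = (\<lambda>i. u \<otimes>\<^bsub>U\<^esub> f i \<oplus>\<^bsub>U\<^esub> u \<otimes>\<^bsub>U\<^esub> g i)"
    using assms(2) U.P_values [OF add(1)] U.P_values [OF add(2)] by (auto simp: U.r_distr)
  then show ?case
    using add eval0_add [OF U.P_smult [OF add(1) assms(2)] U.P_smult [OF add(2) assms(2)]]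
    by (simp add: eval0_add env_act_plus)
qed

lemma eval0_aug: "f \<in> U.P 0 \<Longrightarrow> eval0 f 0 = of_int (resolution_aug U U.T f)"
proof (induction rule: U.P_induct)
  case zero
  then show ?case by (simp add: eval0_def U.aug_free_ext)
next
  case (monomial u c)
  then show ?case by (simp add: eval0_monomial U.aug_monomial env_act_eps0 unit_def)
next
  case (add f g)
  then show ?case by (simp add: eval0_add U.aug_add)
qed

lemma eval1_add:
  "\<lbrakk>f \<in> U.P1; g \<in> U.P1\<rbrakk>
    \<Longrightarrow> eval1 (\<lambda>i. f i \<oplus>\<^bsub>U\<^esub> g i) = (\<lambda>i. eval1 f i + eval1 g i)"
  unfolding eval1_def [abs_def] U.P_def
  by (intro ext U.free_ext_add) (auto simp: env_act_add)

lemma eval1_monomial: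
  "u \<in> carrier U \<Longrightarrow> eval1 (U.monomial u c) = env_act u (lift (eval0 (U.syz c)))"
  unfolding eval1_def [abs_def] by (subst U.free_ext_monomial) auto

lemma eval1_smult:
  assumes "f \<in> U.P1" "u \<in> carrier U"
  shows "eval1 (\<lambda>i. u \<otimes>\<^bsub>U\<^esub> f i) = env_act u (eval1 f)"
  using assms(1)
proof (induction rule: U.P_induct)
  case zero
  then show ?case using assms(2) by (simp add: eval1_def [abs_def])
next
  case (monomial v c)
  have "(\<lambda>i. u \<otimes>\<^bsub>U\<^esub> U.monomial v c i) = U.monomial (u \<otimes>\<^bsub>U\<^esub> v) c"
    using assms(2) by (auto simp: U.monomial_def fun_eq_iff)
  then show ?case using monomial assms(2) by (simp add: eval1_monomial env_act_mult)
next
  case (add f g)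
  have "(\<lambda>i. u \<otimes>\<^bsub>U\<^esub> (f i \<oplus>\<^bsub>U\<^esub> g i)) = (\<lambda>i. u \<otimes>\<^bsub>U\<^esub> f i \<oplus>\<^bsub>U\<^esub> u \<otimes>\<^bsub>U\<^esub> g i)"
    using assms(2) U.P_values [OF add(1)] U.P_values [OF add(2)] by (auto simp: U.r_distr)
  then show ?case
    using add eval1_add [OF U.P_smult [OF add(1) assms(2)] U.P_smult [OF add(2) assms(2)]]
    by (simp add: eval1_add env_act_plus)
qed

lemma eval1_0: "f \<in> U.P1 \<Longrightarrow> eval1 f 0 = 0"
proof (induction rule: U.P_induct)
  case zero
  then show ?case by (simp add: eval1_def)
next
  case (monomial u c)
  then show ?case by (simp add: eval1_monomial env_act_eps0 lift_def)
next
  case (add f g)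
  then show ?case by (simp add: eval1_add)
qed

lemma drop0_lift: "c 0 = 0 \<Longrightarrow> drop0 (lift c) = c"
  by (auto simp: drop0_def lift_def fun_eq_iff)

lemma drop0_eval1: "f \<in> U.P1 \<Longrightarrow> drop0 (eval1 f) = eval0 (U.bd f)"
proof (induction rule: U.P_induct)
  case zero
  then show ?case by (auto simp: eval1_def [abs_def] eval0_def [abs_def] drop0_def U.bd_zero)
next
  case (monomial u c)
  have s: "U.syz c \<in> U.P 0" by (rule U.syz_closed [OF monomial(2)])
  have z: "eval0 (U.syz c) 0 = 0"
    using eval0_aug [OF s] U.syz_aug [OF monomial(2)] by simp
  have "drop0 (eval1 (U.monomial u c)) = env_act u (drop0 (lift (eval0 (U.syz c))))"
    unfolding eval1_monomial [OF monomial(1)]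
    by (rule env_act_drop0 [OF monomial(1), symmetric]) (simp add: lift_def)
  also have "\<dots> = eval0 (U.bd (U.monomial u c))"
    using z by (simp add: drop0_lift U.bd_monomial [OF monomial] eval0_smult [OF s monomial(1)])
  finally show ?case .
next
  case (add f g)
  have "drop0 (eval1 (\<lambda>i. f i \<oplus>\<^bsub>U\<^esub> g i)) = (\<lambda>i. drop0 (eval1 f) i + drop0 (eval1 g) i)"
    by (auto simp: eval1_add [OF add(1,2)] drop0_def)
  then show ?case
    using add by (simp add: U.bd_add [OF add(1,2)] eval0_add [OF U.bd_closed U.bd_closed])
qed

text \<open>On a cycle \<open>drop0\<close> gives zero, so the value lies in the kernel of the extension.\<close>

lemma eval1_cycle:
  assumes m: "m \<in> U.P1" "U.bd m = (\<lambda>_. \<zero>\<^bsub>U\<^esub>)"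
  shows "eval1 m i = (if i = 1 then eval1 m 1 else 0)"
proof -
  have "drop0 (eval1 m) = (\<lambda>_. 0)"
    unfolding drop0_eval1 [OF m(1)] m(2) by (simp add: eval0_def [abs_def])
  then have "eval1 m (Suc (Suc j)) = 0" for j
  proof -
    have "drop0 (eval1 m) (Suc j) = 0" by (simp add: \<open>drop0 (eval1 m) = (\<lambda>_. 0)\<close>)
    then show ?thesis by (simp add: drop0_def)
  qed
  then show ?thesis using eval1_0 [OF m(1)] by (cases i; cases "i - 1") auto
qed

text \<open>The enveloping ring acts on the kernel of the extension through the augmentation.\<close>

lemma eval1_null: "m \<in> U.null_cycles \<Longrightarrow> eval1 m 1 = 0"
proof (rule U.null_cycles_functional [where F = "\<lambda>m. eval1 m 1"])
  show "eval1 (\<lambda>i. f i \<oplus>\<^bsub>U\<^esub> g i) 1 = eval1 f 1 + eval1 g 1"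
    if "f \<in> U.P1" "g \<in> U.P1" for f g
    by (simp add: eval1_add [OF that])
next
  fix u m
  assume u: "u \<in> carrier U" "uea_augmentation u = 0"
    and m: "m \<in> U.P1" "U.bd m = (\<lambda>_. \<zero>\<^bsub>U\<^esub>)"
  have c: "eval1 m = (\<lambda>i. if i = 1 then eval1 m 1 else 0)"
    using eval1_cycle [OF m] by auto
  have "act x (eval1 m) = (\<lambda>_. 0)" for x
    by (subst c) (auto simp: act_def fun_eq_iff split: nat.split)
  then show "eval1 (\<lambda>i. u \<otimes>\<^bsub>U\<^esub> m i) 1 = 0"
    unfolding eval1_smult [OF m(1) u(1)] using env_act_trivial [OF u(1)] u(2) by simp
qed

lemma eval1_bas:
  assumes "b \<in> carrier L"
  shows "eval1 (bas b) = lift (act b unit)"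
proof -
  have "eval1 (bas b) = env_act \<one>\<^bsub>U\<^esub> (lift (act b unit))"
    unfolding bas_def using assms
    by (simp add: eval1_monomial syz_bar eval0_monomial env_closed env_act_env)
  also have "\<dots> = lift (act b unit)"
  proof -
    interpret F: ring F by (rule F_ring)
    have "\<one>\<^bsub>U\<^esub> = uea_ideal +>\<^bsub>F\<^esub> \<one>\<^bsub>F\<^esub>" using ring_hom_one [OF proj_hom] by simp
    then show ?thesis
      using env_act_proj [OF F.one_closed] by (simp add: frag_act_def [abs_def] word_def)
  qed
  finally show ?thesis .
qed

lemma eval1_wedge:
  assumes "a \<in> carrier L" "b \<in> carrier L"
  shows "eval1 (wedge a b) 1 = p a * delta b 0 - p b * delta a 0"
proof -
  have *: "eval1 (\<lambda>c. env x \<otimes>\<^bsub>U\<^esub> bas y c) 1 = p x * delta y 0" if "x \<in> carrier L" "y \<in> carrier L" for x y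
    unfolding eval1_smult [OF bas_P [OF that(2)] env_closed [OF that(1)]] eval1_bas [OF that(2)]
      env_act_env [OF that(1)] by (simp add: lift_def unit_def)
  have P: "(\<lambda>c. env x \<otimes>\<^bsub>U\<^esub> bas y c) \<in> U.P1" if "x \<in> carrier L" "y \<in> carrier L" for x y
    by (intro U.P_smult bas_P env_closed that)
  have "(\<lambda>c. wedge a b c \<oplus>\<^bsub>U\<^esub> env b \<otimes>\<^bsub>U\<^esub> bas a c) = (\<lambda>c. env a \<otimes>\<^bsub>U\<^esub> bas b c)"
    unfolding wedge_def
    using U.P_values [OF P [OF assms]] U.P_values [OF P [OF assms(2,1)]]
    by (simp add: a_minus_def U.a_assoc U.l_neg)
  then have "eval1 (wedge a b) 1 + p b * delta a 0 = p a * delta b 0"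
    using fun_cong [OF eval1_add [OF wedge_P [OF assms] P [OF assms(2,1)]], of 1]
      * [OF assms] * [OF assms(2,1)] by simp
  then show ?thesis by simp
qed

end

section \<open>Quotients of nonassociative rings\<close>

context nonassoc_ring
begin

lemma prod_zero_left [simp]: "x \<in> carrier L \<Longrightarrow> \<zero> \<otimes> x = \<zero>"
  using prod_add_left [of \<zero> \<zero> x] prod_closed [of \<zero> x] add.l_cancel_one by fastforce

lemma prod_zero_right [simp]: "x \<in> carrier L \<Longrightarrow> x \<otimes> \<zero> = \<zero>"
  using prod_add_right [of \<zero> \<zero> x] prod_closed [of x \<zero>] add.l_cancel_one by fastforce

lemma prod_minus_left: "\<lbrakk>x \<in> carrier L; y \<in> carrier L\<rbrakk> \<Longrightarrow> (\<ominus> x) \<otimes> y = \<ominus> (x \<otimes> y)"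
  using prod_add_left [of "\<ominus> x" x y] by (intro minus_equality [symmetric]) (simp_all add: prod_closed l_neg)

lemma prod_minus_right: "\<lbrakk>x \<in> carrier L; y \<in> carrier L\<rbrakk> \<Longrightarrow> x \<otimes> (\<ominus> y) = \<ominus> (x \<otimes> y)"
  using prod_add_right [of "\<ominus> y" y x] by (intro minus_equality [symmetric]) (simp_all add: prod_closed l_neg)

lemma prod_diff_left:
  "\<lbrakk>x \<in> carrier L; y \<in> carrier L; z \<in> carrier L\<rbrakk> \<Longrightarrow> (x \<ominus> y) \<otimes> z = (x \<otimes> z) \<ominus> (y \<otimes> z)"
  by (simp add: minus_eq prod_add_left prod_minus_left)

lemma prod_diff_right:
  "\<lbrakk>x \<in> carrier L; y \<in> carrier L; z \<in> carrier L\<rbrakk> \<Longrightarrow> z \<otimes> (x \<ominus> y) = (z \<otimes> x) \<ominus> (z \<otimes> y)"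
  by (simp add: minus_eq prod_add_right prod_minus_right)

lemma additive_subgroupI:
  assumes "I \<subseteq> carrier L" "\<zero> \<in> I" "\<And>a b. \<lbrakk>a \<in> I; b \<in> I\<rbrakk> \<Longrightarrow> a \<oplus> b \<in> I" "\<And>a. a \<in> I \<Longrightarrow> \<ominus> a \<in> I"
  shows "additive_subgroup I L"
proof
  show "inv\<^bsub>add_monoid L\<^esub> a \<in> I" if "a \<in> I" for a
    using assms(4) [OF that] by (simp add: a_inv_def)
qed (use assms in auto)

end

locale nonassoc_quotient = nonassoc_ring +
  fixes I assumes ideal: "nonassoc_ideal I L"
begin

sublocale abelian_subgroup I L
  using ideal abelian_group_axioms by (intro abelian_subgroupI3) (auto simp: nonassoc_ideal_def)

lemma I_mult: "\<lbrakk>a \<in> I; r \<in> carrier L\<rbrakk> \<Longrightarrow> a \<otimes> r \<in> I" "\<lbrakk>a \<in> I; r \<in> carrier L\<rbrakk> \<Longrightarrow> r \<otimes> a \<in> I"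
  using ideal by (auto simp: nonassoc_ideal_def)

lemma I_closed: "a \<in> I \<Longrightarrow> a \<in> carrier L"
  by (rule a_Hcarr)

lemma I_zero: "\<zero> \<in> I"
  using zero_closed by blast

lemma I_uminus: "a \<in> I \<Longrightarrow> \<ominus> a \<in> I"
  using a_inv_closed by blast

lemma I_add: "\<lbrakk>a \<in> I; b \<in> I\<rbrakk> \<Longrightarrow> a \<oplus> b \<in> I"
  by (rule a_closed)

end

context nonassoc_quotient
begin

abbreviation cls where "cls a \<equiv> I +>\<^bsub>L\<^esub> a"

lemma cls_eq_iff:
  assumes "a \<in> carrier L" "b \<in> carrier L"
  shows "cls a = cls b \<longleftrightarrow> a \<ominus> b \<in> I"
proof -
  have "cls a = cls b \<longleftrightarrow> a \<in> cls b"
    using a_repr_independence' [of a b] a_rcos_self [OF assms(1)] assms(2) by auto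
  also have "\<dots> \<longleftrightarrow> a \<ominus> b \<in> I"
    using a_rcos_module [of b a] assms by (simp add: minus_eq)
  finally show ?thesis .
qed

lemma cls_self: "a \<in> carrier L \<Longrightarrow> a \<in> cls a"
  by (rule a_rcos_self)

lemma cls_mem_iff:
  assumes "a \<in> carrier L"
  shows "b \<in> cls a \<longleftrightarrow> b \<in> carrier L \<and> b \<ominus> a \<in> I"
proof -
  have "cls a \<subseteq> carrier L" using a_r_coset_subset_G a_subset assms by blast
  then show ?thesis using a_rcos_module [of a b] assms by (auto simp: minus_eq)
qed

lemma Quot_simps [simp]:
  "add (L Quot I) = set_add L" "ring.zero (L Quot I) = I" "monoid.mult (L Quot I) = rcoset_mult L I"
  by (simp_all add: FactRing_def)

lemma Quot_carrier: "carrier (L Quot I) = cls ` carrier L"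
  by (auto simp: FactRing_def A_RCOSETS_def')

lemma cls_add: "\<lbrakk>a \<in> carrier L; b \<in> carrier L\<rbrakk> \<Longrightarrow> cls a <+>\<^bsub>L\<^esub> cls b = cls (a \<oplus> b)"
  by (rule a_rcos_sum)

lemma cls_zero: "cls \<zero> = I"
  using a_coset_join2 [of \<zero>] I_zero by (simp add: a_subgroup)

lemma cls_mult:
  assumes a: "a \<in> carrier L" and b: "b \<in> carrier L"
  shows "rcoset_mult L I (cls a) (cls b) = cls (a \<otimes> b)"
proof -
  have eq: "cls (x \<otimes> y) = cls (a \<otimes> b)" if x: "x \<in> cls a" and y: "y \<in> cls b" for x y
  proof -
    have xy: "x \<in> carrier L" "x \<ominus> a \<in> I" "y \<in> carrier L" "y \<ominus> b \<in> I"
      using x y cls_mem_iff a b by auto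
    have pc: "x \<otimes> y \<in> carrier L" "a \<otimes> b \<in> carrier L" "x \<otimes> b \<in> carrier L"
      using prod_closed xy a b by auto
    have e: "x \<otimes> (y \<ominus> b) = x \<otimes> y \<ominus> x \<otimes> b" "(x \<ominus> a) \<otimes> b = x \<otimes> b \<ominus> a \<otimes> b"
      by (rule prod_diff_right prod_diff_left; use xy a b in simp)+
    have "x \<otimes> y \<ominus> a \<otimes> b = (x \<otimes> (y \<ominus> b)) \<oplus> ((x \<ominus> a) \<otimes> b)"
      unfolding e using pc by (simp add: minus_eq a_assoc r_neg1)
    also have "\<dots> \<in> I" by (intro I_add I_mult xy b)
    finally show ?thesis using cls_eq_iff pc by simp
  qed
  show ?thesis
    unfolding rcoset_mult_def
  proof (intro equalityI subsetI)
    fix z assume "z \<in> (\<Union>x\<in>cls a. \<Union>y\<in>cls b. cls (x \<otimes> y))"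
    then show "z \<in> cls (a \<otimes> b)" using eq by blast
  next
    fix z assume "z \<in> cls (a \<otimes> b)"
    then show "z \<in> (\<Union>x\<in>cls a. \<Union>y\<in>cls b. cls (x \<otimes> y))"
      using cls_self a b by blast
  qed
qed

lemma cls_zero_mem: "I \<in> cls ` carrier L"
  using imageI [OF I_closed [OF I_zero], of cls] by (simp add: cls_zero)

lemma cls_zero_add: "a \<in> carrier L \<Longrightarrow> I <+>\<^bsub>L\<^esub> cls a = cls a"
  using cls_add [of \<zero> a] by (simp add: cls_zero)

lemma Quot_nonassoc_ring: "nonassoc_ring (L Quot I)"
proof -
  have "abelian_group (L Quot I)"
  proof (rule abelian_groupI, goal_cases)
    case (6 x)
    then obtain a where a: "a \<in> carrier L" "x = cls a" by (auto simp: Quot_carrier)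
    then show ?case
      by (intro bexI [of _ "cls (\<ominus> a)"]) (auto simp: Quot_carrier cls_add l_neg cls_zero)
  qed (auto simp: Quot_carrier cls_add a_ac cls_zero_add intro: cls_zero_mem)
  moreover have "nonassoc_ring_axioms (L Quot I)"
    by (intro nonassoc_ring_axioms.intro) (auto simp: Quot_carrier cls_add cls_mult prod_closed prod_add_left prod_add_right)
  ultimately show ?thesis by (rule nonassoc_ring.intro)
qed

end

context nonassoc_ring
begin

lemma lie_relators_closed: "lie_relators L \<subseteq> carrier L"
  by (auto simp: lie_relators_def intro!: prod_closed)

lemma nonassoc_ideal_carrier: "nonassoc_ideal (carrier L) L"
  unfolding nonassoc_ideal_def by (auto intro: additive_subgroupI prod_closed)

lemma lie_ideal_ideal: "nonassoc_ideal (lie_ideal L) L"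
proof -
  have ne: "carrier L \<in> {I. nonassoc_ideal I L \<and> lie_relators L \<subseteq> I}"
    using nonassoc_ideal_carrier lie_relators_closed by blast
  have q: "nonassoc_quotient L I" if "nonassoc_ideal I L" for I
    using that by unfold_locales
  show ?thesis
    unfolding nonassoc_ideal_def
  proof (intro conjI ballI additive_subgroupI)
    show "lie_ideal L \<subseteq> carrier L" unfolding lie_ideal_def using ne by blast
    show "\<zero> \<in> lie_ideal L" unfolding lie_ideal_def using nonassoc_quotient.I_zero [OF q] by blast
    show "a \<oplus> b \<in> lie_ideal L" if "a \<in> lie_ideal L" "b \<in> lie_ideal L" for a b
      using that unfolding lie_ideal_def using nonassoc_quotient.I_add [OF q] by blast
    show "\<ominus> a \<in> lie_ideal L" if "a \<in> lie_ideal L" for a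
      using that unfolding lie_ideal_def using nonassoc_quotient.I_uminus [OF q] by blast
    show "a \<otimes> r \<in> lie_ideal L" "r \<otimes> a \<in> lie_ideal L" if "a \<in> lie_ideal L" "r \<in> carrier L" for a r
      using that unfolding lie_ideal_def using nonassoc_quotient.I_mult [OF q] by blast+
  qed
qed

lemma lie_ideal_minimal: "\<lbrakk>nonassoc_ideal I L; lie_relators L \<subseteq> I\<rbrakk> \<Longrightarrow> lie_ideal L \<subseteq> I"
  by (auto simp: lie_ideal_def)

lemma lie_quotient: "lie_ring (L Quot lie_ideal L)"
proof -
  interpret nonassoc_quotient L "lie_ideal L" by unfold_locales (rule lie_ideal_ideal)
  have rel: "r \<in> lie_ideal L" if "r \<in> lie_relators L" for r
    using that by (auto simp: lie_ideal_def)
  have cls_rel: "cls r = lie_ideal L" if "r \<in> lie_relators L" for r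
    using cls_eq_iff [of r \<zero>] rel [OF that] subsetD [OF lie_relators_closed that] cls_zero
    by (simp add: minus_eq)
  show ?thesis
  proof (intro lie_ring.intro Quot_nonassoc_ring lie_ring_axioms.intro)
    fix x assume "x \<in> carrier (L Quot lie_ideal L)"
    then obtain a where a: "a \<in> carrier L" "x = cls a" by (auto simp: Quot_carrier)
    have "a \<otimes> a \<in> lie_relators L" using a by (auto simp: lie_relators_def)
    then show "x \<otimes>\<^bsub>L Quot lie_ideal L\<^esub> x = \<zero>\<^bsub>L Quot lie_ideal L\<^esub>"
      using cls_rel by (simp add: a cls_mult)
  next
    fix x y z
    assume "x \<in> carrier (L Quot lie_ideal L)" "y \<in> carrier (L Quot lie_ideal L)"
      "z \<in> carrier (L Quot lie_ideal L)"
    then obtain a b c where a: "a \<in> carrier L" "x = cls a" "b \<in> carrier L" "y = cls b"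
      "c \<in> carrier L" "z = cls c" by (auto simp: Quot_carrier)
    have "(a \<otimes> (b \<otimes> c)) \<oplus> (b \<otimes> (c \<otimes> a)) \<oplus> (c \<otimes> (a \<otimes> b)) \<in> lie_relators L"
      using a by (auto simp: lie_relators_def)
    then show "x \<otimes>\<^bsub>L Quot lie_ideal L\<^esub> (y \<otimes>\<^bsub>L Quot lie_ideal L\<^esub> z) \<oplus>\<^bsub>L Quot lie_ideal L\<^esub>
        y \<otimes>\<^bsub>L Quot lie_ideal L\<^esub> (z \<otimes>\<^bsub>L Quot lie_ideal L\<^esub> x) \<oplus>\<^bsub>L Quot lie_ideal L\<^esub>
        z \<otimes>\<^bsub>L Quot lie_ideal L\<^esub> (x \<otimes>\<^bsub>L Quot lie_ideal L\<^esub> y) = \<zero>\<^bsub>L Quot lie_ideal L\<^esub>"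
      using cls_rel a by (simp add: cls_mult cls_add prod_closed)
  qed
qed

end

section \<open>The pronilpotent completion\<close>

context lie_ring
begin

lemma bracket_anticomm:
  assumes "x \<in> carrier L" "y \<in> carrier L"
  shows "x \<otimes> y = \<ominus> (y \<otimes> x)"
proof -
  have c: "x \<otimes> y \<in> carrier L" "y \<otimes> x \<in> carrier L" using assms prod_closed by auto
  have "\<zero> = (x \<oplus> y) \<otimes> (x \<oplus> y)" using assms by (simp add: bracket_self)
  also have "\<dots> = (x \<otimes> x \<oplus> x \<otimes> y) \<oplus> (y \<otimes> x \<oplus> y \<otimes> y)"
    using assms by (simp add: prod_add_left prod_add_right prod_closed a_ac)
  also have "\<dots> = x \<otimes> y \<oplus> y \<otimes> x"
    using assms c by (simp add: bracket_self)
  finally show ?thesis using minus_equality [of "x \<otimes> y" "y \<otimes> x"] c by simp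
qed

sublocale anticomm_ring
  by unfold_locales (rule bracket_anticomm)

lemma ad_leibniz:
  assumes "x \<in> carrier L" "a \<in> carrier L" "b \<in> carrier L"
  shows "x \<otimes> (a \<otimes> b) = ((x \<otimes> a) \<otimes> b) \<oplus> (a \<otimes> (x \<otimes> b))"
proof -
  have c: "x \<otimes> (a \<otimes> b) \<in> carrier L" "a \<otimes> (x \<otimes> b) \<in> carrier L" "b \<otimes> (x \<otimes> a) \<in> carrier L"
    using assms prod_closed by auto
  have "a \<otimes> (b \<otimes> x) = \<ominus> (a \<otimes> (x \<otimes> b))"
    using assms prod_closed by (simp add: bracket_anticomm [of b x] prod_minus_right)
  moreover have "(x \<otimes> a) \<otimes> b = \<ominus> (b \<otimes> (x \<otimes> a))"
    using assms prod_closed by (intro bracket_anticomm) auto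
  moreover have "x \<otimes> (a \<otimes> b) = \<ominus> (b \<otimes> (x \<otimes> a)) \<oplus> \<ominus> (a \<otimes> (b \<otimes> x))"
  proof -
    have "\<ominus> (\<ominus> (a \<otimes> (x \<otimes> b)) \<oplus> b \<otimes> (x \<otimes> a)) = x \<otimes> (a \<otimes> b)"
      using jacobi [OF assms] c calculation(1)
      by (intro minus_equality) (simp_all add: a_assoc)
    then show ?thesis using c calculation(1) by (simp add: minus_add a_comm)
  qed
  ultimately show ?thesis using c by simp
qed

lemma lower_central_ideal: "nonassoc_ideal (lower_central L n) L"
  and lower_central_Suc_subset: "lower_central L (Suc n) \<subseteq> lower_central L n"
  and lower_central_bracket: "\<lbrakk>a \<in> lower_central L n; r \<in> carrier L\<rbrakk> \<Longrightarrow> a \<otimes> r \<in> lower_central L (Suc n)"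
proof -
  have br: "a \<otimes> r \<in> lower_central L (Suc n)" if "a \<in> lower_central L n" "r \<in> carrier L" for a r n
    unfolding lower_central.simps by (rule generate.incl) (use that in blast)
  have step: "nonassoc_ideal (lower_central L (Suc n)) L \<and> lower_central L (Suc n) \<subseteq> lower_central L n"
    if I: "nonassoc_ideal (lower_central L n) L" for n
  proof -
    interpret I: nonassoc_quotient L "lower_central L n" by unfold_locales (rule I)
    let ?X = "{x \<otimes> y | x y. x \<in> lower_central L n \<and> y \<in> carrier L}"
    have sub: "lower_central L (Suc n) \<subseteq> lower_central L n"
      unfolding lower_central.simps
      by (rule add.generate_subgroup_incl) (use I.I_mult(1) I.a_subgroup in auto)
    have Xc: "?X \<subseteq> carrier L" using I.I_closed prod_closed by auto
    have ag: "additive_subgroup (lower_central L (Suc n)) L"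
      unfolding lower_central.simps
      by (rule additive_subgroup.intro, rule add.generate_is_subgroup, rule Xc)
    have um: "\<ominus> a \<in> lower_central L (Suc n)" if "a \<in> lower_central L (Suc n)" for a
      by (rule additive_subgroup.a_inv_closed [OF ag that])
    have "a \<otimes> r \<in> lower_central L (Suc n) \<and> r \<otimes> a \<in> lower_central L (Suc n)"
      if a: "a \<in> lower_central L (Suc n)" and r: "r \<in> carrier L" for a r
    proof -
      have "a \<in> lower_central L n" using sub a by blast
      then have "a \<otimes> r \<in> lower_central L (Suc n)" "a \<in> carrier L" using br r I.I_closed by auto
      then show ?thesis using um bracket_anticomm [OF r] by simp
    qed
    then show ?thesis using ag sub unfolding nonassoc_ideal_def by blast
  qed
  have I: "nonassoc_ideal (lower_central L n) L" for n
    by (induction n) (use nonassoc_ideal_carrier step in auto)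
  then show "nonassoc_ideal (lower_central L n) L" .
  show "lower_central L (Suc n) \<subseteq> lower_central L n" using step [OF I] by blast
  show "a \<otimes> r \<in> lower_central L (Suc n)" if "a \<in> lower_central L n" "r \<in> carrier L" using br that .
qed

lemma lower_central_quotient: "nonassoc_quotient L (lower_central L n)"
  by unfold_locales (rule lower_central_ideal)

abbreviation gam where "gam \<equiv> lower_central L"

lemma lower_central_antimono: "m \<le> n \<Longrightarrow> gam n \<subseteq> gam m"
  by (induction n rule: dec_induct) (use lower_central_Suc_subset in auto)

abbreviation C where "C \<equiv> pronilpotent_completion L"

text \<open>Compatible sequences of cosets are handled through representatives, which form a Cauchy sequence
  for the lower central filtration; all operations of the completion are then termwise.\<close>

definition coherent :: "(nat \<Rightarrow> 'a) \<Rightarrow> bool" where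
  "coherent a \<longleftrightarrow> (\<forall>i. a i \<in> carrier L \<and> a (Suc i) \<ominus> a i \<in> gam i)"

definition lim :: "(nat \<Rightarrow> 'a) \<Rightarrow> nat \<Rightarrow> 'a set" where
  "lim a = (\<lambda>i. gam i +>\<^bsub>L\<^esub> a i)"

lemma coherent_closed: "coherent a \<Longrightarrow> a i \<in> carrier L"
  by (simp add: coherent_def)

lemma transition:
  assumes "a \<in> carrier L"
  shows "gam i <+>\<^bsub>L\<^esub> (gam (Suc i) +>\<^bsub>L\<^esub> a) = gam i +>\<^bsub>L\<^esub> a"
proof -
  interpret G: nonassoc_quotient L "gam i" by (rule lower_central_quotient)
  interpret H: nonassoc_quotient L "gam (Suc i)" by (rule lower_central_quotient)
  show ?thesis
  proof (intro equalityI subsetI)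
    fix z assume "z \<in> gam i <+>\<^bsub>L\<^esub> (gam (Suc i) +>\<^bsub>L\<^esub> a)"
    then obtain g h where z: "g \<in> gam i" "h \<in> gam (Suc i)" "z = g \<oplus> (h \<oplus> a)"
      unfolding set_add_def' a_r_coset_def' by blast
    then have "h \<in> gam i" using lower_central_Suc_subset by blast
    then have "z = (g \<oplus> h) \<oplus> a" "g \<oplus> h \<in> gam i"
      using z assms G.I_closed by (simp_all add: a_assoc G.I_add)
    then show "z \<in> gam i +>\<^bsub>L\<^esub> a" unfolding a_r_coset_def' by blast
  next
    fix z assume "z \<in> gam i +>\<^bsub>L\<^esub> a"
    then obtain g where z: "g \<in> gam i" "z = g \<oplus> a" unfolding a_r_coset_def' by blast
    then have "z = g \<oplus> (\<zero> \<oplus> a)" using assms by simp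
    then show "z \<in> gam i <+>\<^bsub>L\<^esub> (gam (Suc i) +>\<^bsub>L\<^esub> a)"
      unfolding set_add_def' a_r_coset_def' using z(1) H.I_zero by blast
  qed
qed

lemma C_carrier: "carrier C = lim ` Collect coherent"
proof (intro equalityI subsetI)
  fix s assume "s \<in> carrier C"
  then have s: "\<And>i. s i \<in> carrier (L Quot gam i)" "\<And>i. gam i <+>\<^bsub>L\<^esub> s (Suc i) = s i"
    by (auto simp: pronilpotent_completion_def)
  have "\<forall>i. \<exists>a\<in>carrier L. s i = gam i +>\<^bsub>L\<^esub> a"
    using s(1) nonassoc_quotient.Quot_carrier [OF lower_central_quotient] by blast
  then obtain a where a: "\<And>i. a i \<in> carrier L" "\<And>i. s i = gam i +>\<^bsub>L\<^esub> a i" by metis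
  have "gam i +>\<^bsub>L\<^esub> a (Suc i) = gam i +>\<^bsub>L\<^esub> a i" for i
    using s(2) [of i] transition [OF a(1)] a(2) by metis
  then have "coherent a"
    using a(1) nonassoc_quotient.cls_eq_iff [OF lower_central_quotient] by (auto simp: coherent_def)
  moreover have "s = lim a" using a(2) by (auto simp: lim_def)
  ultimately show "s \<in> lim ` Collect coherent" by blast
next
  fix s assume "s \<in> lim ` Collect coherent"
  then obtain a where a: "coherent a" "s = lim a" by blast
  have "gam i <+>\<^bsub>L\<^esub> (gam (Suc i) +>\<^bsub>L\<^esub> a (Suc i)) = gam i +>\<^bsub>L\<^esub> a i" for i
    using a(1) nonassoc_quotient.cls_eq_iff [OF lower_central_quotient] transition
    by (auto simp: coherent_def)
  then show "s \<in> carrier C"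
    using coherent_closed [OF a(1)] nonassoc_quotient.Quot_carrier [OF lower_central_quotient]
    by (simp add: pronilpotent_completion_def a(2) lim_def)
qed

lemma lim_closed: "coherent a \<Longrightarrow> lim a \<in> carrier C"
  by (simp add: C_carrier)

lemma lim_eq_iff:
  assumes "coherent a" "coherent b"
  shows "lim a = lim b \<longleftrightarrow> (\<forall>i. a i \<ominus> b i \<in> gam i)"
  using assms coherent_closed nonassoc_quotient.cls_eq_iff [OF lower_central_quotient]
  by (auto simp: lim_def fun_eq_iff)

lemma coherent_const: "x \<in> carrier L \<Longrightarrow> coherent (\<lambda>_. x)"
  using nonassoc_quotient.I_zero [OF lower_central_quotient] by (simp add: coherent_def minus_eq r_neg)

lemma coherent_add:
  assumes "coherent a" "coherent b"
  shows "coherent (\<lambda>i. a i \<oplus> b i)"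
proof -
  have "a (Suc i) \<oplus> b (Suc i) \<ominus> (a i \<oplus> b i) = (a (Suc i) \<ominus> a i) \<oplus> (b (Suc i) \<ominus> b i)" for i
    using coherent_closed [OF assms(1)] coherent_closed [OF assms(2)]
    by (simp add: minus_eq minus_add a_ac)
  then show ?thesis
    using assms nonassoc_quotient.I_add [OF lower_central_quotient] by (simp add: coherent_def)
qed

lemma coherent_mult:
  assumes "coherent a" "coherent b"
  shows "coherent (\<lambda>i. a i \<otimes> b i)"
proof -
  have "a (Suc i) \<otimes> b (Suc i) \<ominus> a i \<otimes> b i \<in> gam i" for i
  proof -
    interpret G: nonassoc_quotient L "gam i" by (rule lower_central_quotient)
    have c: "a i \<in> carrier L" "a (Suc i) \<in> carrier L" "b i \<in> carrier L" "b (Suc i) \<in> carrier L"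
      using coherent_closed assms by auto
    have eq: "gam i +>\<^bsub>L\<^esub> a (Suc i) = gam i +>\<^bsub>L\<^esub> a i" "gam i +>\<^bsub>L\<^esub> b (Suc i) = gam i +>\<^bsub>L\<^esub> b i"
      using assms c by (auto simp: G.cls_eq_iff coherent_def)
    have "gam i +>\<^bsub>L\<^esub> (a (Suc i) \<otimes> b (Suc i)) = gam i +>\<^bsub>L\<^esub> (a i \<otimes> b i)"
      using G.cls_mult [OF c(2,4)] G.cls_mult [OF c(1,3)] eq by simp
    then show ?thesis using c prod_closed by (simp add: G.cls_eq_iff)
  qed
  then show ?thesis using coherent_closed assms by (simp add: coherent_def prod_closed)
qed

lemma coherent_uminus:
  assumes "coherent a"
  shows "coherent (\<lambda>i. \<ominus> a i)"
proof -
  have "\<ominus> a (Suc i) \<ominus> (\<ominus> a i) = \<ominus> (a (Suc i) \<ominus> a i)" for i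
    using coherent_closed [OF assms] by (simp add: minus_eq minus_add)
  then show ?thesis
    using assms nonassoc_quotient.I_uminus [OF lower_central_quotient] by (simp add: coherent_def)
qed

lemma lim_add:
  assumes "coherent a" "coherent b"
  shows "lim a \<oplus>\<^bsub>C\<^esub> lim b = lim (\<lambda>i. a i \<oplus> b i)"
  using assms coherent_closed nonassoc_quotient.cls_add [OF lower_central_quotient]
  by (auto simp: pronilpotent_completion_def lim_def nonassoc_quotient.Quot_simps [OF lower_central_quotient])

lemma lim_mult:
  assumes "coherent a" "coherent b"
  shows "lim a \<otimes>\<^bsub>C\<^esub> lim b = lim (\<lambda>i. a i \<otimes> b i)"
  using assms coherent_closed nonassoc_quotient.cls_mult [OF lower_central_quotient]
  by (auto simp: pronilpotent_completion_def lim_def nonassoc_quotient.Quot_simps [OF lower_central_quotient])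

lemma C_zero: "\<zero>\<^bsub>C\<^esub> = lim (\<lambda>_. \<zero>)"
  using nonassoc_quotient.cls_zero [OF lower_central_quotient]
  by (auto simp: pronilpotent_completion_def lim_def nonassoc_quotient.Quot_simps [OF lower_central_quotient])

lemma C_anticomm_ring: "anticomm_ring C"
proof -
  have z: "coherent (\<lambda>_. \<zero>)" by (rule coherent_const) simp
  have "abelian_group C"
  proof (rule abelian_groupI, goal_cases)
    case (6 x)
    then obtain a where a: "coherent a" "x = lim a" by (auto simp: C_carrier)
    then show ?case using coherent_uminus [OF a(1)] coherent_closed [OF a(1)]
      by (intro bexI [of _ "lim (\<lambda>i. \<ominus> a i)"] lim_closed) (simp_all add: lim_add C_zero l_neg)
  next
    case (3 x y z)
    then show ?case using coherent_closed by (auto simp: C_carrier lim_add coherent_add a_assoc)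
  next
    case (4 x y)
    then obtain a b where "coherent a" "x = lim a" "coherent b" "y = lim b" by (auto simp: C_carrier)
    moreover have "(\<lambda>i. a i \<oplus> b i) = (\<lambda>i. b i \<oplus> a i)"
      using calculation coherent_closed by (auto simp: a_comm)
    ultimately show ?case by (simp add: lim_add)
  next
    case (5 x)
    then show ?case using coherent_closed z by (auto simp: C_carrier lim_add C_zero)
  qed (auto simp: C_carrier lim_add C_zero coherent_add z)
  moreover have "nonassoc_ring_axioms C"
  proof (rule nonassoc_ring_axioms.intro, goal_cases)
    case (1 x y)
    then show ?case by (auto simp: C_carrier lim_mult coherent_mult)
  next
    case (2 x y z)
    then show ?case using coherent_closed
      by (auto simp: C_carrier lim_mult lim_add coherent_mult coherent_add prod_add_left)
  next
    case (3 x y z)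
    then show ?case using coherent_closed
      by (auto simp: C_carrier lim_mult lim_add coherent_mult coherent_add prod_add_right)
  qed
  ultimately interpret C: nonassoc_ring C by (rule nonassoc_ring.intro)
  show ?thesis
  proof
    fix x y assume "x \<in> carrier C" "y \<in> carrier C"
    then obtain a b where ab: "coherent a" "x = lim a" "coherent b" "y = lim b" by (auto simp: C_carrier)
    have ba: "coherent (\<lambda>i. b i \<otimes> a i)" "coherent (\<lambda>i. a i \<otimes> b i)" using ab coherent_mult by auto
    have "(\<lambda>i. a i \<otimes> b i \<oplus> b i \<otimes> a i) = (\<lambda>_. \<zero>)"
    proof
      fix i
      have "a i \<in> carrier L" "b i \<in> carrier L" using ab coherent_closed by auto
      then show "a i \<otimes> b i \<oplus> b i \<otimes> a i = \<zero>"
        using bracket_anticomm [of "a i" "b i"] by (simp add: prod_closed l_neg)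
    qed
    then have "(x \<otimes>\<^bsub>C\<^esub> y) \<oplus>\<^bsub>C\<^esub> (y \<otimes>\<^bsub>C\<^esub> x) = \<zero>\<^bsub>C\<^esub>"
      using ab ba by (simp add: lim_mult lim_add C_zero)
    then show "x \<otimes>\<^bsub>C\<^esub> y = \<ominus>\<^bsub>C\<^esub> (y \<otimes>\<^bsub>C\<^esub> x)"
      using C.minus_equality [of "x \<otimes>\<^bsub>C\<^esub> y" "y \<otimes>\<^bsub>C\<^esub> x"] ab ba by (simp add: lim_mult lim_closed)
  qed
qed

text \<open>Terms that lie deeper and deeper in the lower central series can be summed in the completion.\<close>

primrec psum :: "(nat \<Rightarrow> 'a) \<Rightarrow> nat \<Rightarrow> 'a" where
  "psum t 0 = \<zero>"
| "psum t (Suc n) = psum t n \<oplus> t n"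

lemma psum_closed: "(\<And>i. t i \<in> carrier L) \<Longrightarrow> psum t n \<in> carrier L"
  by (induction n) auto

lemma coherent_psum:
  assumes "\<And>i. t i \<in> gam i"
  shows "coherent (psum t)"
proof -
  have tc: "t i \<in> carrier L" for i
    using nonassoc_quotient.I_closed [OF lower_central_quotient assms] .
  have "psum t i \<oplus> t i \<ominus> psum t i = t i" for i
    using psum_closed [of t i] tc by (simp add: minus_eq a_ac r_neg r_neg1 r_neg2)
  then show ?thesis using assms psum_closed tc by (simp add: coherent_def)
qed

end

section \<open>Matrices of finite rank\<close>

type_synonym matrix = "nat \<Rightarrow> nat \<Rightarrow> real"

definition finite_rank :: "matrix set" where
  "finite_rank = {m. \<exists>n U V. m = (\<lambda>i j. \<Sum>r<n::nat. U r i * V r j)}"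

lemma finite_rank_zero: "(\<lambda>i j. 0) \<in> finite_rank"
  unfolding finite_rank_def by (intro CollectI exI [of _ 0]) simp

lemma finite_rank_add_rank_one:
  assumes "m \<in> finite_rank"
  shows "(\<lambda>i j. m i j + u i * v j) \<in> finite_rank"
proof -
  obtain n U V where m: "m = (\<lambda>i j. \<Sum>r<n::nat. U r i * V r j)"
    using assms unfolding finite_rank_def by blast
  have "(\<lambda>i j. m i j + u i * v j) = (\<lambda>i j. \<Sum>r<Suc n. (U(n := u)) r i * (V(n := v)) r j)"
    unfolding m by (auto simp: fun_eq_iff)
  then show ?thesis unfolding finite_rank_def by blast
qed

lemma finite_rank_induct [consumes 1, case_names zero step]:
  assumes "m \<in> finite_rank" and 0: "Q (\<lambda>i j. 0)"
    and s: "\<And>m u v. \<lbrakk>m \<in> finite_rank; Q m\<rbrakk> \<Longrightarrow> Q (\<lambda>i j. m i j + u i * v j)"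
  shows "Q m"
proof -
  obtain n U V where m: "m = (\<lambda>i j. \<Sum>r<n::nat. U r i * V r j)"
    using assms(1) unfolding finite_rank_def by blast
  have "Q (\<lambda>i j. \<Sum>r<n. U r i * V r j)"
  proof (induction n)
    case 0
    then show ?case using assms(2) by simp
  next
    case (Suc n)
    have "(\<lambda>i j. \<Sum>r<n. U r i * V r j) \<in> finite_rank" unfolding finite_rank_def by blast
    from s [OF this Suc, of "U n" "V n"] show ?case by simp
  qed
  then show ?thesis by (simp add: m)
qed

lemma finite_rank_one: "(\<lambda>i j. u i * v j) \<in> finite_rank"
  using finite_rank_add_rank_one [OF finite_rank_zero, of u v] by simp

lemma finite_rank_add:
  assumes "m \<in> finite_rank" "m' \<in> finite_rank"
  shows "(\<lambda>i j. m i j + m' i j) \<in> finite_rank"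
  using assms(2)
proof (induction m' rule: finite_rank_induct)
  case (step m' u v)
  then show ?case
    using finite_rank_add_rank_one [of "\<lambda>i j. m i j + m' i j" u v] by (simp add: add.assoc)
qed (simp add: assms(1))

lemma finite_rank_scale:
  "m \<in> finite_rank \<Longrightarrow> (\<lambda>i j. r * m i j) \<in> finite_rank"
proof (induction m rule: finite_rank_induct)
  case (step m u v)
  then show ?case
    using finite_rank_add_rank_one [of "\<lambda>i j. r * m i j" "\<lambda>i. r * u i" v]
    by (simp add: distrib_left mult.assoc)
qed (simp add: finite_rank_zero)

text \<open>Gaussian elimination: the equation \<open>U n\<close> is solved for an unknown \<open>k\<close> that occurs in it.\<close>

lemma nontrivial_solution:
  fixes U :: "nat \<Rightarrow> 'i \<Rightarrow> real"
  assumes "finite A" "n < card A"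
  shows "\<exists>c. (\<exists>i\<in>A. c i \<noteq> 0) \<and> (\<forall>r<n. (\<Sum>i\<in>A. c i * U r i) = 0)"
  using assms
proof (induction n arbitrary: A U)
  case 0
  then have "A \<noteq> {}" by auto
  then show ?case by (intro exI [of _ "\<lambda>_. 1"]) auto
next
  case (Suc n)
  show ?case
  proof (cases "\<exists>k\<in>A. U n k \<noteq> 0")
    case False
    then obtain c where "\<exists>i\<in>A. c i \<noteq> 0" "\<forall>r<n. (\<Sum>i\<in>A. c i * U r i) = 0"
      using Suc.IH [OF Suc.prems(1), of U] Suc.prems(2) by auto
    moreover have "(\<Sum>i\<in>A. c i * U n i) = 0" using False by (intro sum.neutral) auto
    ultimately show ?thesis by (auto simp: less_Suc_eq)
  next
    case True
    then obtain k where k: "k \<in> A" "U n k \<noteq> 0" by blast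
    let ?B = "A - {k}"
    have B: "finite ?B" "n < card ?B" using Suc.prems k(1) by auto
    obtain c where c: "\<exists>i\<in>?B. c i \<noteq> 0"
      "\<And>r. r < n \<Longrightarrow> (\<Sum>i\<in>?B. c i * (U r i - U r k * U n i / U n k)) = 0"
      using Suc.IH [OF B, of "\<lambda>r i. U r i - U r k * U n i / U n k"] by auto
    let ?d = "c(k := - (\<Sum>i\<in>?B. c i * U n i) / U n k)"
    have sum: "(\<Sum>i\<in>A. ?d i * U r i) = ?d k * U r k + (\<Sum>i\<in>?B. c i * U r i)" for r
      using Suc.prems(1) k(1) by (subst sum.remove [of A k]) auto
    have "(\<Sum>i\<in>A. ?d i * U r i) = 0" if "r < Suc n" for r
    proof (cases "r = n")
      case True
      then show ?thesis unfolding sum using k(2) by simp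
    next
      case False
      then have "r < n" using that by simp
      have "(\<Sum>i\<in>?B. c i * (U r i - U r k * U n i / U n k))
          = (\<Sum>i\<in>?B. c i * U r i) - U r k / U n k * (\<Sum>i\<in>?B. c i * U n i)"
        by (simp add: right_diff_distrib sum_subtractf sum_distrib_left ac_simps)
      then show ?thesis unfolding sum using c(2) [OF \<open>r < n\<close>] k(2) by (simp add: field_simps)
    qed
    moreover have "\<exists>i\<in>A. ?d i \<noteq> 0" using c(1) by auto
    ultimately show ?thesis by blast
  qed
qed

lemma finite_rank_rows_dependent:
  assumes "m \<in> finite_rank"
  shows "\<exists>n c. (\<exists>i\<le>n. c i \<noteq> 0) \<and> (\<forall>j. (\<Sum>i\<le>n::nat. c i * m (f i) j) = 0)"
proof -
  obtain n U V where m: "m = (\<lambda>i j. \<Sum>r<n::nat. U r i * V r j)"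
    using assms unfolding finite_rank_def by blast
  obtain c where c: "\<exists>i\<in>{..n}. c i \<noteq> 0" "\<And>r. r < n \<Longrightarrow> (\<Sum>i\<le>n. c i * U r (f i)) = 0"
    using nontrivial_solution [of "{..n}" n "\<lambda>r i. U r (f i)"] by auto
  have "(\<Sum>i\<le>n. c i * m (f i) j) = 0" for j
  proof -
    have "(\<Sum>i\<le>n. c i * m (f i) j) = (\<Sum>i\<le>n. \<Sum>r<n. c i * U r (f i) * V r j)"
      by (simp add: m sum_distrib_left mult.assoc)
    also have "\<dots> = (\<Sum>r<n. (\<Sum>i\<le>n. c i * U r (f i)) * V r j)"
      by (subst sum.swap) (simp add: sum_distrib_right)
    finally show ?thesis using c(2) by simp
  qed
  then show ?thesis using c(1) by auto
qed

text \<open>Extend a basis of the finite rank matrices by \<open>w\<close> and prescribe the values on it.\<close>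

lemma separating_functional:
  assumes "w \<notin> finite_rank"
  shows "\<exists>lam :: matrix \<Rightarrow> real. (\<forall>a b. lam (\<lambda>i j. a i j + b i j) = lam a + lam b)
    \<and> (\<forall>r a. lam (\<lambda>i j. r * a i j) = r * lam a) \<and> (\<forall>a\<in>finite_rank. lam a = 0) \<and> lam w = 1"
proof -
  let ?s = "\<lambda>(r::real) (a::matrix). (\<lambda>i j. r * a i j)"
  interpret V: vector_space ?s
    by unfold_locales (auto simp: fun_eq_iff algebra_simps)
  interpret VP: vector_space_pair ?s "(*) :: real \<Rightarrow> real \<Rightarrow> real"
    by unfold_locales (auto simp: algebra_simps)
  have sub: "V.subspace finite_rank"
    unfolding V.subspace_def
    using finite_rank_zero finite_rank_add finite_rank_scale
    by (simp add: zero_fun_def plus_fun_def)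
  obtain B where B: "B \<subseteq> finite_rank" "V.independent B" "finite_rank \<subseteq> V.span B"
    using V.maximal_independent_subset [of finite_rank] by blast
  have "w \<notin> V.span B" using assms V.span_minimal [OF B(1) sub] by blast
  then have "V.independent (insert w B)" using B(2) by (simp add: V.independent_insert)
  then obtain lam where lam: "Vector_Spaces.linear ?s (*) lam"
    "\<And>x. x \<in> insert w B \<Longrightarrow> lam x = (if x = w then 1 else 0)"
    using VP.linear_independent_extend [of "insert w B" "\<lambda>x. if x = w then 1 else 0"] by blast
  interpret lam: Vector_Spaces.linear ?s "(*) :: real \<Rightarrow> real \<Rightarrow> real" lam by (rule lam(1))
  have "lam b = 0" if "b \<in> B" for b
    using lam(2) [of b] that B(1) assms by auto
  then have "lam a = 0" if "a \<in> finite_rank" for a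
    using lam.eq_0_on_span [of B a] B(3) that by blast
  then show ?thesis
    using lam.add lam.scale lam(2) [of w] by (intro exI [of _ lam]) (simp add: plus_fun_def)
qed

definition power_of_two :: "nat \<Rightarrow> bool" where
  "power_of_two m \<longleftrightarrow> (\<exists>r. m = 2 ^ r)"

lemma power_of_two_gap:
  assumes "n < 2 ^ k" "i \<le> n" "i' \<le> n" "power_of_two ((2::nat) ^ Suc k - i' + i)"
  shows "i = i'"
proof (rule ccontr)
  assume ne: "i \<noteq> i'"
  obtain q where q: "(2::nat) ^ Suc k - i' + i = 2 ^ q" using assms(4) by (auto simp: power_of_two_def)
  have le: "i' \<le> 2 ^ Suc k" using assms by simp
  have eq: "2 ^ q + i' = 2 * 2 ^ k + i" using q le by simp
  consider "q < Suc k" | "q = Suc k" | "q > Suc k" by linarith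
  then show False
  proof cases
    case 1
    then have "(2::nat) ^ q \<le> 2 ^ k" by (simp add: power_increasing)
    then show False using eq assms(1-3) by linarith
  next
    case 2
    then show False using eq ne by simp
  next
    case 3
    then have "(2::nat) ^ Suc (Suc k) \<le> 2 ^ q" by (intro power_increasing) auto
    then have "4 * 2 ^ k \<le> (2::nat) ^ q" by simp
    then show False using eq assms(1-3) by linarith
  qed
qed

text \<open>The matrix of the class to be constructed. Up to signs its entries depend on \<open>a + b\<close> only, and the
  submatrix with even rows and odd columns is a Hankel matrix. Its sequence is supported on the
  powers of 2, and the value at \<open>m\<close> is \<open>2 ^ m\<close> in order to be divisible.\<close>

definition hankel :: matrix where
  "hankel a b = (if odd (a + b) then (- 1) ^ a * (let m = (a + b + 1) div 2 in
      if power_of_two m then 2 ^ m else 0) else 0)"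

text \<open>The gaps in the sequence become longer than any given number \<open>n\<close> of rows. In a column placed so that
  row \<open>k\<close> meets a far out power of 2, the other rows have entry 0, so a linear relation between the rows
  has coefficient 0 at \<open>k\<close>.\<close>

lemma hankel_infinite_rank: "hankel \<notin> finite_rank"
proof
  assume "hankel \<in> finite_rank"
  then obtain n c where c: "\<exists>i\<le>n. c i \<noteq> 0"
    "\<And>j. (\<Sum>i\<le>n::nat. c i * hankel (2 * i) j) = 0"
    using finite_rank_rows_dependent [of hankel "\<lambda>i. 2 * i"] by auto
  then obtain k where k: "k \<le> n" "c k \<noteq> 0" by blast
  have n: "n < 2 ^ n" by (rule less_exp)
  let ?l = "2 ^ Suc n - k - 1 :: nat"
  have "k + 1 \<le> 2 ^ n" using k(1) n by linarith
  then have kl: "k + 1 \<le> 2 ^ Suc n" by simp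
  have h: "hankel (2 * i) (2 * ?l + 1) = (if i = k then 2 ^ 2 ^ Suc n else 0)" if "i \<le> n" for i
  proof -
    have m: "(2 * i + (2 * ?l + 1) + 1) div 2 = 2 ^ Suc n - k + i" using kl by simp
    have p: "power_of_two (2 ^ Suc n - k + i) \<longleftrightarrow> i = k"
    proof
      show "power_of_two (2 ^ Suc n - k + i) \<Longrightarrow> i = k"
        by (rule power_of_two_gap [OF n that k(1)])
      show "i = k \<Longrightarrow> power_of_two (2 ^ Suc n - k + i)"
        using kl by (auto simp: power_of_two_def intro: exI [of _ "Suc n"])
    qed
    show ?thesis unfolding hankel_def Let_def m p using kl by auto
  qed
  have "(\<Sum>i\<le>n. c i * hankel (2 * i) (2 * ?l + 1)) = (\<Sum>i\<le>n. if i = k then c k * 2 ^ 2 ^ Suc n else 0)"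
  proof (rule sum.cong [OF refl])
    fix i assume "i \<in> {..n}"
    then show "c i * hankel (2 * i) (2 * ?l + 1) = (if i = k then c k * 2 ^ 2 ^ Suc n else 0)"
      unfolding h [of i, OF \<open>i \<in> {..n}\<close> [unfolded atMost_iff]] by simp
  qed
  also have "\<dots> = c k * 2 ^ 2 ^ Suc n" using k(1) by simp
  finally show False using c(2) [of "2 * ?l + 1"] k(2) by simp
qed

section \<open>A quotient of the free Lie ring\<close>

text \<open>Coordinates of the free Lie ring modulo brackets with three or more factors \<open>y\<close>. An element of the
  quotient consists of the coefficient of \<open>x\<close>, the coefficients of the iterated brackets \<open>y i\<close>, and a
  matrix in which \<open>[y i, y j]\<close> is the difference of two matrix units. The weight is the number of
  factors.\<close>

datatype coord = Px | Au nat | Ww nat nat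

primrec weight :: "coord \<Rightarrow> nat" where
  "weight Px = 1"
| "weight (Au i) = i + 1"
| "weight (Ww i j) = i + j + 2"

text \<open>The actions of \<open>[x, -]\<close>: with a power series in \<open>s\<close> for the \<open>y\<close>-part and one in \<open>s\<close> and \<open>t\<close> for the matrix,
  these are multiplication by \<open>s\<close> and by \<open>s + t\<close>.\<close>

definition shift1 :: "(nat \<Rightarrow> real) \<Rightarrow> nat \<Rightarrow> real" where
  "shift1 u i = (case i of 0 \<Rightarrow> 0 | Suc k \<Rightarrow> u k)"

definition shift2 :: "(nat \<Rightarrow> nat \<Rightarrow> real) \<Rightarrow> nat \<Rightarrow> nat \<Rightarrow> real" where
  "shift2 w i j = (case i of 0 \<Rightarrow> 0 | Suc k \<Rightarrow> w k j) + (case j of 0 \<Rightarrow> 0 | Suc k \<Rightarrow> w i k)"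

primrec br :: "(coord \<Rightarrow> real) \<Rightarrow> (coord \<Rightarrow> real) \<Rightarrow> coord \<Rightarrow> real" where
  "br a b Px = 0"
| "br a b (Au i) = a Px * shift1 (\<lambda>k. b (Au k)) i - b Px * shift1 (\<lambda>k. a (Au k)) i"
| "br a b (Ww i j) = a Px * shift2 (\<lambda>k l. b (Ww k l)) i j - b Px * shift2 (\<lambda>k l. a (Ww k l)) i j
    + a (Au i) * b (Au j) - b (Au i) * a (Au j)"

lemma br_self: "br a a = (\<lambda>_. 0)"
proof
  show "br a a i = 0" for i by (cases i) auto
qed

lemma br_linear_left: "br (\<lambda>i. r * c i + s * d i) b k = r * br c b k + s * br d b k"
  and br_linear_right: "br b (\<lambda>i. r * c i + s * d i) k = r * br b c k + s * br b d k"
  by (cases k; auto simp: shift1_def shift2_def algebra_simps split: nat.split)+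

lemma br_jacobi: "br a (br b c) k + br b (br c a) k + br c (br a b) k = 0"
  by (cases k) (auto simp: shift1_def shift2_def algebra_simps split: nat.split)

lemma br_cong:
  assumes "\<And>i. weight i \<le> weight k \<Longrightarrow> a i = a' i" "\<And>i. weight i \<le> weight k \<Longrightarrow> b i = b' i"
  shows "br a b k = br a' b' k"
proof -
  have "a Px = a' Px" "b Px = b' Px" by (cases k; intro assms; simp)+
  then show ?thesis using assms
    by (cases k) (auto simp: shift1_def shift2_def split: nat.split)
qed

text \<open>The coordinates define a graded Lie ring, so the terms of its lower central series have no
  coordinates of low weight.\<close>

lemma br_weight:
  assumes a: "\<And>i. weight i \<le> n \<Longrightarrow> a i = 0" and k: "weight k \<le> Suc n"
  shows "br a b k = 0"
proof (cases "n = 0")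
  case True
  then show ?thesis using k by (cases k) (auto simp: shift1_def)
next
  case False
  then have "a Px = 0" by (intro a) simp
  then show ?thesis using a k False
    by (cases k) (auto simp: shift1_def shift2_def split: nat.split)
qed

lemma br_lin_ext:
  "br (\<lambda>i. lin_ext (\<lambda>s. A s i) p) (\<lambda>i. lin_ext (\<lambda>t. B t i) q) k
    = lin_ext (\<lambda>s. lin_ext (\<lambda>t. br (A s) (B t) k) q) p"
proof -
  have "br (\<lambda>i. lin_ext (\<lambda>s. A s i) p) b k = lin_ext (\<lambda>s. br (A s) b k) p" for b
    by (rule linear_lin_ext [of "\<lambda>a. br a b k"]) (rule br_linear_left)
  moreover have "br a (\<lambda>i. lin_ext (\<lambda>t. B t i) q) k = lin_ext (\<lambda>t. br a (B t) k) q" for a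
    by (rule linear_lin_ext [of "\<lambda>b. br a b k"]) (rule br_linear_right)
  ultimately show ?thesis by simp
qed

primrec magma_eval :: "'x \<Rightarrow> 'x magma \<Rightarrow> coord \<Rightarrow> real" where
  "magma_eval xg (Gen z) = (\<lambda>k. of_bool (k = (if z = xg then Px else Au 0)))"
| "magma_eval xg (Mul s t) = br (magma_eval xg s) (magma_eval xg t)"

definition free_eval :: "'x \<Rightarrow> ('x magma \<Rightarrow>\<^sub>0 int) \<Rightarrow> coord \<Rightarrow> real" where
  "free_eval xg p i = lin_ext (\<lambda>t. magma_eval xg t i) p"

lemma free_eval_mult: "free_eval xg (bilin_ext Mul p q) = br (free_eval xg p) (free_eval xg q)"
  by (simp add: free_eval_def [abs_def] lin_ext_bilin_ext br_lin_ext fun_eq_iff)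

lemma free_eval_add: "free_eval xg (p + q) = (\<lambda>i. free_eval xg p i + free_eval xg q i)"
  and free_eval_diff: "free_eval xg (p - q) = (\<lambda>i. free_eval xg p i - free_eval xg q i)"
  and free_eval_uminus: "free_eval xg (- p) = (\<lambda>i. - free_eval xg p i)"
  and free_eval_0: "free_eval xg 0 = (\<lambda>_. 0)"
  by (auto simp: free_eval_def lin_ext_add lin_ext_diff lin_ext_uminus)

lemma free_nonassoc_ring_simps [simp]:
  "p \<in> carrier (free_nonassoc_ring S) \<longleftrightarrow> Poly_Mapping.keys p \<subseteq> {t. set_magma t \<subseteq> S}"
  "monoid.mult (free_nonassoc_ring S) = bilin_ext Mul"
  "ring.zero (free_nonassoc_ring S) = 0" "add (free_nonassoc_ring S) = (+)"
  by (auto simp: free_nonassoc_ring_def bilin_ext_def fun_eq_iff)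

lemma free_nonassoc_ring: "nonassoc_ring (free_nonassoc_ring S)"
proof (rule nonassoc_ring.intro)
  show "abelian_group (free_nonassoc_ring S)"
  proof (rule abelian_groupI, goal_cases)
    case (6 x)
    then show ?case by (intro bexI [of _ "- x"]) auto
  next
    case (1 x y)
    then show ?case using Poly_Mapping.keys_add [of x y] by auto
  qed (simp_all add: add_ac)
  show "nonassoc_ring_axioms (free_nonassoc_ring S)"
  proof (rule nonassoc_ring_axioms.intro)
    fix x y assume xy: "x \<in> carrier (free_nonassoc_ring S)" "y \<in> carrier (free_nonassoc_ring S)"
    show "x \<otimes>\<^bsub>free_nonassoc_ring S\<^esub> y \<in> carrier (free_nonassoc_ring S)"
      unfolding free_nonassoc_ring_simps
    proof
      fix z assume "z \<in> Poly_Mapping.keys (bilin_ext Mul x y)"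
      then obtain s t where "s \<in> Poly_Mapping.keys x" "t \<in> Poly_Mapping.keys y" "z = Mul s t"
        using keys_bilin_ext [of Mul x y] by blast
      then show "z \<in> {t. set_magma t \<subseteq> S}" using xy by auto
    qed
  qed (simp_all add: bilin_ext_add_left bilin_ext_add_right)
qed

locale free_lie =
  fixes S :: "'x set" and xg yg :: 'x
  assumes xg: "xg \<in> S" and yg: "yg \<in> S" and xyg: "xg \<noteq> yg"
begin

abbreviation N where "N \<equiv> free_nonassoc_ring S"
abbreviation f where "f \<equiv> free_lie_ring S"

sublocale N: nonassoc_ring N
  by (rule free_nonassoc_ring)

sublocale NI: nonassoc_quotient N "lie_ideal N"
  by unfold_locales (rule N.lie_ideal_ideal)

lemma f_def: "f = N Quot lie_ideal N"
  by (simp add: free_lie_ring_def)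

sublocale f: lie_ring f
  unfolding f_def by (rule N.lie_quotient)

lemma N_uminus: "p \<in> carrier N \<Longrightarrow> \<ominus>\<^bsub>N\<^esub> p = - p"
  by (rule N.minus_equality) auto

lemma lie_ideal_eval: "p \<in> lie_ideal N \<Longrightarrow> free_eval xg p = (\<lambda>_. 0)"
proof -
  let ?K = "{p \<in> carrier N. free_eval xg p = (\<lambda>_. 0)}"
  have br0: "br (\<lambda>_. 0) b = (\<lambda>_. 0)" "br b (\<lambda>_. 0) = (\<lambda>_. 0)" for b
    using br_linear_left [of 0 "\<lambda>_. 0" 0 "\<lambda>_. 0" b] br_linear_right [of b 0 "\<lambda>_. 0" 0 "\<lambda>_. 0"]
    by auto
  have "nonassoc_ideal ?K N"
    unfolding nonassoc_ideal_def
  proof (intro conjI ballI N.additive_subgroupI)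
    show "a \<oplus>\<^bsub>N\<^esub> b \<in> ?K" if "a \<in> ?K" "b \<in> ?K" for a b
      using that N.add.m_closed [of a b] by (simp add: free_eval_add)
    show "\<ominus>\<^bsub>N\<^esub> a \<in> ?K" if "a \<in> ?K" for a
      using that N_uminus [of a] by (simp add: free_eval_uminus)
    show "a \<otimes>\<^bsub>N\<^esub> r \<in> ?K" "r \<otimes>\<^bsub>N\<^esub> a \<in> ?K" if "a \<in> ?K" "r \<in> carrier N" for a r
      using that N.prod_closed [of a r] N.prod_closed [of r a] by (simp_all add: free_eval_mult br0)
  qed (auto simp: free_eval_0)
  moreover have "free_eval xg p = (\<lambda>_. 0)" if "p \<in> lie_relators N" for p
    using that unfolding lie_relators_def
    by (auto simp: free_eval_mult br_self free_eval_add br_jacobi fun_eq_iff)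
  then have "lie_relators N \<subseteq> ?K" using N.lie_relators_closed by blast
  ultimately show "p \<in> lie_ideal N \<Longrightarrow> free_eval xg p = (\<lambda>_. 0)"
    using N.lie_ideal_minimal by blast
qed

definition lie_eval :: "('x magma \<Rightarrow>\<^sub>0 int) set \<Rightarrow> coord \<Rightarrow> real" where
  "lie_eval c = free_eval xg (SOME p. p \<in> c)"

lemma lie_eval_cls:
  assumes "p \<in> carrier N"
  shows "lie_eval (NI.cls p) = free_eval xg p"
proof -
  let ?q = "SOME q. q \<in> NI.cls p"
  have "?q \<in> NI.cls p" using NI.cls_self [OF assms] by (rule someI)
  then have q: "?q \<in> carrier N" "?q \<ominus>\<^bsub>N\<^esub> p \<in> lie_ideal N" using NI.cls_mem_iff [OF assms] by auto
  have "free_eval xg (?q - p) = (\<lambda>_. 0)"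
    using lie_ideal_eval [OF q(2)] N_uminus [OF assms] by (simp add: N.minus_eq)
  then show ?thesis by (simp add: lie_eval_def free_eval_diff fun_eq_iff)
qed

lemma f_cases:
  assumes "a \<in> carrier f"
  obtains p where "p \<in> carrier N" "a = NI.cls p"
  using assms unfolding f_def NI.Quot_carrier by auto

lemma lie_eval_add:
  assumes "a \<in> carrier f" "b \<in> carrier f"
  shows "lie_eval (a \<oplus>\<^bsub>f\<^esub> b) = (\<lambda>i. lie_eval a i + lie_eval b i)"
proof -
  obtain p where p: "p \<in> carrier N" "a = NI.cls p" using assms(1) by (rule f_cases)
  obtain q where q: "q \<in> carrier N" "b = NI.cls q" using assms(2) by (rule f_cases)
  have "a \<oplus>\<^bsub>f\<^esub> b = NI.cls (p \<oplus>\<^bsub>N\<^esub> q)"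
    unfolding f_def p(2) q(2) NI.Quot_simps by (rule NI.cls_add [OF p(1) q(1)])
  then show ?thesis
    using lie_eval_cls [OF N.add.m_closed [OF p(1) q(1)]] lie_eval_cls [OF p(1)] lie_eval_cls [OF q(1)]
    by (simp add: p(2) q(2) free_eval_add)
qed

lemma lie_eval_mult:
  assumes "a \<in> carrier f" "b \<in> carrier f"
  shows "lie_eval (a \<otimes>\<^bsub>f\<^esub> b) = br (lie_eval a) (lie_eval b)"
proof -
  obtain p where p: "p \<in> carrier N" "a = NI.cls p" using assms(1) by (rule f_cases)
  obtain q where q: "q \<in> carrier N" "b = NI.cls q" using assms(2) by (rule f_cases)
  have "a \<otimes>\<^bsub>f\<^esub> b = NI.cls (p \<otimes>\<^bsub>N\<^esub> q)"
    unfolding f_def p(2) q(2) NI.Quot_simps by (rule NI.cls_mult [OF p(1) q(1)])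
  then show ?thesis
    using lie_eval_cls [OF N.prod_closed [OF p(1) q(1)]] lie_eval_cls [OF p(1)] lie_eval_cls [OF q(1)]
    by (simp add: p(2) q(2) free_eval_mult)
qed

lemma lie_eval_zero: "lie_eval \<zero>\<^bsub>f\<^esub> i = 0"
  using fun_cong [OF lie_eval_add [OF f.zero_closed f.zero_closed], of i] by simp

lemma lie_eval_uminus: "a \<in> carrier f \<Longrightarrow> lie_eval (\<ominus>\<^bsub>f\<^esub> a) i = - lie_eval a i"
  using fun_cong [OF lie_eval_add [of a "\<ominus>\<^bsub>f\<^esub> a"], of i] by (simp add: f.r_neg lie_eval_zero)

lemma lie_eval_diff:
  "\<lbrakk>a \<in> carrier f; b \<in> carrier f\<rbrakk> \<Longrightarrow> lie_eval (a \<ominus>\<^bsub>f\<^esub> b) i = lie_eval a i - lie_eval b i"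
  by (simp add: a_minus_def lie_eval_add lie_eval_uminus)

lemma lie_eval_lower_central:
  "\<lbrakk>a \<in> f.gam n; weight i \<le> n\<rbrakk> \<Longrightarrow> lie_eval a i = 0"
proof (induction n arbitrary: a i)
  case 0
  then show ?case by (cases i) auto
next
  case (Suc n)
  let ?X = "{x \<otimes>\<^bsub>f\<^esub> y | x y. x \<in> f.gam n \<and> y \<in> carrier f}"
  have gc: "x \<in> carrier f" if "x \<in> f.gam n" for x
    using nonassoc_quotient.I_closed [OF f.lower_central_quotient that] .
  have Xc: "?X \<subseteq> carrier f" using gc f.prod_closed by auto
  have xg: "lie_eval z i = 0" if "z \<in> ?X" for z
  proof -
    obtain x y where z: "z = x \<otimes>\<^bsub>f\<^esub> y" "x \<in> f.gam n" "y \<in> carrier f" using \<open>z \<in> ?X\<close> by blast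
    show ?thesis unfolding z(1) lie_eval_mult [OF gc [OF z(2)] z(3)]
      by (rule br_weight [OF Suc.IH [OF z(2)] Suc.prems(2)])
  qed
  have "a \<in> generate (add_monoid f) ?X" using Suc.prems(1) by simp
  then have "a \<in> carrier f \<and> lie_eval a i = 0"
  proof (induction rule: generate.induct)
    case one
    then show ?case using lie_eval_zero by simp
  next
    case (incl h)
    then show ?case using xg Xc by blast
  next
    case (inv h)
    have "h \<in> carrier f" "lie_eval h i = 0" using xg [OF inv] Xc inv by auto
    then show ?case unfolding a_inv_def [symmetric] using lie_eval_uminus [of h i] by simp
  next
    case (eng h1 h2)
    then show ?case by (simp add: lie_eval_add)
  qed
  then show ?case by simp
qed

text \<open>A coordinate of weight \<open>n\<close> is determined modulo the term with index \<open>n\<close> of the lower central series, so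
  it makes sense on the completion.\<close>

definition hat_eval :: "(nat \<Rightarrow> ('x magma \<Rightarrow>\<^sub>0 int) set set) \<Rightarrow> coord \<Rightarrow> real" where
  "hat_eval s i = lie_eval (SOME a. a \<in> s (weight i)) i"

lemma hat_eval_lim:
  assumes a: "f.coherent a" and n: "weight i \<le> n"
  shows "hat_eval (f.lim a) i = lie_eval (a n) i"
proof -
  have ac: "a k \<in> carrier f" for k using f.coherent_closed [OF a] .
  have step: "lie_eval (a (Suc k)) i = lie_eval (a k) i" if "weight i \<le> k" for k
    using lie_eval_lower_central [of "a (Suc k) \<ominus>\<^bsub>f\<^esub> a k" k i] a that ac
    by (simp add: f.coherent_def lie_eval_diff)
  have e: "lie_eval (a n) i = lie_eval (a (weight i)) i"
    using n by (induction n rule: dec_induct) (simp_all add: step)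
  interpret G: nonassoc_quotient f "f.gam (weight i)" by (rule f.lower_central_quotient)
  let ?b = "SOME b. b \<in> G.cls (a (weight i))"
  have "?b \<in> G.cls (a (weight i))" using G.cls_self [OF ac] by (rule someI)
  then have b: "?b \<in> carrier f" "?b \<ominus>\<^bsub>f\<^esub> a (weight i) \<in> f.gam (weight i)"
    using G.cls_mem_iff [OF ac] by auto
  have "lie_eval ?b i = lie_eval (a (weight i)) i"
    using lie_eval_lower_central [OF b(2), of i] b(1) ac by (simp add: lie_eval_diff)
  then show ?thesis by (simp add: hat_eval_def f.lim_def e)
qed

lemma hat_eval_add:
  assumes "s \<in> carrier f.C" "t \<in> carrier f.C"
  shows "hat_eval (s \<oplus>\<^bsub>f.C\<^esub> t) i = hat_eval s i + hat_eval t i"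
proof -
  obtain a b where ab: "f.coherent a" "s = f.lim a" "f.coherent b" "t = f.lim b"
    using assms by (auto simp: f.C_carrier)
  show ?thesis
    using ab hat_eval_lim [OF ab(1) order.refl] hat_eval_lim [OF ab(3) order.refl]
      hat_eval_lim [OF f.coherent_add [OF ab(1,3)] order.refl] f.coherent_closed
    by (simp add: f.lim_add lie_eval_add)
qed

lemma hat_eval_mult:
  assumes "s \<in> carrier f.C" "t \<in> carrier f.C"
  shows "hat_eval (s \<otimes>\<^bsub>f.C\<^esub> t) i = br (hat_eval s) (hat_eval t) i"
proof -
  obtain a b where ab: "f.coherent a" "s = f.lim a" "f.coherent b" "t = f.lim b"
    using assms by (auto simp: f.C_carrier)
  have "br (lie_eval (a (weight i))) (lie_eval (b (weight i))) i = br (hat_eval s) (hat_eval t) i"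
    using ab hat_eval_lim by (intro br_cong) auto
  then show ?thesis
    using ab hat_eval_lim [OF f.coherent_mult [OF ab(1,3)] order.refl] f.coherent_closed
    by (simp add: f.lim_mult lie_eval_mult)
qed

end

section \<open>The divisible class\<close>

text \<open>The coefficients of the class (for \<open>k = 0\<close>), and the result of dividing them by \<open>2 ^ k\<close> after removing
  the finitely many that are not divisible.\<close>

definition coefficient :: "nat \<Rightarrow> nat \<Rightarrow> nat" where
  "coefficient k m = (if k \<le> m \<and> power_of_two m then 2 ^ (m - k) else 0)"

lemma coefficient_step:
  "coefficient k m = 2 * coefficient (Suc k) m + (if m = k then of_bool (power_of_two k) else 0)"
proof (cases "Suc k \<le> m")
  case True
  then have "m - k = Suc (m - Suc k)" by simp
  then show ?thesis using True by (simp add: coefficient_def)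
next
  case False
  then show ?thesis by (auto simp: coefficient_def)
qed

lemma (in ring) double_identity:
  assumes "a \<in> carrier R" "b \<in> carrier R" "c \<in> carrier R" "d \<in> carrier R"
  shows "((a \<oplus> a) \<oplus> b) \<ominus> ((c \<oplus> c) \<oplus> d) = ((a \<ominus> c) \<oplus> (a \<ominus> c)) \<oplus> (b \<ominus> d)"
  using assms by algebra

context lie_ring
begin

sublocale C: anticomm_ring C
  by (rule C_anticomm_ring)

abbreviation multiple :: "nat \<Rightarrow> 'a \<Rightarrow> 'a" where "multiple n a \<equiv> add_pow L n a"

lemma prod_multiple_right:
  "\<lbrakk>a \<in> carrier L; b \<in> carrier L\<rbrakk> \<Longrightarrow> a \<otimes> (multiple n b) = multiple n (a \<otimes> b)"
  by (induction n) (simp_all add: prod_add_right prod_closed)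

lemma multiple_gam: "a \<in> gam i \<Longrightarrow> multiple n a \<in> gam i"
proof (induction n)
  case 0
  then show ?case using nonassoc_quotient.I_zero [OF lower_central_quotient] by simp
next
  case (Suc n)
  then show ?case using nonassoc_quotient.I_add [OF lower_central_quotient] by simp
qed

lemma bracket_primitive:
  assumes x: "x \<in> carrier L" and y: "y \<in> carrier L"
  shows "x \<otimes> primitive x y m j = iter_bracket x y j \<otimes> iter_bracket x y (j + 2 * m)"
proof (induction m arbitrary: j)
  case 0
  show ?case using x iter_bracket_closed [OF x y] by (simp add: bracket_self)
next
  case (Suc m)
  let ?y = "iter_bracket x y"
  have yc: "?y n \<in> carrier L" for n by (rule iter_bracket_closed [OF x y])
  have "x \<otimes> primitive x y (Suc m) j
      = x \<otimes> (?y j \<otimes> ?y (j + 2 * m + 1)) \<ominus> x \<otimes> primitive x y m (Suc j)"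
    unfolding primitive.simps by (intro prod_diff_right x prod_closed yc primitive_closed y)
  also have "\<dots> = (?y (Suc j) \<otimes> ?y (j + 2 * m + 1) \<oplus> ?y j \<otimes> ?y (j + 2 * m + 2))
      \<ominus> ?y (Suc j) \<otimes> ?y (Suc j + 2 * m)"
    unfolding Suc ad_leibniz [OF x yc yc] by simp
  also have "\<dots> = ?y j \<otimes> ?y (j + 2 * Suc m)"
    using yc [of "Suc j"] yc [of "j + 2 * m + 1"] yc [of j] yc [of "j + 2 * m + 2"]
    by (simp add: minus_eq a_ac prod_closed r_neg1 r_neg2 r_neg del: iter_bracket.simps)
  finally show ?case .
qed

lemma iter_bracket_gam:
  assumes x: "x \<in> carrier L" and y: "y \<in> carrier L"
  shows "iter_bracket x y n \<in> gam n"
proof (induction n)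
  case 0
  then show ?case using y by simp
next
  case (Suc n)
  have "iter_bracket x y n \<otimes> x \<in> gam (Suc n)" by (rule lower_central_bracket [OF Suc x])
  then show ?case
    using bracket_anticomm [OF x iter_bracket_closed [OF x y]]
      nonassoc_quotient.I_uminus [OF lower_central_quotient] by (simp del: lower_central.simps)
qed

lemma primitive_gam:
  assumes x: "x \<in> carrier L" and y: "y \<in> carrier L"
  shows "primitive x y m j \<in> gam (j + m)"
proof (induction m arbitrary: j)
  case 0
  show ?case using nonassoc_quotient.I_zero [OF lower_central_quotient] by simp
next
  case (Suc m)
  interpret G: nonassoc_quotient L "gam (j + Suc m)" by (rule lower_central_quotient)
  have "iter_bracket x y (j + 2 * m + 1) \<in> gam (j + Suc m)"
    using iter_bracket_gam [OF x y, of "j + 2 * m + 1"] lower_central_antimono [of "j + Suc m" "j + 2 * m + 1"]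
    by auto
  then have "iter_bracket x y j \<otimes> iter_bracket x y (j + 2 * m + 1) \<in> gam (j + Suc m)"
    by (rule G.I_mult(2) [OF _ iter_bracket_closed [OF x y]])
  moreover have "primitive x y m (Suc j) \<in> gam (j + Suc m)" using Suc [of "Suc j"] by simp
  ultimately show ?case unfolding primitive.simps minus_eq by (intro G.I_add G.I_uminus)
qed

definition series :: "(nat \<Rightarrow> nat) \<Rightarrow> (nat \<Rightarrow> 'a) \<Rightarrow> nat \<Rightarrow> 'a" where
  "series g u = psum (\<lambda>m. multiple (g m) (u m))"

lemma coherent_series: "(\<And>m. u m \<in> gam m) \<Longrightarrow> coherent (series g u)"
  unfolding series_def by (intro coherent_psum multiple_gam)

lemma series_double:
  assumes u: "\<And>m. u m \<in> gam m" and g: "\<And>m. g m = 2 * g' m + (if m = k then e else 0)"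
  shows "lim (series g u) = (lim (series g' u) \<oplus>\<^bsub>C\<^esub> lim (series g' u)) \<oplus>\<^bsub>C\<^esub> lim (\<lambda>_. multiple e (u k))"
proof -
  have uc: "u m \<in> carrier L" for m
    using nonassoc_quotient.I_closed [OF lower_central_quotient u] .
  have sc: "series h u n \<in> carrier L" for h n
    unfolding series_def by (rule psum_closed) (simp add: uc)
  have ec: "multiple e (u k) \<in> carrier L" using uc by simp
  have eq: "series g u n = (series g' u n \<oplus> series g' u n) \<oplus> (if k < n then multiple e (u k) else \<zero>)" for n
  proof (induction n)
    case (Suc n)
    have gn: "multiple (g n) (u n) = (multiple (g' n) (u n) \<oplus> multiple (g' n) (u n)) \<oplus> (if n = k then multiple e (u k) else \<zero>)"
      using uc by (simp add: g mult_2 add.nat_pow_mult [symmetric])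
    have "series h u (Suc n) = series h u n \<oplus> multiple (h n) (u n)" for h by (simp add: series_def)
    then show ?case
      using Suc uc sc by (auto simp: gn a_ac less_Suc_eq)
  qed (simp add: series_def)
  have coh: "coherent (series h u)" for h by (rule coherent_series [OF u])
  have coh2: "coherent (\<lambda>i. (series g' u i \<oplus> series g' u i) \<oplus> multiple e (u k))"
    by (intro coherent_add coh coherent_const ec)
  have "series g u n \<ominus> ((series g' u n \<oplus> series g' u n) \<oplus> multiple e (u k)) \<in> gam n" for n
  proof -
    interpret G: nonassoc_quotient L "gam n" by (rule lower_central_quotient)
    show ?thesis
    proof (cases "k < n")
      case True
      then show ?thesis using eq [of n] sc uc G.I_zero by (simp add: minus_eq r_neg)
    next
      case False
      then have "multiple e (u k) \<in> gam n"
        using multiple_gam [OF u [of k]] lower_central_antimono [of n k] by auto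
      moreover have "series g u n \<ominus> ((series g' u n \<oplus> series g' u n) \<oplus> multiple e (u k)) = \<ominus> (multiple e (u k))"
        using False eq [of n] sc [of g' n] ec
        by (simp add: minus_eq minus_add a_ac r_neg r_neg1 r_neg2)
      ultimately show ?thesis using G.I_uminus by simp
    qed
  qed
  then have "lim (series g u) = lim (\<lambda>i. (series g' u i \<oplus> series g' u i) \<oplus> multiple e (u k))"
    using lim_eq_iff [OF coh coh2] by blast
  also have "\<dots> = (lim (series g' u) \<oplus>\<^bsub>C\<^esub> lim (series g' u)) \<oplus>\<^bsub>C\<^esub> lim (\<lambda>_. multiple e (u k))"
    by (simp add: lim_add coh coherent_add coherent_const ec)
  finally show ?thesis .
qed

abbreviation const where "const a \<equiv> lim (\<lambda>_. a)"

lemma const_closed: "a \<in> carrier L \<Longrightarrow> const a \<in> carrier C"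
  by (intro lim_closed coherent_const)

lemma const_mult:
  "\<lbrakk>a \<in> carrier L; b \<in> carrier L\<rbrakk> \<Longrightarrow> const (a \<otimes> b) = const a \<otimes>\<^bsub>C\<^esub> const b"
  by (simp add: lim_mult coherent_const)

lemma const_diff:
  assumes "a \<in> carrier L" "b \<in> carrier L"
  shows "const (a \<ominus> b) = const a \<ominus>\<^bsub>C\<^esub> const b"
proof -
  have "const (a \<ominus> b) \<oplus>\<^bsub>C\<^esub> const b = const a"
    using assms by (simp add: lim_add coherent_const minus_eq a_assoc l_neg)
  moreover have "const (a \<ominus> b) = (const (a \<ominus> b) \<oplus>\<^bsub>C\<^esub> const b) \<ominus>\<^bsub>C\<^esub> const b"
    using const_closed assms by (simp add: C.minus_eq C.a_assoc C.r_neg)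
  ultimately show ?thesis by simp
qed

lemma const_iter_bracket:
  "\<lbrakk>x \<in> carrier L; y \<in> carrier L\<rbrakk>
    \<Longrightarrow> C.iter_bracket (const x) (const y) n = const (iter_bracket x y n)"
  by (induction n) (simp_all add: const_mult iter_bracket_closed)

lemma const_primitive:
  "\<lbrakk>x \<in> carrier L; y \<in> carrier L\<rbrakk>
    \<Longrightarrow> C.primitive (const x) (const y) m j = const (primitive x y m j)"
proof (induction m arbitrary: j)
  case (Suc m)
  then show ?case
    by (simp add: const_iter_bracket const_mult const_diff iter_bracket_closed primitive_closed prod_closed
        del: iter_bracket.simps C.iter_bracket.simps)
qed (simp add: C_zero)

context
  fixes x y assumes x: "x \<in> carrier L" and y: "y \<in> carrier L"
begin

text \<open>With coefficients \<open>g m\<close>, the completion contains the sum of the \<open>g m * y (2 m)\<close> and the sum of the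
  \<open>g m * w m\<close>, where \<open>[x, w m] = [y, y (2 m)]\<close>. The cycle is the combination of wedges whose brackets cancel.\<close>

definition hat_y where "hat_y k = lim (series (coefficient k) (\<lambda>m. iter_bracket x y (2 * m)))"

definition hat_w where "hat_w k = lim (series (coefficient k) (\<lambda>m. primitive x y m 0))"

definition hat_cycle where
  "hat_cycle k = (\<lambda>c. C.wedge (const y) (hat_y k) c \<ominus>\<^bsub>C.U\<^esub> C.wedge (const x) (hat_w k) c)"

lemma even_iter_gam: "iter_bracket x y (2 * m) \<in> gam m"
  using iter_bracket_gam [OF x y, of "2 * m"] lower_central_antimono [of m "2 * m"] by auto

lemma primitive_gam_0: "primitive x y m 0 \<in> gam m"
  using primitive_gam [OF x y, of m 0] by simp

lemma coherent_y: "coherent (series (coefficient k) (\<lambda>m. iter_bracket x y (2 * m)))"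
  by (rule coherent_series [OF even_iter_gam])

lemma coherent_w: "coherent (series (coefficient k) (\<lambda>m. primitive x y m 0))"
  by (rule coherent_series [OF primitive_gam_0])

lemma hat_y_closed: "hat_y k \<in> carrier C"
  unfolding hat_y_def by (rule lim_closed [OF coherent_y])

lemma hat_w_closed: "hat_w k \<in> carrier C"
  unfolding hat_w_def by (rule lim_closed [OF coherent_w])

lemma hat_bracket: "const y \<otimes>\<^bsub>C\<^esub> hat_y k = const x \<otimes>\<^bsub>C\<^esub> hat_w k"
proof -
  have "y \<otimes> series g (\<lambda>m. iter_bracket x y (2 * m)) n = x \<otimes> series g (\<lambda>m. primitive x y m 0) n" for g n
  proof (induction n)
    case (Suc n)
    have c: "series g (\<lambda>m. iter_bracket x y (2 * m)) n \<in> carrier L"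
      "series g (\<lambda>m. primitive x y m 0) n \<in> carrier L"
      unfolding series_def by (intro psum_closed add.nat_pow_closed iter_bracket_closed primitive_closed x y)+
    have "y \<otimes> (multiple (g n) (iter_bracket x y (2 * n))) = x \<otimes> (multiple (g n) (primitive x y n 0))"
      using bracket_primitive [OF x y, of n 0] x y
      by (simp add: prod_multiple_right iter_bracket_closed primitive_closed)
    then show ?case using Suc c x y
      by (simp add: series_def prod_add_right iter_bracket_closed primitive_closed)
  qed (simp add: series_def x y)
  then show ?thesis
    unfolding hat_y_def hat_w_def
    by (simp add: lim_mult coherent_const x y coherent_y coherent_w)
qed

lemma hat_cycle_zeta: "hat_cycle k \<in> C.U.zeta_cycles"
proof -
  have W: "C.wedge (const y) (hat_y k) \<in> C.U.P1" "C.wedge (const x) (hat_w k) \<in> C.U.P1"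
    by (intro C.wedge_P const_closed x y hat_y_closed hat_w_closed)+
  have "C.U.bd (hat_cycle k) = (\<lambda>_. \<zero>\<^bsub>C.U\<^esub>)"
    unfolding hat_cycle_def C.U.bd_diff [OF W] C.wedge_bd [OF const_closed [OF y] hat_y_closed]
      C.wedge_bd [OF const_closed [OF x] hat_w_closed] hat_bracket
    using C.env_closed [OF C.prod_closed [OF const_closed [OF x] hat_w_closed]]
    by (auto simp: C.U.monomial_def fun_eq_iff a_minus_def C.U.r_neg)
  moreover have "hat_cycle k \<in> C.U.P1" unfolding hat_cycle_def by (rule C.U.P_diff [OF W])
  moreover have "uea_augmentation (hat_cycle k c) = 0" for c
    unfolding hat_cycle_def
    using C.wedge_eps [OF const_closed [OF y] hat_y_closed] C.wedge_eps [OF const_closed [OF x] hat_w_closed]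
      C.U.P_values [OF W(1)] C.U.P_values [OF W(2)]
    by (simp add: a_minus_def C.U.eps_add C.U.eps_uminus)
  ultimately show ?thesis by (simp add: C.U.zeta_cycles_def)
qed

text \<open>The coefficient with index \<open>k\<close> contributes nothing: for a single index the cycle is the boundary found
  by telescoping.\<close>

lemma correction_null:
  "C.U.ceq (\<lambda>c. C.wedge (const y) (const (multiple (of_bool b) (iter_bracket x y (2 * k)))) c
      \<ominus>\<^bsub>C.U\<^esub> C.wedge (const x) (const (multiple (of_bool b) (primitive x y k 0))) c) (\<lambda>_. \<zero>\<^bsub>C.U\<^esub>)"
proof -
  have *: "C.U.ceq (\<lambda>c. C.wedge (const y) a c \<ominus>\<^bsub>C.U\<^esub> C.wedge (const x) a' c) (\<lambda>_. \<zero>\<^bsub>C.U\<^esub>)"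
    if a: "a \<in> carrier C" and e: "C.U.ceq (C.wedge (const x) a') (C.wedge (const y) a)" for a a'
  proof -
    have W: "C.wedge (const y) a \<in> C.U.P1" by (intro C.wedge_P const_closed y a)
    have "C.U.ceq (\<lambda>c. C.wedge (const y) a c \<ominus>\<^bsub>C.U\<^esub> C.wedge (const x) a' c)
        (\<lambda>c. C.wedge (const y) a c \<ominus>\<^bsub>C.U\<^esub> C.wedge (const y) a c)"
      by (intro C.U.ceq_diff C.U.ceq_refl W e)
    then show ?thesis using C.U.P_values [OF W] by (simp add: a_minus_def C.U.r_neg)
  qed
  show ?thesis
  proof (cases b)
    case True
    show ?thesis
      using *[OF const_closed [OF iter_bracket_closed [OF x y]]]
        C.wedge_primitive [OF const_closed [OF x] const_closed [OF y], of k 0]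
      by (simp add: True const_iter_bracket const_primitive x y iter_bracket_closed primitive_closed)
  next
    case False
    have "C.U.ceq (C.wedge (const x) \<zero>\<^bsub>C\<^esub>) (C.wedge (const y) \<zero>\<^bsub>C\<^esub>)"
      by (rule C.U.ceq_trans [OF C.wedge_zero_right [OF const_closed [OF x]]
            C.U.ceq_sym [OF C.wedge_zero_right [OF const_closed [OF y]]]])
    then show ?thesis using *[OF C.zero_closed] by (simp add: False C_zero [symmetric])
  qed
qed

lemma hat_cycle_double:
  "C.U.ceq (hat_cycle k) (\<lambda>c. hat_cycle (Suc k) c \<oplus>\<^bsub>C.U\<^esub> hat_cycle (Suc k) c)"
proof -
  let ?e = "of_bool (power_of_two k) :: nat"
  let ?a = "const (multiple ?e (iter_bracket x y (2 * k)))" and ?b = "const (multiple ?e (primitive x y k 0))"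
  let ?x = "const x" and ?y = "const y"
  let ?A = "hat_y (Suc k)" and ?B = "hat_w (Suc k)"
  have cl: "?x \<in> carrier C" "?y \<in> carrier C" "?a \<in> carrier C" "?b \<in> carrier C"
    "?A \<in> carrier C" "?B \<in> carrier C"
    using x y by (auto intro!: const_closed iter_bracket_closed primitive_closed hat_y_closed hat_w_closed
        add.nat_pow_closed)
  have A: "hat_y k = (?A \<oplus>\<^bsub>C\<^esub> ?A) \<oplus>\<^bsub>C\<^esub> ?a"
    unfolding hat_y_def by (rule series_double [OF even_iter_gam coefficient_step])
  have B: "hat_w k = (?B \<oplus>\<^bsub>C\<^esub> ?B) \<oplus>\<^bsub>C\<^esub> ?b"
    unfolding hat_w_def by (rule series_double [OF primitive_gam_0 coefficient_step])
  have lin: "C.U.ceq (C.wedge p ((q \<oplus>\<^bsub>C\<^esub> q) \<oplus>\<^bsub>C\<^esub> r))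
      (\<lambda>c. (C.wedge p q c \<oplus>\<^bsub>C.U\<^esub> C.wedge p q c) \<oplus>\<^bsub>C.U\<^esub> C.wedge p r c)"
    if "p \<in> carrier C" "q \<in> carrier C" "r \<in> carrier C" for p q r
    using that by (intro C.U.ceq_trans [OF C.wedge_add_right] C.U.ceq_add C.wedge_add_right
        C.U.ceq_refl C.wedge_P) auto
  have 1: "C.U.ceq (hat_cycle k)
      (\<lambda>c. ((C.wedge ?y ?A c \<oplus>\<^bsub>C.U\<^esub> C.wedge ?y ?A c) \<oplus>\<^bsub>C.U\<^esub> C.wedge ?y ?a c)
        \<ominus>\<^bsub>C.U\<^esub> ((C.wedge ?x ?B c \<oplus>\<^bsub>C.U\<^esub> C.wedge ?x ?B c) \<oplus>\<^bsub>C.U\<^esub> C.wedge ?x ?b c))"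
    unfolding hat_cycle_def A B by (intro C.U.ceq_diff lin cl)
  have 2: "(\<lambda>c. ((C.wedge ?y ?A c \<oplus>\<^bsub>C.U\<^esub> C.wedge ?y ?A c) \<oplus>\<^bsub>C.U\<^esub> C.wedge ?y ?a c)
        \<ominus>\<^bsub>C.U\<^esub> ((C.wedge ?x ?B c \<oplus>\<^bsub>C.U\<^esub> C.wedge ?x ?B c) \<oplus>\<^bsub>C.U\<^esub> C.wedge ?x ?b c))
    = (\<lambda>c. (hat_cycle (Suc k) c \<oplus>\<^bsub>C.U\<^esub> hat_cycle (Suc k) c)
        \<oplus>\<^bsub>C.U\<^esub> (C.wedge ?y ?a c \<ominus>\<^bsub>C.U\<^esub> C.wedge ?x ?b c))"
  proof
    fix c
    note v = C.U.P_values [OF C.wedge_P [OF cl(2,5)], of c] C.U.P_values [OF C.wedge_P [OF cl(2,3)], of c]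
      C.U.P_values [OF C.wedge_P [OF cl(1,6)], of c] C.U.P_values [OF C.wedge_P [OF cl(1,4)], of c]
    show "((C.wedge ?y ?A c \<oplus>\<^bsub>C.U\<^esub> C.wedge ?y ?A c) \<oplus>\<^bsub>C.U\<^esub> C.wedge ?y ?a c)
        \<ominus>\<^bsub>C.U\<^esub> ((C.wedge ?x ?B c \<oplus>\<^bsub>C.U\<^esub> C.wedge ?x ?B c) \<oplus>\<^bsub>C.U\<^esub> C.wedge ?x ?b c)
      = (hat_cycle (Suc k) c \<oplus>\<^bsub>C.U\<^esub> hat_cycle (Suc k) c)
        \<oplus>\<^bsub>C.U\<^esub> (C.wedge ?y ?a c \<ominus>\<^bsub>C.U\<^esub> C.wedge ?x ?b c)"
      unfolding hat_cycle_def by (rule C.U.double_identity [OF v])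
  qed
  have P: "hat_cycle (Suc k) \<in> C.U.P1" by (rule C.U.zeta_cycles_P [OF hat_cycle_zeta])
  have 3: "C.U.ceq (\<lambda>c. (hat_cycle (Suc k) c \<oplus>\<^bsub>C.U\<^esub> hat_cycle (Suc k) c)
        \<oplus>\<^bsub>C.U\<^esub> (C.wedge ?y ?a c \<ominus>\<^bsub>C.U\<^esub> C.wedge ?x ?b c))
      (\<lambda>c. (hat_cycle (Suc k) c \<oplus>\<^bsub>C.U\<^esub> hat_cycle (Suc k) c) \<oplus>\<^bsub>C.U\<^esub> \<zero>\<^bsub>C.U\<^esub>)"
    by (intro C.U.ceq_add C.U.ceq_refl P correction_null)
  show ?thesis
    using C.U.ceq_trans [OF 1 [unfolded 2] 3] C.U.P_values [OF P] by simp
qed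

lemma hat_class_divisible:
  "C.U.zeta (hat_cycle 0) = C.U.zeta (hat_cycle k) [^]\<^bsub>C.U.H2\<^esub> ((2::nat) ^ k)"
proof -
  have "C.U.zeta (hat_cycle k)
      = C.U.zeta (hat_cycle (Suc k)) \<otimes>\<^bsub>C.U.H2\<^esub> C.U.zeta (hat_cycle (Suc k))" for k
    by (rule trans [OF C.U.ceq_zeta_cycles [OF hat_cycle_double hat_cycle_zeta
            C.U.zeta_cycles_add [OF hat_cycle_zeta hat_cycle_zeta]]
          C.U.zeta_add [OF hat_cycle_zeta hat_cycle_zeta]])
  from C.U.doubling_divisible [of hat_cycle, OF hat_cycle_zeta this, of 0 k]
  show ?thesis by (simp only: add_0)
qed

end

end

section \<open>The class is nonzero\<close>

text \<open>Multiplication by \<open>s + t\<close> sends a product \<open>u(s) v(t)\<close> to the sum of two products.\<close>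

lemma shift2_finite_rank: "w \<in> finite_rank \<Longrightarrow> shift2 w \<in> finite_rank"
proof (induction w rule: finite_rank_induct)
  case zero
  have "shift2 (\<lambda>i j. 0) = (\<lambda>i j. 0)" by (auto simp: shift2_def fun_eq_iff split: nat.split)
  then show ?case by (simp add: finite_rank_zero)
next
  case (step m u v)
  have "shift2 (\<lambda>i j. m i j + u i * v j)
      = (\<lambda>i j. (shift2 m i j + shift1 u i * v j) + u i * shift1 v j)"
    by (auto simp: shift2_def shift1_def fun_eq_iff split: nat.split)
  then show ?case using step by (simp add: finite_rank_add_rank_one)
qed

lemma shift2_linear:
  "shift2 (\<lambda>i j. r * w i j + s * w' i j) = (\<lambda>i j. r * shift2 w i j + s * shift2 w' i j)"
  by (auto simp: shift2_def fun_eq_iff algebra_simps split: nat.split)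

lemma shift2_power_linear:
  "(shift2 ^^ n) (\<lambda>i j. r * w i j + s * w' i j) = (\<lambda>i j. r * (shift2 ^^ n) w i j + s * (shift2 ^^ n) w' i j)"
  by (induction n) (simp_all add: shift2_linear)

lemma shift2_power_finite_rank: "w \<in> finite_rank \<Longrightarrow> (shift2 ^^ n) w \<in> finite_rank"
  by (induction n) (simp_all add: shift2_finite_rank)

context free_lie
begin

definition gen_x where "gen_x = NI.cls (frag_of (Gen xg))"

definition gen_y where "gen_y = NI.cls (frag_of (Gen yg))"

lemma gen_closed: "gen_x \<in> carrier f" "gen_y \<in> carrier f"
  unfolding gen_x_def gen_y_def f_def NI.Quot_carrier using xg yg by auto

lemma eval_gen: "lie_eval gen_x = (\<lambda>k. of_bool (k = Px))" "lie_eval gen_y = (\<lambda>k. of_bool (k = Au 0))"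
  unfolding gen_x_def gen_y_def using xg yg xyg
  by (simp_all add: lie_eval_cls free_eval_def [abs_def])

lemma eval_iter_bracket: "lie_eval (f.iter_bracket gen_x gen_y n) = (\<lambda>k. of_bool (k = Au n))"
proof (induction n)
  case 0
  then show ?case by (simp add: eval_gen)
next
  case (Suc n)
  have "br (\<lambda>k. of_bool (k = Px)) (\<lambda>k. of_bool (k = Au n)) i = of_bool (i = Au (Suc n))" for i
    by (cases i) (auto simp: shift1_def shift2_def split: nat.split)
  then have "br (\<lambda>k. of_bool (k = Px)) (\<lambda>k. of_bool (k = Au n)) = (\<lambda>k. of_bool (k = Au (Suc n)))" ..
  moreover have "lie_eval (f.iter_bracket gen_x gen_y (Suc n))
      = br (lie_eval gen_x) (lie_eval (f.iter_bracket gen_x gen_y n))"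
    using gen_closed by (simp add: lie_eval_mult f.iter_bracket_closed)
  ultimately show ?case by (simp only: Suc eval_gen)
qed

lemma eval_primitive:
  "lie_eval (f.primitive gen_x gen_y m j) (Ww a b)
    = (if j \<le> a \<and> j \<le> b \<and> a + b + 1 = 2 * j + 2 * m then (- 1) ^ (a + j) else 0)"
proof (induction m arbitrary: j)
  case 0
  then show ?case by (simp add: lie_eval_zero)
next
  case (Suc m)
  have "lie_eval (f.primitive gen_x gen_y (Suc m) j) (Ww a b)
    = br (\<lambda>k. of_bool (k = Au j)) (\<lambda>k. of_bool (k = Au (j + 2 * m + 1))) (Ww a b)
      - lie_eval (f.primitive gen_x gen_y m (Suc j)) (Ww a b)"
    using gen_closed
    by (simp add: lie_eval_diff lie_eval_mult f.prod_closed f.iter_bracket_closed f.primitive_closed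
        eval_iter_bracket del: f.iter_bracket.simps br.simps)
  also have "br (\<lambda>k. of_bool (k = Au j)) (\<lambda>k. of_bool (k = Au (j + 2 * m + 1))) (Ww a b)
    = of_bool (a = j \<and> b = j + 2 * m + 1) - of_bool (a = j + 2 * m + 1 \<and> b = j)"
    by (auto simp: shift2_def split: nat.split)
  finally have eq: "lie_eval (f.primitive gen_x gen_y (Suc m) j) (Ww a b)
    = of_bool (a = j \<and> b = j + 2 * m + 1) - of_bool (a = j + 2 * m + 1 \<and> b = j)
      - (if Suc j \<le> a \<and> Suc j \<le> b \<and> a + b + 1 = 2 * Suc j + 2 * m then (- 1) ^ (a + Suc j) else 0)"
    by (simp only: Suc)
  show ?case
  proof (cases "j \<le> a \<and> j \<le> b \<and> a + b + 1 = 2 * j + 2 * Suc m")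
    case False
    then show ?thesis unfolding eq by auto
  next
    case True
    consider "a = j" | "b = j" | "Suc j \<le> a \<and> Suc j \<le> b" using True by linarith
    then show ?thesis
    proof cases
      case 1
      then show ?thesis unfolding eq using True by (auto simp: mult_2 [symmetric])
    next
      case 2
      then have "a = j + 2 * m + 1" "a + j = 2 * (j + m) + 1" using True by auto
      then show ?thesis unfolding eq using True 2 by simp
    next
      case 3
      then show ?thesis unfolding eq using True by auto
    qed
  qed
qed

lemma eval_primitive_0:
  "lie_eval (f.primitive gen_x gen_y m 0) (Ww a b) = (if a + b + 1 = 2 * m then (- 1) ^ a else 0)"
  by (simp add: eval_primitive)

lemma eval_primitive_Px: "lie_eval (f.primitive gen_x gen_y m j) Px = 0"
  using gen_closed
  by (induction m arbitrary: j)
    (simp_all add: lie_eval_zero lie_eval_diff lie_eval_mult f.prod_closed f.iter_bracket_closed f.primitive_closed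
      del: f.iter_bracket.simps)

lemma eval_multiple: "a \<in> carrier f \<Longrightarrow> lie_eval (f.multiple n a) i = of_nat n * lie_eval a i"
  by (induction n) (simp_all add: lie_eval_zero lie_eval_add algebra_simps)

lemma eval_series:
  assumes "\<And>m. u m \<in> carrier f"
  shows "lie_eval (f.series g u n) i = (\<Sum>m<n. of_nat (g m) * lie_eval (u m) i)"
proof (induction n)
  case (Suc n)
  have "f.series g u n \<in> carrier f" unfolding f.series_def by (rule f.psum_closed) (simp add: assms)
  then show ?case using Suc assms by (simp add: f.series_def lie_eval_add eval_multiple)
qed (simp add: f.series_def lie_eval_zero)

lemma hat_eval_w: "hat_eval (f.hat_w gen_x gen_y 0) (Ww a b) = hankel a b"
proof -
  define n where "n = a + b + 2"
  have "hat_eval (f.hat_w gen_x gen_y 0) (Ww a b)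
      = lie_eval (f.series (coefficient 0) (\<lambda>m. f.primitive gen_x gen_y m 0) n) (Ww a b)"
    unfolding f.hat_w_def [OF gen_closed]
    by (rule hat_eval_lim [OF f.coherent_w [OF gen_closed]]) (simp add: n_def)
  also have "\<dots> = (\<Sum>m<n. of_nat (coefficient 0 m) * (if a + b + 1 = 2 * m then (- 1) ^ a else 0))"
    unfolding eval_series [OF f.primitive_closed [OF gen_closed]] eval_primitive_0 ..
  also have "\<dots> = (\<Sum>m<n. if m = (a + b + 1) div 2 then
      (if odd (a + b) then of_nat (coefficient 0 m) * (- 1) ^ a else 0) else 0)"
  proof (rule sum.cong [OF refl])
    fix m
    have "a + b + 1 = 2 * m \<longleftrightarrow> m = (a + b + 1) div 2 \<and> odd (a + b)" by presburger
    then show "of_nat (coefficient 0 m) * (if a + b + 1 = 2 * m then (- 1) ^ a else 0)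
      = (if m = (a + b + 1) div 2 then
          (if odd (a + b) then of_nat (coefficient 0 m) * (- 1) ^ a else 0) else (0::real))"
      by (simp only: if_distrib simp_thms mult_zero_right split: if_split)
        (cases "m = (a + b + 1) div 2"; cases "odd (a + b)"; simp)
  qed
  also have "\<dots> = (if odd (a + b) then of_nat (coefficient 0 ((a + b + 1) div 2)) * (- 1) ^ a else 0)"
  proof -
    have "(a + b + 1) div 2 < n" by (simp add: n_def)
    then show ?thesis by simp
  qed
  also have "\<dots> = hankel a b"
    by (simp add: hankel_def coefficient_def Let_def)
  finally show ?thesis .
qed

lemma hat_eval_Px: "hat_eval (f.const gen_x) Px = 1" "hat_eval (f.const gen_y) Px = 0"
  "hat_eval (f.hat_w gen_x gen_y k) Px = 0" "hat_eval (f.hat_y gen_x gen_y k) Px = 0"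
proof -
  show "hat_eval (f.const gen_x) Px = 1" "hat_eval (f.const gen_y) Px = 0"
    using hat_eval_lim [OF f.coherent_const [OF gen_closed(1)] order.refl, of Px]
      hat_eval_lim [OF f.coherent_const [OF gen_closed(2)] order.refl, of Px]
    by (simp_all add: eval_gen)
  show "hat_eval (f.hat_w gen_x gen_y k) Px = 0"
    using hat_eval_lim [where i = Px, OF f.coherent_w [OF gen_closed] order.refl] gen_closed
    by (simp add: f.hat_w_def eval_series f.primitive_closed eval_primitive_Px lie_eval_zero)
  show "hat_eval (f.hat_y gen_x gen_y k) Px = 0"
    using hat_eval_lim [where i = Px, OF f.coherent_y [OF gen_closed] order.refl] gen_closed
    by (simp add: f.hat_y_def eval_series f.iter_bracket_closed eval_iter_bracket eval_gen)
qed

text \<open>The matrix part of an element is a derivation modulo the products \<open>u(s) v(t)\<close> contributed by brackets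
  of two \<open>y\<close>-parts, that is, modulo finite rank. A functional that kills finite rank matrices therefore
  defines a detection, whose value on the cycle is that of the matrix \<^const>\<open>hankel\<close> up to sign.\<close>

lemma hat_class_nonzero:
  "f.C.U.zeta (f.hat_cycle gen_x gen_y 0) \<noteq> \<one>\<^bsub>f.C.U.H2\<^esub>"
proof
  assume one: "f.C.U.zeta (f.hat_cycle gen_x gen_y 0) = \<one>\<^bsub>f.C.U.H2\<^esub>"
  obtain lam :: "matrix \<Rightarrow> real" where
    add: "\<And>a b. lam (\<lambda>i j. a i j + b i j) = lam a + lam b"
    and scale: "\<And>r a. lam (\<lambda>i j. r * a i j) = r * lam a"
    and fr: "\<And>a. a \<in> finite_rank \<Longrightarrow> lam a = 0" and hk: "lam hankel = 1"
    using separating_functional [OF hankel_infinite_rank] by metis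
  have lin: "lam (\<lambda>i j. r * a i j + s * b i j) = r * lam a + s * lam b" for r s a b
    using add [of "\<lambda>i j. r * a i j" "\<lambda>i j. s * b i j"] scale by simp
  define mat where "mat s = (\<lambda>a b. hat_eval s (Ww a b))" for s
  define p where "p s = hat_eval s Px" for s
  define delta where "delta s n = lam ((shift2 ^^ n) (mat s))" for s and n :: nat
  interpret D: detection f.C p delta
  proof
    fix s t assume st: "s \<in> carrier f.C" "t \<in> carrier f.C"
    show "p (s \<oplus>\<^bsub>f.C\<^esub> t) = p s + p t" unfolding p_def by (rule hat_eval_add [OF st])
    show "p (s \<otimes>\<^bsub>f.C\<^esub> t) = 0" unfolding p_def hat_eval_mult [OF st] by simp
    have m_add: "mat (s \<oplus>\<^bsub>f.C\<^esub> t) = (\<lambda>i j. 1 * mat s i j + 1 * mat t i j)"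
      by (simp add: mat_def hat_eval_add [OF st])
    show "delta (s \<oplus>\<^bsub>f.C\<^esub> t) n = delta s n + delta t n" for n
      unfolding delta_def m_add shift2_power_linear lin by simp
    let ?u = "\<lambda>i. hat_eval s (Au i)" and ?v = "\<lambda>i. hat_eval t (Au i)"
    have m: "mat (s \<otimes>\<^bsub>f.C\<^esub> t) = (\<lambda>i j. 1 * (p s * shift2 (mat t) i j + (- p t) * shift2 (mat s) i j)
        + 1 * (?u i * ?v j + (- ?v i) * ?u j))"
      by (simp add: mat_def hat_eval_mult [OF st] p_def fun_eq_iff)
    have "(\<lambda>i j. ?u i * ?v j + (- ?v i) * ?u j) \<in> finite_rank"
      by (rule finite_rank_add_rank_one [OF finite_rank_one])
    then have "lam ((shift2 ^^ n) (\<lambda>i j. ?u i * ?v j + (- ?v i) * ?u j)) = 0" for n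
      by (intro fr shift2_power_finite_rank)
    then show "delta (s \<otimes>\<^bsub>f.C\<^esub> t) n = p s * delta t (Suc n) - p t * delta s (Suc n)" for n
      unfolding delta_def m by (simp only: shift2_power_linear lin) (simp add: funpow_swap1)
  qed
  let ?x = "f.const gen_x" and ?y = "f.const gen_y"
  let ?A = "f.hat_y gen_x gen_y 0" and ?B = "f.hat_w gen_x gen_y 0"
  have cl: "?x \<in> carrier f.C" "?y \<in> carrier f.C" "?A \<in> carrier f.C" "?B \<in> carrier f.C"
    by (intro f.const_closed gen_closed f.hat_y_closed f.hat_w_closed)+
  let ?c = "f.hat_cycle gen_x gen_y 0"
  have z: "?c \<in> f.C.U.zeta_cycles" by (rule f.hat_cycle_zeta [OF gen_closed])
  have "D.eval1 ?c 1 = 0"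
    using D.eval1_null f.C.U.zeta_eq_one_iff [OF z] one by blast
  moreover have "(\<lambda>c. ?c c \<oplus>\<^bsub>f.C.U\<^esub> f.C.wedge ?x ?B c) = f.C.wedge ?y ?A"
    unfolding f.hat_cycle_def [OF gen_closed]
    using f.C.U.P_values [OF f.C.wedge_P [OF cl(2,3)]] f.C.U.P_values [OF f.C.wedge_P [OF cl(1,4)]]
    by (simp add: a_minus_def f.C.U.a_assoc f.C.U.l_neg)
  then have "D.eval1 ?c 1 + D.eval1 (f.C.wedge ?x ?B) 1 = D.eval1 (f.C.wedge ?y ?A) 1"
    using D.eval1_add [OF f.C.U.zeta_cycles_P [OF z] f.C.wedge_P [OF cl(1,4)]] by simp
  ultimately have "D.eval1 (f.C.wedge ?x ?B) 1 = D.eval1 (f.C.wedge ?y ?A) 1" by simp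
  then have "delta ?B 0 = 0"
    unfolding D.eval1_wedge [OF cl(1,4)] D.eval1_wedge [OF cl(2,3)]
    by (simp add: p_def hat_eval_Px)
  moreover have "mat ?B = hankel" by (simp add: mat_def hat_eval_w)
  ultimately show False using hk by (simp add: delta_def)
qed

end

lemma trivial_module_int_module: "trivial_module = int_module uea_augmentation"
  by (simp add: trivial_module_def int_module_def)

theorem theoremB:
  fixes S :: "'x set"
  assumes "card S = 2"
  shows "(let H = lie_homology 2 (pronilpotent_completion (free_lie_ring S)) in
           \<exists>z\<in>carrier H. z \<noteq> \<one>\<^bsub>H\<^esub> \<and>
             (\<forall>k\<ge>1. \<exists>y\<in>carrier H. z = y [^]\<^bsub>H\<^esub> ((2::nat) ^ k)))
         \<and> cohomological_dimension (pronilpotent_completion (free_lie_ring S)) > 2"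
proof -
  obtain a b where S: "S = {a, b}" "a \<noteq> b" using assms by (auto simp: card_2_iff)
  interpret free_lie S a b by unfold_locales (use S in auto)
  let ?H = "f.C.U.H2"
  let ?z = "f.C.U.zeta (f.hat_cycle gen_x gen_y 0)"
  have H: "lie_homology 2 f.C = ?H"
    unfolding lie_homology_def trivial_module_int_module ..
  have zc: "f.C.U.zeta (f.hat_cycle gen_x gen_y k) \<in> carrier ?H" for k
    by (rule f.C.U.zeta_closed [OF f.hat_cycle_zeta [OF gen_closed]])
  have div: "\<exists>y\<in>carrier ?H. ?z = y [^]\<^bsub>?H\<^esub> ((2::nat) ^ k)" for k
    using f.hat_class_divisible [OF gen_closed] zc by blast
  have "carrier (Ext 3 f.C.U f.C.U.T f.C.U.cycle_module)
      \<noteq> {\<one>\<^bsub>Ext 3 f.C.U f.C.U.T f.C.U.cycle_module\<^esub>}"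
    by (rule f.C.U.divisible_Tor_imp_Ext [OF zc hat_class_nonzero div])
  then have "carrier (lie_cohomology 3 f.C f.C.U.cycle_module)
      \<noteq> {\<one>\<^bsub>lie_cohomology 3 f.C f.C.U.cycle_module\<^esub>}"
    unfolding lie_cohomology_def trivial_module_int_module .
  then have "enat 3 \<le> cohomological_dimension f.C"
    unfolding cohomological_dimension_def
    by (intro Sup_upper CollectI exI [of _ 3] exI [of _ f.C.U.cycle_module] conjI refl
        f.C.U.cycle_module_left_module)
  moreover have "(2::enat) < enat 3" by (simp add: numeral_eq_enat)
  ultimately have cd: "2 < cohomological_dimension f.C" by (rule less_le_trans [rotated])
  show ?thesis
    unfolding H Let_def
    by (intro conjI bexI [of _ ?z] allI impI hat_class_nonzero div zc cd)
qed

end
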